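(* Let $\mathsf{k}$ be a separable Hilbert space, let $\mathcal{F}^{\mathsf{k}}$ be the Fock Arveson system over $\mathsf{k}$ and let $\Omega^{\mathsf{k}}$ be its vacuum unit. For $c\in\mathsf{k}$ let $\chi^c=(\chi^c_t)_{t>0}$, where $\chi^c_t\in\mathcal{F}^{\mathsf{k}}_t$ is the one-particle vector $c_{[0,t[}\in L^2([0,t[;\mathsf{k})$, that is, the function equal to $c$ on $[0,t[$ (and $0$ elsewhere). Then the prescription $c\mapsto\chi^c$ defines an isometric isomorphism from $\mathsf{k}$ to the Hilbert space of roots of the pointed Arveson system $(\mathcal{F}^{\mathsf{k}},\Omega^{\mathsf{k}})$.
   Context: Inner products are linear in the second argument. Let $\Gamma(\mathsf{H})$ denote symmetric Fock space over a Hilbert space $\mathsf{H}$, with exponential vectors $\varepsilon(h)=((n!)^{-1/2}h^{\otimes n})_{n\ge0}$. Let $\mathsf{K}=L^2(\mathbb{R}_+;\mathsf{k})$, $\mathsf{K}_t=\{g\in\mathsf{K}:\operatorname{ess\text{-}supp} g\subset[0,t]\}$, and let $(S_t)_{t\ge0}$ be the semigroup of unilateral (right) shifts on $\mathsf{K}$. The Fock Arveson system $\mathcal{F}^{\mathsf{k}}$ has fibres $\mathcal{F}^{\mathsf{k}}_t=\overline{\operatorname{Lin}}\{\varepsilon(g):g\in\mathsf{K}_t\}=\Gamma(\mathsf{K}_t)\subset\Gamma(\mathsf{K})$ ($t>0$), and unitary structure maps $B_{s,t}:\mathcal{F}^{\mathsf{k}}_{s+t}\to\mathcal{F}^{\mathsf{k}}_s\otimes\mathcal{F}^{\mathsf{k}}_t$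 determined by $\varepsilon(h)\mapsto\varepsilon(h_{[0,s[})\otimes\varepsilon(S_s^*h)$ ($h\in\mathsf{K}_{s+t}$), where $h_{[0,s[}$ equals $h$ on $[0,s[$ and $0$ elsewhere. A section is measurable if it is measurable as a map into $\Gamma(\mathsf{K})$. For $x\in\mathcal{F}^{\mathsf{k}}_s$, $y\in\mathcal{F}^{\mathsf{k}}_t$, $x\cdot y:=B_{s,t}^*(x\otimes y)$. The vacuum unit is $\Omega^{\mathsf{k}}=(\Omega^{\mathsf{k}}_t)_{t>0}$ with $\Omega^{\mathsf{k}}_t=\varepsilon(0)$. A root of $(\mathcal{F}^{\mathsf{k}},\Omega^{\mathsf{k}})$ is a measurable section $a$ (i.e. $a_t\in\mathcal{F}^{\mathsf{k}}_t$) such that $a_{s+t}=a_s\cdot\Omega^{\mathsf{k}}_t+\Omega^{\mathsf{k}}_s\cdot a_t$ and $\langle\Omega^{\mathsf{k}}_t,a_t\rangle=0$ for all $s,t>0$. The space of roots is a Hilbert space under pointwise operations and the inner product $\langle a,b\rangle:=\langle a_1,b_1\rangle$. *)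

theory Defs
  imports "HOL-Analysis.Analysis"
begin

subsection \<open>Complex Hilbert spaces\<close>

text \<open>
  Complex inner product spaces: the form \<open>cinner\<close> is linear in the second argument. The class extends
  \<^class>\<open>real_inner\<close> by the underlying real structure, whose inner product is the real part of \<open>cinner\<close>,
  so that the norm and topology are those of the library.
\<close>

class complex_inner = real_inner +
  fixes scaleC :: "complex \<Rightarrow> 'a \<Rightarrow> 'a" (infixr "*\<^sub>C" 75)
    and cinner :: "'a \<Rightarrow> 'a \<Rightarrow> complex"
  assumes scaleC_add_right: "a *\<^sub>C (x + y) = a *\<^sub>C x + a *\<^sub>C y"
    and scaleC_add_left: "(a + b) *\<^sub>C x = a *\<^sub>C x + b *\<^sub>C x"
    and scaleC_scaleC: "a *\<^sub>C b *\<^sub>C x = (a * b) *\<^sub>C x"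
    and scaleR_scaleC: "r *\<^sub>R x = complex_of_real r *\<^sub>C x"
    and cinner_commute: "cinner x y = cnj (cinner y x)"
    and cinner_add_right: "cinner x (y + z) = cinner x y + cinner x z"
    and cinner_scaleC_right: "cinner x (a *\<^sub>C y) = a * cinner x y"
    and inner_eq_Re_cinner: "inner x y = Re (cinner x y)"

class complex_hilbert_space = complex_inner + complete_space
begin
subclass banach ..
end

lemma scaleC_one [simp]: "1 *\<^sub>C x = (x :: 'a::complex_inner)"
  by (metis of_real_1 scaleR_scaleC scaleR_one)

global_interpretation complex_vector: vector_space "scaleC :: complex \<Rightarrow> 'a \<Rightarrow> 'a::complex_inner"
  defines csubspace = complex_vector.subspace
    and cspan = complex_vector.span
  by unfold_locales (auto simp: scaleC_add_right scaleC_add_left scaleC_scaleC)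

lemma cinner_add_left: "cinner (x + y) z = cinner x z + cinner y (z :: 'a::complex_inner)"
  by (metis cinner_add_right cinner_commute complex_cnj_add)

lemma cinner_scaleC_left: "cinner (a *\<^sub>C x) y = cnj a * cinner x (y :: 'a::complex_inner)"
  by (metis cinner_commute cinner_scaleC_right complex_cnj_mult)

lemma cinner_zero_right [simp]: "cinner x (0 :: 'a::complex_inner) = 0"
  using cinner_add_right[of x 0 0] by simp

lemma cinner_zero_left [simp]: "cinner (0 :: 'a::complex_inner) x = 0"
  using cinner_add_left[of 0 0 x] by simp

lemma cinner_sum_right: "cinner x (\<Sum>i\<in>I. f i) = (\<Sum>i\<in>I. cinner x (f i :: 'a::complex_inner))"
  by (induction I rule: infinite_finite_induct) (auto simp: cinner_add_right)

lemma cinner_sum_left: "cinner (\<Sum>i\<in>I. f i) x = (\<Sum>i\<in>I. cinner (f i) (x :: 'a::complex_inner))"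
  by (induction I rule: infinite_finite_induct) (auto simp: cinner_add_left)

lemma cinner_minus_right: "cinner x (- y :: 'a::complex_inner) = - cinner x y"
  using cinner_add_right[of x y "- y"] by (simp add: eq_neg_iff_add_eq_0 add.commute)

lemma cinner_diff_right: "cinner x (y - z :: 'a::complex_inner) = cinner x y - cinner x z"
  using cinner_add_right[of x y "- z"] by (simp add: cinner_minus_right)

lemma cinner_eq_Complex:
  "cinner x y = Complex (inner x y) (inner (\<i> *\<^sub>C x) (y :: 'a::complex_inner))"
  by (simp add: complex_eq_iff inner_eq_Re_cinner cinner_scaleC_left)

lemma cinner_self: "cinner x x = complex_of_real ((norm (x :: 'a::complex_inner))\<^sup>2)"
proof -
  have "Im (cinner x x) = 0"
    using arg_cong[OF cinner_commute[of x x], of Im] by simp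
  moreover have "Re (cinner x x) = (norm x)\<^sup>2"
    using inner_eq_Re_cinner[of x x] by (simp add: dot_square_norm)
  ultimately show ?thesis by (simp add: complex_eq_iff)
qed

lemma tendsto_cinner_right:
  assumes "(f \<longlongrightarrow> l) F"
  shows "((\<lambda>i. cinner x (f i)) \<longlongrightarrow> cinner x (l :: 'a::complex_inner)) F"
  unfolding cinner_eq_Complex
  by (intro tendsto_Complex tendsto_inner tendsto_const assms)

instantiation complex :: complex_hilbert_space
begin

definition scaleC_complex :: "complex \<Rightarrow> complex \<Rightarrow> complex" where
  "scaleC_complex a x = a * x"

definition cinner_complex :: "complex \<Rightarrow> complex \<Rightarrow> complex" where
  "cinner_complex x y = cnj x * y"

instance
  by standard (simp_all add: scaleC_complex_def cinner_complex_def inner_complex_def scaleR_conv_of_real algebra_simps)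

end

subsection \<open>Orthonormal bases\<close>

definition orthonormal :: "'a::complex_inner set \<Rightarrow> bool" where
  "orthonormal B \<longleftrightarrow> (\<forall>x\<in>B. \<forall>y\<in>B. cinner x y = (if x = y then 1 else 0))"

definition orthonormal_basis :: "'a::complex_inner set \<Rightarrow> bool" where
  "orthonormal_basis B \<longleftrightarrow> orthonormal B \<and> closure (cspan B) = UNIV"

lemma orthonormal_subset: "orthonormal B \<Longrightarrow> A \<subseteq> B \<Longrightarrow> orthonormal A"
  unfolding orthonormal_def by blast

lemma cinner_orthonormal_sum:
  assumes "orthonormal B" "finite F" "F \<subseteq> B" "b \<in> B"
  shows "cinner b (\<Sum>a\<in>F. c a *\<^sub>C a) = (if b \<in> F then c b else 0)"
proof -
  have "cinner b (\<Sum>a\<in>F. c a *\<^sub>C a) = (\<Sum>a\<in>F. if b = a then c a else 0)"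
    unfolding cinner_sum_right using assms
    by (intro sum.cong) (auto simp: cinner_scaleC_right orthonormal_def)
  then show ?thesis using assms by simp
qed

lemma norm_orthonormal_sum:
  assumes "orthonormal F" "finite F"
  shows "(norm (\<Sum>b\<in>F. c b *\<^sub>C b))\<^sup>2 = (\<Sum>b\<in>F. (cmod (c b))\<^sup>2)"
proof -
  have "complex_of_real ((norm (\<Sum>b\<in>F. c b *\<^sub>C b))\<^sup>2) = (\<Sum>b\<in>F. cnj (c b) * c b)"
    unfolding cinner_self[symmetric] 
    by (subst cinner_sum_left, intro sum.cong refl)
       (use assms in \<open>simp add: cinner_scaleC_left cinner_orthonormal_sum[of F F]\<close>)
  also have "\<dots> = complex_of_real (\<Sum>b\<in>F. (cmod (c b))\<^sup>2)"
    by (simp add: complex_norm_square[symmetric] mult.commute del: of_real_power)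
  finally show ?thesis by (simp only: of_real_eq_iff)
qed

lemma bessel:
  assumes "orthonormal F" "finite F"
  shows "(\<Sum>b\<in>F. (cmod (cinner b x))\<^sup>2) \<le> (norm x)\<^sup>2"
proof -
  define p where "p = (\<Sum>b\<in>F. cinner b x *\<^sub>C b)"
  have "cinner p x = (\<Sum>b\<in>F. cnj (cinner b x) * cinner b x)"
    by (simp add: p_def cinner_sum_left cinner_scaleC_left)
  also have "\<dots> = complex_of_real (\<Sum>b\<in>F. (cmod (cinner b x))\<^sup>2)"
    by (simp add: complex_norm_square[symmetric] mult.commute del: of_real_power)
  finally have "inner p x = (\<Sum>b\<in>F. (cmod (cinner b x))\<^sup>2)"
    by (simp only: inner_eq_Re_cinner Re_complex_of_real)
  moreover have "(norm p)\<^sup>2 = (\<Sum>b\<in>F. (cmod (cinner b x))\<^sup>2)"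
    unfolding p_def by (rule norm_orthonormal_sum[OF assms])
  moreover have "0 \<le> (norm (x - p))\<^sup>2" by simp
  ultimately show ?thesis
    by (simp add: power2_norm_eq_inner inner_diff_left inner_diff_right inner_commute)
qed

lemma orthonormal_maximal_total:
  fixes B :: "'a::complex_hilbert_space set"
  assumes B: "orthonormal B" and max: "\<And>C. orthonormal C \<Longrightarrow> B \<subseteq> C \<Longrightarrow> C = B"
  shows "closure (cspan B) = UNIV"
proof -
  have "x \<in> closure (cspan B)" for x :: 'a
  proof -
    define S where "S F = (\<Sum>b\<in>F. (cmod (cinner b x))\<^sup>2)" for F
    define A where "A = S ` {F. finite F \<and> F \<subseteq> B}"
    have bdd: "bdd_above A"
      unfolding A_def S_def using bessel orthonormal_subset[OF B]
      by (intro bdd_aboveI2[where M = "(norm x)\<^sup>2"]) auto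
    have ne: "A \<noteq> {}" unfolding A_def by auto
    have upper: "S F \<le> Sup A" if "finite F" "F \<subseteq> B" for F
      using that bdd by (auto simp: A_def intro!: cSup_upper)
    have "\<exists>F. finite F \<and> F \<subseteq> B \<and> S F > Sup A - inverse (real (Suc n))" for n
    proof -
      have "Sup A - inverse (real (Suc n)) < Sup A" by simp
      then obtain a where "a \<in> A" "a > Sup A - inverse (real (Suc n))"
        using less_cSup_iff[OF ne bdd] by blast
      then show ?thesis by (auto simp: A_def)
    qed
    then obtain F where F: "\<And>n. finite (F n)" "\<And>n. F n \<subseteq> B"
      "\<And>n. S (F n) > Sup A - inverse (real (Suc n))" by metis
    define G where "G n = (\<Union>k\<le>n. F k)" for n
    have G: "finite (G n)" "G n \<subseteq> B" "F n \<subseteq> G n" for n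
      using F by (auto simp: G_def)
    have Gmono: "G m \<subseteq> G n" if "m \<le> n" for m n
      using that by (fastforce simp: G_def)
    have SG: "S (G n) > Sup A - inverse (real (Suc n))" for n
      using F(3)[of n] sum_mono2[OF G(1) G(3), of n "\<lambda>b. (cmod (cinner b x))\<^sup>2"]
      unfolding S_def by simp
    define y where "y n = (\<Sum>b\<in>G n. cinner b x *\<^sub>C b)" for n
    have dist_y: "(norm (y n - y m))\<^sup>2 < inverse (real (Suc m))" if "m \<le> n" for m n
    proof -
      have "y n - y m = (\<Sum>b\<in>G n - G m. cinner b x *\<^sub>C b)"
        unfolding y_def using Gmono[OF that] G(1) by (simp add: sum_diff)
      then have "(norm (y n - y m))\<^sup>2 = S (G n - G m)"
        unfolding S_def using norm_orthonormal_sum[of "G n - G m" "\<lambda>b. cinner b x"]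
        orthonormal_subset[OF B, of "G n - G m"] G[of n] by auto
      also have "\<dots> = S (G n) - S (G m)"
        unfolding S_def using Gmono[OF that] G(1) by (simp add: sum_diff)
      also have "\<dots> < inverse (real (Suc m))"
        using upper[OF G(1,2)[of n]] SG[of m] by simp
      finally show ?thesis .
    qed
    have "Cauchy y"
    proof (rule metric_CauchyI)
      fix e :: real assume "e > 0"
      then obtain N where N: "inverse (real (Suc N)) < (e/2)\<^sup>2"
        using reals_Archimedean[of "(e/2)\<^sup>2"] by auto
      have *: "dist (y n) (y N) < e/2" if "n \<ge> N" for n
      proof -
        have "(norm (y n - y N))\<^sup>2 < (e/2)\<^sup>2" using dist_y[OF that] N by simp
        then show ?thesis unfolding dist_norm by (rule power2_less_imp_less) (use \<open>e > 0\<close> in simp)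
      qed
      show "\<exists>M. \<forall>m\<ge>M. \<forall>n\<ge>M. dist (y m) (y n) < e"
        by (rule exI[of _ N]) (auto intro: dist_triangle_half_l * simp: dist_commute)
    qed
    then obtain z where z: "y \<longlonglongrightarrow> z" using Cauchy_convergent convergent_def by blast
    have yin: "y n \<in> cspan B" for n
      unfolding y_def using G(2)[of n] 
      by (intro complex_vector.span_sum complex_vector.span_scale complex_vector.span_base) auto
    have zin: "z \<in> closure (cspan B)"
      using z yin by (auto simp: closure_sequential)
    have orth: "cinner b (x - z) = 0" if b: "b \<in> B" for b
    proof -
      have lim: "(\<lambda>n. cinner b (x - y n)) \<longlonglongrightarrow> cinner b (x - z)"
        by (intro tendsto_cinner_right tendsto_diff tendsto_const z)
      have val: "cinner b (x - y n) = (if b \<in> G n then 0 else cinner b x)" for n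
        unfolding y_def cinner_diff_right using cinner_orthonormal_sum[OF B G(1,2)[of n] b] by auto
      have "(\<lambda>n. cinner b (x - y n)) \<longlonglongrightarrow> 0"
      proof (cases "\<exists>n. b \<in> G n")
        case True
        then obtain N where "b \<in> G N" by blast
        then have "\<forall>n\<ge>N. cinner b (x - y n) = 0" using Gmono val by auto
        then show ?thesis by (intro tendsto_eventually) (auto simp: eventually_sequentially)
      next
        case False
        have "(cmod (cinner b x))\<^sup>2 \<le> inverse (real (Suc n))" for n
        proof -
          have "S (insert b (G n)) = (cmod (cinner b x))\<^sup>2 + S (G n)"
            unfolding S_def using False G(1) by simp
          moreover have "S (insert b (G n)) \<le> Sup A"
            using G b by (intro upper) auto
          ultimately show ?thesis using SG[of n] by simp
        qed
        then have "(cmod (cinner b x))\<^sup>2 \<le> 0"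
          by (intro LIMSEQ_le_const[OF LIMSEQ_inverse_real_of_nat]) auto
        then have "cinner b x = 0" by simp
        then have "cinner b (x - y n) = 0" for n using val[of n] by simp
          then show ?thesis by simp
      qed
      then show ?thesis using lim LIMSEQ_unique by blast
    qed
    have "x = z"
    proof (rule ccontr)
      assume "x \<noteq> z"
      define u where "u = inverse (norm (x - z)) *\<^sub>R (x - z)"
      have nz: "norm (x - z) \<noteq> 0" using \<open>x \<noteq> z\<close> by simp
      have ub: "cinner b u = 0" if "b \<in> B" for b
        using orth[OF that] by (simp add: u_def scaleR_scaleC cinner_scaleC_right)
      have uu: "cinner u u = 1"
        using nz by (simp add: cinner_self u_def)
      have "orthonormal (insert u B)"
        unfolding orthonormal_def
      proof (intro ballI)
        fix v w assume "v \<in> insert u B" "w \<in> insert u B"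
        moreover have "cinner u b = 0" if "b \<in> B" for b
          using ub[OF that] by (subst cinner_commute) simp
        moreover have "u \<notin> B" using ub[of u] uu by auto
        ultimately show "cinner v w = (if v = w then 1 else 0)"
          using ub uu B by (auto simp: orthonormal_def)
      qed
      then have "insert u B = B" by (rule max) auto
      then have "u \<in> B" by auto
      then show False using ub[of u] uu by simp
    qed
    then show ?thesis using zin by simp
  qed
  then show ?thesis by auto
qed

lemma ex_orthonormal_basis: "\<exists>B :: 'a::complex_hilbert_space set. orthonormal_basis B"
proof -
  have "\<exists>M\<in>Collect orthonormal. \<forall>X\<in>Collect orthonormal. M \<subseteq> X \<longrightarrow> X = (M :: 'a set)"
  proof (rule subset_Zorn')
    fix c :: "'a set set" assume c: "subset.chain (Collect orthonormal) c"
    have "orthonormal (\<Union>c)"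
      unfolding orthonormal_def
    proof safe
      fix x y X Y assume "x \<in> X" "X \<in> c" "y \<in> Y" "Y \<in> c"
      moreover from this c have "X \<subseteq> Y \<or> Y \<subseteq> X" "orthonormal X" "orthonormal Y"
        by (auto simp: subset.chain_def)
      ultimately show "cinner x y = (if x = y then 1 else 0)"
        unfolding orthonormal_def by blast
    qed
    then show "\<Union>c \<in> Collect orthonormal" by simp
  qed
  then obtain M :: "'a set" where M: "orthonormal M" "\<And>X. orthonormal X \<Longrightarrow> M \<subseteq> X \<Longrightarrow> X = M"
    by auto
  then show ?thesis
    unfolding orthonormal_basis_def using orthonormal_maximal_total[of M] by blast
qed

text \<open>
  A Hilbert space carries no distinguished orthonormal basis; one is chosen, and tensor powers are written
  in coordinates with respect to it. Different choices give unitarily equivalent models.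
\<close>

definition onb :: "'a::complex_hilbert_space set" where
  "onb = (SOME B. orthonormal_basis B)"

lemma orthonormal_basis_onb: "orthonormal_basis onb"
  unfolding onb_def by (rule someI_ex[OF ex_orthonormal_basis])

subsection \<open>Square-summable families\<close>

typedef 'i ell2 = "{f :: 'i \<Rightarrow> complex. (\<lambda>i. (cmod (f i))\<^sup>2) summable_on UNIV}"
  morphisms coord Abs_ell2
  by (rule exI[of _ "\<lambda>_. 0"]) simp

setup_lifting type_definition_ell2

lemma square_summable_add:
  assumes "(\<lambda>i. (cmod (f i))\<^sup>2) summable_on UNIV" "(\<lambda>i. (cmod (g i))\<^sup>2) summable_on UNIV"
  shows "(\<lambda>i. (cmod (f i + g i))\<^sup>2) summable_on UNIV"
proof (rule summable_on_comparison_test)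
  show "(\<lambda>i. 2 * (cmod (f i))\<^sup>2 + 2 * (cmod (g i))\<^sup>2) summable_on UNIV"
    using assms by (intro summable_on_add summable_on_cmult_right)
  fix i
  have "(cmod (f i + g i))\<^sup>2 \<le> (cmod (f i) + cmod (g i))\<^sup>2"
    by (intro power_mono norm_triangle_ineq) auto
  also have "\<dots> \<le> 2 * (cmod (f i))\<^sup>2 + 2 * (cmod (g i))\<^sup>2"
    using sum_squares_bound[of "cmod (f i)" "cmod (g i)"] by (simp add: power2_sum)
  finally show "(cmod (f i + g i))\<^sup>2 \<le> 2 * (cmod (f i))\<^sup>2 + 2 * (cmod (g i))\<^sup>2" .
qed auto

lemma square_summable_mult:
  assumes "(\<lambda>i. (cmod (f i))\<^sup>2) summable_on UNIV"
  shows "(\<lambda>i. (cmod (c * f i))\<^sup>2) summable_on UNIV"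
  using summable_on_cmult_right[OF assms, of "(cmod c)\<^sup>2"] by (simp add: norm_mult power_mult_distrib)

lemma square_summable_cinner:
  assumes "(\<lambda>i. (cmod (f i))\<^sup>2) summable_on UNIV" "(\<lambda>i. (cmod (g i))\<^sup>2) summable_on UNIV"
  shows "(\<lambda>i. cnj (f i) * g i) summable_on UNIV"
proof (rule abs_summable_summable, rule summable_on_comparison_test)
  show "(\<lambda>i. (cmod (f i))\<^sup>2 + (cmod (g i))\<^sup>2) summable_on UNIV"
    using assms by (intro summable_on_add)
  fix i
  have "0 \<le> cmod (f i) * cmod (g i)" by simp
  then show "norm (cnj (f i) * g i) \<le> (cmod (f i))\<^sup>2 + (cmod (g i))\<^sup>2"
    using sum_squares_bound[of "cmod (f i)" "cmod (g i)"] unfolding norm_mult complex_mod_cnj by linarith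
qed auto

instantiation ell2 :: (type) complex_inner
begin

lift_definition zero_ell2 :: "'a ell2" is "\<lambda>_. 0" by simp

lift_definition plus_ell2 :: "'a ell2 \<Rightarrow> 'a ell2 \<Rightarrow> 'a ell2" is "\<lambda>f g i. f i + g i"
  by (rule square_summable_add)

lift_definition uminus_ell2 :: "'a ell2 \<Rightarrow> 'a ell2" is "\<lambda>f i. - f i" by simp

lift_definition minus_ell2 :: "'a ell2 \<Rightarrow> 'a ell2 \<Rightarrow> 'a ell2" is "\<lambda>f g i. f i - g i"
proof -
  fix f g :: "'a \<Rightarrow> complex"
  assume "(\<lambda>i. (cmod (f i))\<^sup>2) summable_on UNIV" "(\<lambda>i. (cmod (g i))\<^sup>2) summable_on UNIV"
  then show "(\<lambda>i. (cmod (f i - g i))\<^sup>2) summable_on UNIV"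
    using square_summable_add[of f "\<lambda>i. - g i"] by simp
qed

lift_definition scaleC_ell2 :: "complex \<Rightarrow> 'a ell2 \<Rightarrow> 'a ell2" is "\<lambda>c f i. c * f i"
  by (rule square_summable_mult)

lift_definition scaleR_ell2 :: "real \<Rightarrow> 'a ell2 \<Rightarrow> 'a ell2" is "\<lambda>r f i. complex_of_real r * f i"
  by (rule square_summable_mult)

lift_definition cinner_ell2 :: "'a ell2 \<Rightarrow> 'a ell2 \<Rightarrow> complex"
  is "\<lambda>f g. \<Sum>\<^sub>\<infinity>i. cnj (f i) * g i" .

definition inner_ell2 :: "'a ell2 \<Rightarrow> 'a ell2 \<Rightarrow> real" where
  "inner_ell2 x y = Re (cinner x y)"

definition norm_ell2 :: "'a ell2 \<Rightarrow> real" where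
  "norm_ell2 x = sqrt (inner x x)"

definition sgn_ell2 :: "'a ell2 \<Rightarrow> 'a ell2" where
  "sgn_ell2 x = inverse (norm x) *\<^sub>R x"

definition dist_ell2 :: "'a ell2 \<Rightarrow> 'a ell2 \<Rightarrow> real" where
  "dist_ell2 x y = norm (x - y)"

definition uniformity_ell2 :: "('a ell2 \<times> 'a ell2) filter" where
  "uniformity_ell2 = (INF e\<in>{0<..}. principal {(x, y). dist x y < e})"

definition open_ell2 :: "'a ell2 set \<Rightarrow> bool" where
  "open_ell2 U = (\<forall>x\<in>U. \<forall>\<^sub>F (x', y) in uniformity. x' = x \<longrightarrow> y \<in> U)"

instance
proof
  fix x y z :: "'a ell2" and a b :: complex and r q :: real and U :: "'a ell2 set"
  show "x + y + z = x + (y + z)" by transfer (simp add: add.assoc)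
  show "x + y = y + x" by transfer (simp add: add.commute)
  show "0 + x = x" by transfer simp
  show "- x + x = 0" by transfer simp
  show "x - y = x + - y" by transfer simp
  show "r *\<^sub>R (x + y) = r *\<^sub>R x + r *\<^sub>R y" by transfer (simp add: distrib_left)
  show "(r + q) *\<^sub>R x = r *\<^sub>R x + q *\<^sub>R x" by transfer (simp add: distrib_right)
  show "r *\<^sub>R q *\<^sub>R x = (r * q) *\<^sub>R x" by transfer (simp add: mult.assoc)
  show "1 *\<^sub>R x = x" by transfer simp
  show "sgn x = inverse (norm x) *\<^sub>R x" by (rule sgn_ell2_def)
  show "dist x y = norm (x - y)" by (rule dist_ell2_def)
  show "(uniformity :: ('a ell2 \<times> 'a ell2) filter) = (INF e\<in>{0<..}. principal {(x, y). dist x y < e})"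
    by (rule uniformity_ell2_def)
  show "open U \<longleftrightarrow> (\<forall>x\<in>U. \<forall>\<^sub>F (x', y) in uniformity. x' = x \<longrightarrow> y \<in> U)"
    by (rule open_ell2_def)
  show "a *\<^sub>C (x + y) = a *\<^sub>C x + a *\<^sub>C y" by transfer (simp add: distrib_left)
  show "(a + b) *\<^sub>C x = a *\<^sub>C x + b *\<^sub>C x" by transfer (simp add: distrib_right)
  show "a *\<^sub>C b *\<^sub>C x = (a * b) *\<^sub>C x" by transfer (simp add: mult.assoc)
  show "r *\<^sub>R x = complex_of_real r *\<^sub>C x" by transfer simp
  have commute: "cinner x y = cnj (cinner y x)" for x y :: "'a ell2"
    by transfer (simp add: infsum_cnj[symmetric] mult.commute del: infsum_cnj)
  have add: "cinner x (y + z) = cinner x y + cinner x z" for x y z :: "'a ell2"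
    by transfer (simp add: distrib_left infsum_add square_summable_cinner)
  have scale: "cinner x (a *\<^sub>C y) = a * cinner x y" for x y :: "'a ell2" and a
    by transfer (simp add: infsum_cmult_right'[symmetric] ac_simps)
  show "cinner x y = cnj (cinner y x)" "cinner x (y + z) = cinner x y + cinner x z"
    "cinner x (a *\<^sub>C y) = a * cinner x y" by (rule commute add scale)+
  show "inner x y = Re (cinner x y)" "norm x = sqrt (inner x x)"
    by (rule inner_ell2_def norm_ell2_def)+
  show "inner x y = inner y x"
    unfolding inner_ell2_def by (subst commute) simp
  show "inner (x + y) z = inner x z + inner y z"
    unfolding inner_ell2_def by (subst (1 2 3) commute) (simp add: add)
  show "inner (r *\<^sub>R x) y = r * inner x y"
    unfolding inner_ell2_def \<open>r *\<^sub>R x = complex_of_real r *\<^sub>C x\<close>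
    by (subst (1 2) commute) (simp add: scale)
  have self: "inner x x = (\<Sum>\<^sub>\<infinity>i. (cmod (coord x i))\<^sup>2)"
  proof -
    have "cinner x x = (\<Sum>\<^sub>\<infinity>i. complex_of_real ((cmod (coord x i))\<^sup>2))"
      by transfer (simp only: mult.commute complex_norm_square)
    also have "\<dots> = complex_of_real (\<Sum>\<^sub>\<infinity>i. (cmod (coord x i))\<^sup>2)"
      using coord[of x] by (intro infsumI has_sum_of_real has_sum_infsum) simp
    finally show ?thesis by (simp add: inner_ell2_def)
  qed
  show "0 \<le> inner x x" unfolding self by (intro infsum_nonneg) simp
  show "inner x x = 0 \<longleftrightarrow> x = 0"
  proof
    assume "inner x x = 0"
    then have "(cmod (coord x i))\<^sup>2 = 0" for i
      unfolding self using coord[of x] by (intro nonneg_infsum_le_0D[where A = UNIV]) auto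
    then show "x = 0" by transfer auto
  next
    assume "x = 0"
    then show "inner x x = 0" unfolding self by (simp add: zero_ell2.rep_eq)
  qed
qed

end

lemma norm_ell2_sq: "(norm x)\<^sup>2 = (\<Sum>\<^sub>\<infinity>i. (cmod (coord x i))\<^sup>2)"
proof -
  have "cinner x x = (\<Sum>\<^sub>\<infinity>i. complex_of_real ((cmod (coord x i))\<^sup>2))"
    unfolding cinner_ell2.rep_eq
    by (intro infsum_cong) (simp add: complex_norm_square[symmetric] mult.commute del: of_real_power)
  also have "\<dots> = complex_of_real (\<Sum>\<^sub>\<infinity>i. (cmod (coord x i))\<^sup>2)"
    using coord[of x] by (intro infsumI has_sum_of_real has_sum_infsum) simp
  finally show ?thesis by (simp only: cinner_self of_real_eq_iff)
qed

instance ell2 :: (type) complex_hilbert_space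
proof
  fix X :: "nat \<Rightarrow> 'a ell2"
  assume X: "Cauchy X"
  have partial: "(\<Sum>i\<in>F. (cmod (coord x i))\<^sup>2) \<le> (norm x)\<^sup>2" if "finite F" for x :: "'a ell2" and F
    unfolding norm_ell2_sq using coord[of x] that by (intro finite_sum_le_infsum) auto
  have comp: "cmod (coord x i) \<le> norm x" for x :: "'a ell2" and i
    by (rule power2_le_imp_le) (use partial[of "{i}" x] in auto)
  have "Cauchy (\<lambda>n. coord (X n) i)" for i
  proof (rule metric_CauchyI)
    fix e :: real assume "e > 0"
    then obtain N where "\<forall>m\<ge>N. \<forall>n\<ge>N. dist (X m) (X n) < e" using metric_CauchyD[OF X \<open>e > 0\<close>] by blast
    moreover have "dist (coord (X m) i) (coord (X n) i) \<le> dist (X m) (X n)" for m n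
      using comp[of "X m - X n" i] unfolding dist_norm minus_ell2.rep_eq .
    ultimately show "\<exists>N. \<forall>m\<ge>N. \<forall>n\<ge>N. dist (coord (X m) i) (coord (X n) i) < e"
      by (meson le_less_trans)
  qed
  then have "\<exists>L. (\<lambda>n. coord (X n) i) \<longlonglongrightarrow> L" for i
    by (simp add: Cauchy_convergent_iff convergent_def)
  then obtain l where l: "\<And>i. (\<lambda>n. coord (X n) i) \<longlonglongrightarrow> l i"
    by metis
  have bound: "(\<Sum>i\<in>F. (cmod (coord (X m) i - l i))\<^sup>2) \<le> e\<^sup>2"
    if F: "finite F" and N: "\<forall>m\<ge>N. \<forall>n\<ge>N. dist (X m) (X n) < e" and m: "m \<ge> N" for F N m e
  proof (rule LIMSEQ_le_const2)
    show "(\<lambda>n. \<Sum>i\<in>F. (cmod (coord (X m) i - coord (X n) i))\<^sup>2)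
      \<longlonglongrightarrow> (\<Sum>i\<in>F. (cmod (coord (X m) i - l i))\<^sup>2)"
      by (intro tendsto_intros l)
    have "(\<Sum>i\<in>F. (cmod (coord (X m) i - coord (X n) i))\<^sup>2) \<le> e\<^sup>2" if "n \<ge> N" for n
    proof -
      have "norm (X m - X n) \<le> e" using N[rule_format, OF m that] by (simp add: dist_norm)
      then have "(norm (X m - X n))\<^sup>2 \<le> e\<^sup>2" by (intro power_mono) auto
      then show ?thesis using partial[OF F, of "X m - X n"] by (simp add: minus_ell2.rep_eq)
    qed
    then show "\<exists>N. \<forall>n\<ge>N. (\<Sum>i\<in>F. (cmod (coord (X m) i - coord (X n) i))\<^sup>2) \<le> e\<^sup>2" by blast
  qed
  have diff: "(\<lambda>i. (cmod (coord (X m) i - l i))\<^sup>2) summable_on UNIV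
      \<and> (\<Sum>\<^sub>\<infinity>i. (cmod (coord (X m) i - l i))\<^sup>2) \<le> e\<^sup>2"
    if "\<forall>m\<ge>N. \<forall>n\<ge>N. dist (X m) (X n) < e" "m \<ge> N" for N m e
  proof
    show "(\<lambda>i. (cmod (coord (X m) i - l i))\<^sup>2) summable_on UNIV"
    proof (rule nonneg_bdd_above_summable_on)
      show "bdd_above (sum (\<lambda>i. (cmod (coord (X m) i - l i))\<^sup>2) ` {F. F \<subseteq> UNIV \<and> finite F})"
        by (rule bdd_aboveI2[where M = "e\<^sup>2"]) (use bound[OF _ that] in simp)
    qed simp
    then show "(\<Sum>\<^sub>\<infinity>i. (cmod (coord (X m) i - l i))\<^sup>2) \<le> e\<^sup>2"
      by (rule infsum_le_finite_sums) (rule bound[OF _ that])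
  qed
  obtain N1 where N1: "\<forall>m\<ge>N1. \<forall>n\<ge>N1. dist (X m) (X n) < 1"
    using metric_CauchyD[OF X zero_less_one] by blast
  have "(\<lambda>i. (cmod (l i))\<^sup>2) summable_on UNIV"
    using square_summable_add[of "coord (X N1)" "\<lambda>i. - (coord (X N1) i - l i)"]
      diff[OF N1 order_refl] coord[of "X N1"] unfolding norm_minus_cancel by simp
  then have L: "coord (Abs_ell2 l) = l" by (simp add: Abs_ell2_inverse)
  have "X \<longlonglongrightarrow> Abs_ell2 l"
  proof (rule metric_LIMSEQ_I)
    fix e :: real assume "e > 0"
    then obtain N where N: "\<forall>m\<ge>N. \<forall>n\<ge>N. dist (X m) (X n) < e / 2"
      using metric_CauchyD[OF X half_gt_zero[OF \<open>e > 0\<close>]] by blast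
    have "dist (X m) (Abs_ell2 l) < e" if "m \<ge> N" for m
    proof -
      have "(norm (X m - Abs_ell2 l))\<^sup>2 \<le> (e/2)\<^sup>2"
        unfolding norm_ell2_sq minus_ell2.rep_eq L using diff[OF N that] by simp
      then have "norm (X m - Abs_ell2 l) \<le> e / 2"
        by (rule power2_le_imp_le) (use \<open>e > 0\<close> in simp)
      then show ?thesis using \<open>e > 0\<close> by (simp add: dist_norm)
    qed
    then show "\<exists>no. \<forall>n\<ge>no. dist (X n) (Abs_ell2 l) < e" by blast
  qed
  then show "convergent X" by (rule convergentI)
qed

subsection \<open>Square-integrable functions\<close>

lemma norm_scaleC: "norm (a *\<^sub>C x) = cmod a * norm (x :: 'a::complex_inner)"
proof -
  have "complex_of_real ((norm (a *\<^sub>C x))\<^sup>2) = cnj a * a * complex_of_real ((norm x)\<^sup>2)"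
    by (simp only: cinner_self[symmetric] cinner_scaleC_left cinner_scaleC_right ac_simps)
  also have "\<dots> = complex_of_real ((cmod a * norm x)\<^sup>2)"
    by (simp only: power_mult_distrib of_real_mult complex_norm_square mult.commute)
  finally have "(norm (a *\<^sub>C x))\<^sup>2 = (cmod a * norm x)\<^sup>2" by (simp only: of_real_eq_iff)
  then show ?thesis by (simp add: power2_eq_iff_nonneg)
qed

lemma bounded_linear_scaleC: "bounded_linear (\<lambda>x. a *\<^sub>C (x :: 'a::complex_inner))"
  by (rule bounded_linear_intro[of _ "cmod a"])
     (simp_all add: scaleC_add_right scaleR_scaleC scaleC_scaleC mult.commute norm_scaleC)

lemma cmod_cinner_le: "cmod (cinner x y) \<le> norm x * norm (y :: 'a::complex_inner)"
proof (cases "cinner x y = 0")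
  case False
  define u where "u = cnj (cinner x y) / cmod (cinner x y)"
  have "cinner x (u *\<^sub>C y) = complex_of_real (cmod (cinner x y))"
    using False by (simp add: u_def cinner_scaleC_right field_simps complex_norm_square[symmetric] power2_eq_square
        flip: of_real_power)
  then have "cmod (cinner x y) = inner x (u *\<^sub>C y)" by (simp add: inner_eq_Re_cinner)
  also have "\<dots> \<le> norm x * norm (u *\<^sub>C y)" by (rule norm_cauchy_schwarz)
  also have "norm (u *\<^sub>C y) = norm y" using False by (simp add: norm_scaleC u_def norm_divide)
  finally show ?thesis .
qed simp

lemma borel_measurable_scaleC:
  fixes f :: "'b \<Rightarrow> 'a::complex_inner"
  assumes "f \<in> borel_measurable M"
  shows "(\<lambda>x. a *\<^sub>C f x) \<in> borel_measurable M"
  using borel_measurable_continuous_on[OF linear_continuous_on[OF bounded_linear_scaleC] assms] .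

lemma borel_measurable_cinner:
  fixes f g :: "'b \<Rightarrow> 'a::{complex_inner, second_countable_topology}"
  assumes "f \<in> borel_measurable M" "g \<in> borel_measurable M"
  shows "(\<lambda>x. cinner (f x) (g x)) \<in> borel_measurable M"
  unfolding borel_measurable_complex_iff cinner_eq_Complex complex.sel
  using assms by (auto intro!: borel_measurable_inner borel_measurable_scaleC)

definition square_integrable :: "'b measure \<Rightarrow> ('b \<Rightarrow> 'a::real_normed_vector) \<Rightarrow> bool" where
  "square_integrable M f \<longleftrightarrow> f \<in> borel_measurable M \<and> integrable M (\<lambda>x. (norm (f x))\<^sup>2)"

lemma square_norm_add_le: "(norm (x + y))\<^sup>2 \<le> 2 * (norm x)\<^sup>2 + 2 * (norm (y :: 'a::real_normed_vector))\<^sup>2"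
proof -
  have "(norm (x + y))\<^sup>2 \<le> (norm x + norm y)\<^sup>2"
    by (intro power_mono norm_triangle_ineq) auto
  also have "\<dots> \<le> 2 * (norm x)\<^sup>2 + 2 * (norm y)\<^sup>2"
    using sum_squares_bound[of "norm x" "norm y"] by (simp add: power2_sum)
  finally show ?thesis .
qed

lemma square_integrable_zero: "square_integrable M (\<lambda>_. 0)"
  by (simp add: square_integrable_def)

lemma square_integrable_add:
  fixes f g :: "'b \<Rightarrow> 'a::{real_normed_vector, second_countable_topology}"
  assumes "square_integrable M f" "square_integrable M g"
  shows "square_integrable M (\<lambda>x. f x + g x)"
  unfolding square_integrable_def
proof
  have m: "f \<in> borel_measurable M" "g \<in> borel_measurable M"
    and i: "integrable M (\<lambda>x. (norm (f x))\<^sup>2)" "integrable M (\<lambda>x. (norm (g x))\<^sup>2)"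
    using assms by (auto simp: square_integrable_def)
  show "(\<lambda>x. f x + g x) \<in> borel_measurable M" using m by simp
  show "integrable M (\<lambda>x. (norm (f x + g x))\<^sup>2)"
  proof (rule Bochner_Integration.integrable_bound)
    show "integrable M (\<lambda>x. 2 * (norm (f x))\<^sup>2 + 2 * (norm (g x))\<^sup>2)" using i by simp
    show "(\<lambda>x. (norm (f x + g x))\<^sup>2) \<in> borel_measurable M" using m by simp
    show "AE x in M. norm ((norm (f x + g x))\<^sup>2) \<le> norm (2 * (norm (f x))\<^sup>2 + 2 * (norm (g x))\<^sup>2)"
      using square_norm_add_le by (intro AE_I2) simp
  qed
qed

lemma square_integrable_uminus:
  fixes f :: "'b \<Rightarrow> 'a::{real_normed_vector, second_countable_topology}"
  shows "square_integrable M f \<Longrightarrow> square_integrable M (\<lambda>x. - f x)"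
  by (simp add: square_integrable_def)

lemma square_integrable_diff:
  fixes f g :: "'b \<Rightarrow> 'a::{real_normed_vector, second_countable_topology}"
  shows "square_integrable M f \<Longrightarrow> square_integrable M g \<Longrightarrow> square_integrable M (\<lambda>x. f x - g x)"
  using square_integrable_add[OF _ square_integrable_uminus, of M f g] by simp

lemma square_integrable_scaleC:
  fixes f :: "'b \<Rightarrow> 'a::complex_inner"
  shows "square_integrable M f \<Longrightarrow> square_integrable M (\<lambda>x. a *\<^sub>C f x)"
  by (simp add: square_integrable_def borel_measurable_scaleC norm_scaleC power_mult_distrib)

lemma square_integrable_cinner:
  fixes f g :: "'b \<Rightarrow> 'a::{complex_inner, second_countable_topology}"
  assumes "square_integrable M f" "square_integrable M g"
  shows "integrable M (\<lambda>x. cinner (f x) (g x))"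
proof (rule Bochner_Integration.integrable_bound)
  show "integrable M (\<lambda>x. (norm (f x))\<^sup>2 + (norm (g x))\<^sup>2)"
    using assms by (simp add: square_integrable_def)
  show "(\<lambda>x. cinner (f x) (g x)) \<in> borel_measurable M"
    using assms by (simp add: square_integrable_def borel_measurable_cinner)
  have "norm (cinner x y) \<le> norm ((norm x)\<^sup>2 + (norm y)\<^sup>2)" for x y :: 'a
  proof -
    have "0 \<le> norm x * norm y" by simp
    then have "norm x * norm y \<le> (norm x)\<^sup>2 + (norm y)\<^sup>2"
      using sum_squares_bound[of "norm x" "norm y"] by linarith
    then show ?thesis using cmod_cinner_le[of x y] by simp
  qed
  then show "AE x in M. norm (cinner (f x) (g x)) \<le> norm ((norm (f x))\<^sup>2 + (norm (g x))\<^sup>2)"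
    by simp
qed

lemma square_integrable_complete:
  fixes f :: "nat \<Rightarrow> 'b \<Rightarrow> 'a::{banach, second_countable_topology}"
  assumes sq: "\<And>n. square_integrable M (f n)"
    and Cauchy: "\<And>e. e > 0 \<Longrightarrow> \<exists>N. \<forall>m\<ge>N. \<forall>n\<ge>N. (\<integral>x. (norm (f m x - f n x))\<^sup>2 \<partial>M) < e"
  obtains g where "square_integrable M g"
    "\<And>e. e > 0 \<Longrightarrow> \<exists>N. \<forall>n\<ge>N. (\<integral>x. (norm (f n x - g x))\<^sup>2 \<partial>M) \<le> e"
proof -
  have meas [measurable]: "f n \<in> borel_measurable M" for n
    using sq by (simp add: square_integrable_def)
  have int: "integrable M (\<lambda>x. (norm (f m x - f n x))\<^sup>2)" for m n
    using square_integrable_diff[OF sq sq] by (simp add: square_integrable_def)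
  have "\<exists>N. \<forall>m\<ge>N. \<forall>n\<ge>N. (\<integral>x. (norm (f m x - f n x))\<^sup>2 \<partial>M) < (1/4)^k" for k :: nat
    by (rule Cauchy) simp
  then obtain N where N: "\<And>k m n. m \<ge> N k \<Longrightarrow> n \<ge> N k \<Longrightarrow>
      (\<integral>x. (norm (f m x - f n x))\<^sup>2 \<partial>M) < (1/4)^k" by metis
  define r where "r k = k + (\<Sum>j\<le>k. N j)" for k
  have r: "k \<le> r k" "N k \<le> r k" "N k \<le> r (Suc k)" for k
  proof -
    have "N k \<le> (\<Sum>j\<le>k. N j)" by (rule member_le_sum) auto
    then show "k \<le> r k" "N k \<le> r k" "N k \<le> r (Suc k)" by (auto simp: r_def)
  qed
  define D where "D k x = (norm (f (r (Suc k)) x - f (r k) x))\<^sup>2" for k x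
  have D_meas [measurable]: "D k \<in> borel_measurable M" for k unfolding D_def by measurable
  have nnD: "(\<integral>\<^sup>+x. ennreal (2^k * D k x) \<partial>M) \<le> ennreal ((1/2)^k)" for k
  proof -
    have "(\<integral>\<^sup>+x. ennreal (2^k * D k x) \<partial>M) = ennreal (\<integral>x. 2^k * D k x \<partial>M)"
      using int by (intro nn_integral_eq_integral) (auto simp: D_def)
    also have "(\<integral>x. 2^k * D k x \<partial>M) = 2^k * (\<integral>x. D k x \<partial>M)" by simp
    also have "\<dots> \<le> 2^k * (1/4)^k"
      using N[OF r(3,2), of k] unfolding D_def by (intro mult_left_mono less_imp_le) auto
    also have "\<dots> = (1/2)^k" by (simp add: power_mult_distrib[symmetric])
    finally show ?thesis by (simp add: ennreal_leI)
  qed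
  have "(\<integral>\<^sup>+x. (\<Sum>k. ennreal (2^k * D k x)) \<partial>M) = (\<Sum>k. \<integral>\<^sup>+x. ennreal (2^k * D k x) \<partial>M)"
    by (rule nn_integral_suminf) measurable
  also have "\<dots> \<le> (\<Sum>k. ennreal ((1/2)^k))"
    by (intro suminf_le nnD summableI)
  also have "\<dots> = ennreal (\<Sum>k. (1/2)^k)"
    by (intro suminf_ennreal2) (auto simp: summable_geometric)
  also have "\<dots> < \<infinity>" by simp
  finally have fin: "AE x in M. (\<Sum>k. ennreal (2^k * D k x)) \<noteq> \<infinity>"
    by (intro nn_integral_PInf_AE) auto
  have conv: "convergent (\<lambda>k. f (r k) x)" if fin: "(\<Sum>k. ennreal (2^k * D k x)) \<noteq> \<infinity>" for x
  proof -
    have nonneg: "0 \<le> 2^k * D k x" for k by (simp add: D_def)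
    have "summable (\<lambda>k. 2^k * D k x)"
      by (rule summable_suminf_not_top) (use nonneg fin in auto)
    then have "Bseq (\<lambda>k. 2^k * D k x)" by (rule summable_imp_Bseq)
    then obtain C where C: "\<And>k. norm (2^k * D k x) \<le> C"
      unfolding Bseq_def by blast
    have "norm (f (r (Suc k)) x - f (r k) x) \<le> sqrt C * (1 / sqrt 2)^k" for k
    proof -
      have "D k x \<le> C * (1/2)^k"
        using C[of k] nonneg[of k] by (simp add: field_simps power_divide)
      then have "sqrt (D k x) \<le> sqrt (C * (1/2)^k)" by simp
      also have "\<dots> = sqrt C * (1 / sqrt 2)^k"
        by (simp add: real_sqrt_mult real_sqrt_power real_sqrt_divide)
      finally show ?thesis by (simp add: D_def)
    qed
    note bound = this
    have "summable (\<lambda>k. sqrt C * (1 / sqrt 2)^k)"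
      by (intro summable_mult summable_geometric) simp
    then have "summable (\<lambda>k. f (r (Suc k)) x - f (r k) x)"
      by (rule summable_comparison_test'[where N = 0]) (rule bound)
    then have "convergent (\<lambda>n. \<Sum>k<n. f (r (Suc k)) x - f (r k) x)"
      by (simp add: summable_iff_convergent)
    then have "convergent (\<lambda>n. (f (r n) x - f (r 0) x) + f (r 0) x)"
      by (intro convergent_add convergent_const)
        (simp add: sum_lessThan_telescope[of "\<lambda>k. f (r k) x"])
    then show ?thesis by simp
  qed
  define g where "g x = lim (\<lambda>k. f (r k) x)" for x
  have [measurable]: "g \<in> borel_measurable M"
    unfolding g_def by (rule borel_measurable_lim_metric) measurable
  have lim: "AE x in M. (\<lambda>k. f (r k) x) \<longlonglongrightarrow> g x"
    using fin by eventually_elim (simp add: g_def conv convergent_LIMSEQ_iff[symmetric])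
  have fatou: "(\<integral>\<^sup>+x. ennreal ((norm (f m x - g x))\<^sup>2) \<partial>M) \<le> ennreal e"
    if N: "\<forall>m\<ge>N. \<forall>n\<ge>N. (\<integral>x. (norm (f m x - f n x))\<^sup>2 \<partial>M) < e" and m: "m \<ge> N" for m N e
  proof -
    let ?u = "\<lambda>k x. ennreal ((norm (f m x - f (r k) x))\<^sup>2)"
    have "AE x in M. ennreal ((norm (f m x - g x))\<^sup>2) = liminf (\<lambda>k. ?u k x)"
      using lim
    proof eventually_elim
      case (elim x)
      have "(\<lambda>k. ?u k x) \<longlonglongrightarrow> ennreal ((norm (f m x - g x))\<^sup>2)"
        by (intro tendsto_ennrealI tendsto_intros elim)
      then show ?case by (intro lim_imp_Liminf[symmetric]) auto
    qed
    then have "(\<integral>\<^sup>+x. ennreal ((norm (f m x - g x))\<^sup>2) \<partial>M) = (\<integral>\<^sup>+x. liminf (\<lambda>k. ?u k x) \<partial>M)"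
      by (rule nn_integral_cong_AE)
    also have "\<dots> \<le> liminf (\<lambda>k. \<integral>\<^sup>+x. ?u k x \<partial>M)"
      by (rule nn_integral_liminf) measurable
    also have "\<dots> \<le> liminf (\<lambda>k. ennreal e)"
    proof (rule Liminf_mono)
      have "(\<integral>\<^sup>+x. ?u k x \<partial>M) \<le> ennreal e" if "k \<ge> N" for k
      proof -
        have "(\<integral>\<^sup>+x. ?u k x \<partial>M) = ennreal (\<integral>x. (norm (f m x - f (r k) x))\<^sup>2 \<partial>M)"
          using int by (intro nn_integral_eq_integral) auto
        also have "\<dots> \<le> ennreal e"
          using N[rule_format, of m "r k"] m that r(1)[of k] by (intro ennreal_leI) simp
        finally show ?thesis .
      qed
      then show "\<forall>\<^sub>F k in sequentially. (\<integral>\<^sup>+x. ?u k x \<partial>M) \<le> ennreal e"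
        by (auto simp: eventually_sequentially)
    qed
    also have "\<dots> = ennreal e" by (rule Liminf_const) simp
    finally show ?thesis .
  qed
  have diff: "integrable M (\<lambda>x. (norm (f m x - g x))\<^sup>2)" "(\<integral>x. (norm (f m x - g x))\<^sup>2 \<partial>M) \<le> e"
    if "e > 0" "\<forall>m\<ge>N. \<forall>n\<ge>N. (\<integral>x. (norm (f m x - f n x))\<^sup>2 \<partial>M) < e" "m \<ge> N" for m N e
  proof -
    have le: "(\<integral>\<^sup>+x. ennreal ((norm (f m x - g x))\<^sup>2) \<partial>M) \<le> ennreal e"
      by (rule fatou[OF that(2,3)])
    also have "\<dots> < \<infinity>" by simp
    finally show *: "integrable M (\<lambda>x. (norm (f m x - g x))\<^sup>2)"
      by (intro integrableI_bounded) auto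
    have "ennreal (\<integral>x. (norm (f m x - g x))\<^sup>2 \<partial>M) \<le> ennreal e"
      using le nn_integral_eq_integral[OF *] by simp
    then show "(\<integral>x. (norm (f m x - g x))\<^sup>2 \<partial>M) \<le> e" using \<open>e > 0\<close> by (simp add: ennreal_le_iff)
  qed
  obtain N1 where N1: "\<forall>m\<ge>N1. \<forall>n\<ge>N1. (\<integral>x. (norm (f m x - f n x))\<^sup>2 \<partial>M) < 1"
    using Cauchy[of 1] by auto
  have "square_integrable M (\<lambda>x. f N1 x - g x)"
    using diff(1)[OF zero_less_one N1 order_refl] by (simp add: square_integrable_def)
  from square_integrable_diff[OF sq[of N1] this] have "square_integrable M g" by simp
  moreover have "\<exists>N. \<forall>n\<ge>N. (\<integral>x. (norm (f n x - g x))\<^sup>2 \<partial>M) \<le> e" if e: "e > 0" for e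
    using Cauchy[OF e] diff(2)[OF e] by blast
  ultimately show ?thesis by (rule that)
qed

subsection \<open>The space of square-integrable vector functions on the half line\<close>

abbreviation half_line :: "real measure" where
  "half_line \<equiv> restrict_space lborel {0..}"

definition L2_rel :: "(real \<Rightarrow> 'a::{complex_hilbert_space, second_countable_topology}) \<Rightarrow> (real \<Rightarrow> 'a) \<Rightarrow> bool" where
  "L2_rel f g \<longleftrightarrow> square_integrable half_line f \<and> square_integrable half_line g \<and>
     (AE x in half_line. f x = g x)"

quotient_type (overloaded) 'a L2 =
  "real \<Rightarrow> 'a::{complex_hilbert_space, second_countable_topology}" / partial: L2_rel
  morphisms rep_L2 abs_L2
proof (rule part_equivpI)
  show "\<exists>f. L2_rel f (f :: real \<Rightarrow> 'a)"
    by (rule exI[of _ "\<lambda>_. 0"]) (simp add: L2_rel_def square_integrable_zero)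
  show "symp (L2_rel :: (real \<Rightarrow> 'a) \<Rightarrow> _)"
    by (rule sympI) (auto simp: L2_rel_def)
  show "transp (L2_rel :: (real \<Rightarrow> 'a) \<Rightarrow> _)"
    by (rule transpI) (auto simp: L2_rel_def)
qed

instantiation L2 :: ("{complex_hilbert_space, second_countable_topology}") complex_inner
begin

lift_definition zero_L2 :: "'a L2" is "\<lambda>_. 0"
  by (simp add: L2_rel_def square_integrable_zero)

lift_definition plus_L2 :: "'a L2 \<Rightarrow> 'a L2 \<Rightarrow> 'a L2" is "\<lambda>f g x. f x + g x"
  by (auto simp: L2_rel_def square_integrable_add)

lift_definition uminus_L2 :: "'a L2 \<Rightarrow> 'a L2" is "\<lambda>f x. - f x"
  by (auto simp: L2_rel_def square_integrable_uminus)

lift_definition minus_L2 :: "'a L2 \<Rightarrow> 'a L2 \<Rightarrow> 'a L2" is "\<lambda>f g x. f x - g x"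
  by (auto simp: L2_rel_def square_integrable_diff)

lift_definition scaleC_L2 :: "complex \<Rightarrow> 'a L2 \<Rightarrow> 'a L2" is "\<lambda>c f x. c *\<^sub>C f x"
  by (auto simp: L2_rel_def square_integrable_scaleC)

lift_definition scaleR_L2 :: "real \<Rightarrow> 'a L2 \<Rightarrow> 'a L2" is "\<lambda>r f x. r *\<^sub>R f x"
  unfolding scaleR_scaleC by (auto simp: L2_rel_def square_integrable_scaleC)

lift_definition cinner_L2 :: "'a L2 \<Rightarrow> 'a L2 \<Rightarrow> complex"
  is "\<lambda>f g. \<integral>x. cinner (f x) (g x) \<partial>half_line"
proof -
  fix f f' g g' :: "real \<Rightarrow> 'a"
  assume "L2_rel f f'" "L2_rel g g'"
  then show "(\<integral>x. cinner (f x) (g x) \<partial>half_line) = (\<integral>x. cinner (f' x) (g' x) \<partial>half_line)"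
    by (intro integral_cong_AE borel_measurable_cinner) (auto simp: L2_rel_def square_integrable_def)
qed

definition inner_L2 :: "'a L2 \<Rightarrow> 'a L2 \<Rightarrow> real" where
  "inner_L2 x y = Re (cinner x y)"

definition norm_L2 :: "'a L2 \<Rightarrow> real" where
  "norm_L2 x = sqrt (inner x x)"

definition sgn_L2 :: "'a L2 \<Rightarrow> 'a L2" where
  "sgn_L2 x = inverse (norm x) *\<^sub>R x"

definition dist_L2 :: "'a L2 \<Rightarrow> 'a L2 \<Rightarrow> real" where
  "dist_L2 x y = norm (x - y)"

definition uniformity_L2 :: "('a L2 \<times> 'a L2) filter" where
  "uniformity_L2 = (INF e\<in>{0<..}. principal {(x, y). dist x y < e})"

definition open_L2 :: "'a L2 set \<Rightarrow> bool" where
  "open_L2 U = (\<forall>x\<in>U. \<forall>\<^sub>F (x', y) in uniformity. x' = x \<longrightarrow> y \<in> U)"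

instance
proof
  fix x y z :: "'a L2" and a b :: complex and r q :: real and U :: "'a L2 set"
  note rel = L2_rel_def square_integrable_zero square_integrable_add square_integrable_uminus
    square_integrable_diff square_integrable_scaleC 
  show "x + y + z = x + (y + z)" by transfer (auto simp: rel add.assoc)
  show "x + y = y + x" by transfer (auto simp: rel add.commute)
  show "0 + x = x" by transfer (auto simp: rel)
  show "- x + x = 0" by transfer (auto simp: rel)
  show "x - y = x + - y" by transfer (auto simp: rel)
  show "r *\<^sub>R (x + y) = r *\<^sub>R x + r *\<^sub>R y" by transfer (auto simp: rel scaleR_scaleC scaleC_add_right)
  show "(r + q) *\<^sub>R x = r *\<^sub>R x + q *\<^sub>R x" by transfer (auto simp: rel scaleR_scaleC scaleC_add_left)
  show "r *\<^sub>R q *\<^sub>R x = (r * q) *\<^sub>R x" by transfer (auto simp: rel scaleR_scaleC scaleC_scaleC)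
  show "1 *\<^sub>R x = x" by transfer (auto simp: rel scaleR_scaleC)
  show "sgn x = inverse (norm x) *\<^sub>R x" by (rule sgn_L2_def)
  show "dist x y = norm (x - y)" by (rule dist_L2_def)
  show "(uniformity :: ('a L2 \<times> 'a L2) filter) = (INF e\<in>{0<..}. principal {(x, y). dist x y < e})"
    by (rule uniformity_L2_def)
  show "open U \<longleftrightarrow> (\<forall>x\<in>U. \<forall>\<^sub>F (x', y) in uniformity. x' = x \<longrightarrow> y \<in> U)"
    by (rule open_L2_def)
  show "a *\<^sub>C (x + y) = a *\<^sub>C x + a *\<^sub>C y" by transfer (auto simp: rel scaleC_add_right)
  show "(a + b) *\<^sub>C x = a *\<^sub>C x + b *\<^sub>C x" by transfer (auto simp: rel scaleC_add_left)
  show "a *\<^sub>C b *\<^sub>C x = (a * b) *\<^sub>C x" by transfer (auto simp: rel scaleC_scaleC)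
  show R: "r *\<^sub>R x = complex_of_real r *\<^sub>C x" for r and x :: "'a L2"
    by transfer (auto simp: rel scaleR_scaleC)
  have commute: "cinner x y = cnj (cinner y x)" for x y :: "'a L2"
  proof transfer
    fix f g :: "real \<Rightarrow> 'a"
    show "(\<integral>x. cinner (f x) (g x) \<partial>half_line) = cnj (\<integral>x. cinner (g x) (f x) \<partial>half_line)"
      unfolding Bochner_Integration.integral_cnj[symmetric]
      by (rule Bochner_Integration.integral_cong) (auto intro: cinner_commute)
  qed
  have add: "cinner x (y + z) = cinner x y + cinner x z" for x y z :: "'a L2"
    by transfer (simp add: L2_rel_def cinner_add_right square_integrable_cinner)
  have scale: "cinner x (a *\<^sub>C y) = a * cinner x y" for x y :: "'a L2" and a
    by transfer (simp add: cinner_scaleC_right)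
  show "cinner x y = cnj (cinner y x)" "cinner x (y + z) = cinner x y + cinner x z"
    "cinner x (a *\<^sub>C y) = a * cinner x y" by (rule commute add scale)+
  show "inner x y = Re (cinner x y)" "norm x = sqrt (inner x x)"
    by (rule inner_L2_def norm_L2_def)+
  show "inner x y = inner y x"
    unfolding inner_L2_def by (subst commute) simp
  show "inner (x + y) z = inner x z + inner y z"
    unfolding inner_L2_def by (subst (1 2 3) commute) (simp add: add)
  show "inner (r *\<^sub>R x) y = r * inner x y"
    unfolding inner_L2_def R by (subst (1 2) commute) (simp add: scale)
  show "0 \<le> inner x x"
    unfolding inner_L2_def by transfer (simp add: cinner_self del: of_real_power)
  show "inner x x = 0 \<longleftrightarrow> x = 0"
    unfolding inner_L2_def
  proof transfer
    fix f :: "real \<Rightarrow> 'a" assume "L2_rel f f"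
    then have f: "square_integrable half_line f" by (simp add: L2_rel_def)
    have "Re (\<integral>x. cinner (f x) (f x) \<partial>half_line) = (\<integral>x. (norm (f x))\<^sup>2 \<partial>half_line)"
      by (simp add: cinner_self del: of_real_power)
    also have "\<dots> = 0 \<longleftrightarrow> (AE x in half_line. (norm (f x))\<^sup>2 = 0)"
      using f by (intro integral_nonneg_eq_0_iff_AE) (auto simp: square_integrable_def)
    finally show "Re (\<integral>x. cinner (f x) (f x) \<partial>half_line) = 0 \<longleftrightarrow> L2_rel f (\<lambda>_. 0)"
      using f by (simp add: L2_rel_def square_integrable_zero)
  qed
qed

end

lemma norm_L2_sq: "L2_rel f f \<Longrightarrow> (norm (abs_L2 f))\<^sup>2 = (\<integral>x. (norm (f x))\<^sup>2 \<partial>half_line)"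
proof -
  assume f: "L2_rel f f"
  have "complex_of_real ((norm (abs_L2 f))\<^sup>2) = (\<integral>x. cinner (f x) (f x) \<partial>half_line)"
    unfolding cinner_self[symmetric] by (rule cinner_L2.abs_eq[OF f f])
  also have "\<dots> = complex_of_real (\<integral>x. (norm (f x))\<^sup>2 \<partial>half_line)"
    unfolding cinner_self by (rule integral_complex_of_real)
  finally show ?thesis by (simp only: of_real_eq_iff)
qed

lemma L2_rel_rep: "L2_rel (rep_L2 x) (rep_L2 x)"
  using Quotient3_rep_reflp[OF Quotient3_L2] .

lemma abs_rep_L2: "abs_L2 (rep_L2 x) = x"
  using Quotient3_abs_rep[OF Quotient3_L2] .

instance L2 :: ("{complex_hilbert_space, second_countable_topology}") complex_hilbert_space
proof
  fix X :: "nat \<Rightarrow> 'a L2"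
  assume X: "Cauchy X"
  define f where "f n = rep_L2 (X n)" for n
  have rel: "L2_rel (f n) (f n)" and Xf: "X n = abs_L2 (f n)" for n
    unfolding f_def by (simp_all add: L2_rel_rep abs_rep_L2)
  have sq: "square_integrable half_line (f n)" for n
    using rel by (simp add: L2_rel_def)
  have dist: "(dist (abs_L2 h) (abs_L2 g))\<^sup>2 = (\<integral>x. (norm (h x - g x))\<^sup>2 \<partial>half_line)"
    if h: "square_integrable half_line h" and g: "square_integrable half_line g" for h g :: "real \<Rightarrow> 'a"
  proof -
    have "L2_rel h h" "L2_rel g g" "L2_rel (\<lambda>x. h x - g x) (\<lambda>x. h x - g x)"
      using h g by (auto simp: L2_rel_def square_integrable_diff)
    then show ?thesis by (simp add: dist_norm minus_L2.abs_eq norm_L2_sq)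
  qed
  have "\<exists>N. \<forall>m\<ge>N. \<forall>n\<ge>N. (\<integral>x. (norm (f m x - f n x))\<^sup>2 \<partial>half_line) < e" if "e > 0" for e
  proof -
    obtain N where N: "\<forall>m\<ge>N. \<forall>n\<ge>N. dist (X m) (X n) < sqrt e"
      using metric_CauchyD[OF X, of "sqrt e"] \<open>e > 0\<close> by auto
    have "(\<integral>x. (norm (f m x - f n x))\<^sup>2 \<partial>half_line) < e" if "m \<ge> N" "n \<ge> N" for m n
    proof -
      have "(dist (X m) (X n))\<^sup>2 < (sqrt e)\<^sup>2"
        using N[rule_format, OF that] by (intro power_strict_mono) auto
      then show ?thesis using \<open>e > 0\<close> by (simp add: Xf dist[OF sq sq])
    qed
    then show ?thesis by blast
  qed
  from square_integrable_complete[OF sq this]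
  obtain g where g: "square_integrable half_line g"
    and lim: "\<And>e. e > 0 \<Longrightarrow> \<exists>N. \<forall>n\<ge>N. (\<integral>x. (norm (f n x - g x))\<^sup>2 \<partial>half_line) \<le> e"
    by blast
  have "X \<longlonglongrightarrow> abs_L2 g"
  proof (rule metric_LIMSEQ_I)
    fix e :: real assume "e > 0"
    obtain N where N: "\<forall>n\<ge>N. (\<integral>x. (norm (f n x - g x))\<^sup>2 \<partial>half_line) \<le> (e/2)\<^sup>2"
      using lim[of "(e/2)\<^sup>2"] \<open>e > 0\<close> by auto
    have "dist (X n) (abs_L2 g) < e" if "n \<ge> N" for n
    proof -
      have "(dist (X n) (abs_L2 g))\<^sup>2 \<le> (e/2)\<^sup>2"
        unfolding Xf dist[OF sq g] using N that by blast
      then have "dist (X n) (abs_L2 g) \<le> e/2" by (rule power2_le_imp_le) (use \<open>e > 0\<close> in simp)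
      then show ?thesis using \<open>e > 0\<close> by simp
    qed
    then show "\<exists>N. \<forall>n\<ge>N. dist (X n) (abs_L2 g) < e" by blast
  qed
  then show "convergent X" by (rule convergentI)
qed

lift_definition essential_support :: "'a::{complex_hilbert_space, second_countable_topology} L2 \<Rightarrow> real set"
  is "\<lambda>f. {x. 0 \<le> x \<and> (\<forall>e>0. \<not> (AE y in half_line. dist y x < e \<longrightarrow> f y = 0))}"
proof -
  fix f g :: "real \<Rightarrow> 'a" assume "L2_rel f g"
  then have ae: "AE y in half_line. f y = g y" by (simp add: L2_rel_def)
  have "(AE y in half_line. dist y x < e \<longrightarrow> f y = 0) \<longleftrightarrow> (AE y in half_line. dist y x < e \<longrightarrow> g y = 0)" for x e
    using ae by (intro eventually_subst) (auto elim: eventually_mono)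
  then show "{x. 0 \<le> x \<and> (\<forall>e>0. \<not> (AE y in half_line. dist y x < e \<longrightarrow> f y = 0))} =
    {x. 0 \<le> x \<and> (\<forall>e>0. \<not> (AE y in half_line. dist y x < e \<longrightarrow> g y = 0))}" by simp
qed

lemma square_integrable_indicator:
  fixes f :: "real \<Rightarrow> 'a::{real_normed_vector, second_countable_topology}"
  assumes f: "square_integrable half_line f" and A: "A \<in> sets borel"
  shows "square_integrable half_line (\<lambda>x. indicator A x *\<^sub>R f x)"
  unfolding square_integrable_def
proof
  have [measurable]: "f \<in> borel_measurable half_line" 
    using f by (simp add: square_integrable_def)
  have [measurable]: "(indicator A :: real \<Rightarrow> real) \<in> borel_measurable half_line"
    using A by (intro measurable_restrict_space1) simp
  show "(\<lambda>x. indicator A x *\<^sub>R f x) \<in> borel_measurable half_line" by measurable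
  show "integrable half_line (\<lambda>x. (norm (indicator A x *\<^sub>R f x))\<^sup>2)"
  proof (rule Bochner_Integration.integrable_bound)
    show "integrable half_line (\<lambda>x. (norm (f x))\<^sup>2)" using f by (simp add: square_integrable_def)
  qed (measurable, simp add: indicator_def)
qed

text \<open>
  \<open>L2_truncate s h\<close> is $h_{[0,s[}$, \<open>L2_step c t\<close> is $c_{[0,t[}$, and \<open>L2_shift s\<close> is the right shift $S_s$
  (an isometry for \<open>s \<ge> 0\<close>, the only range in which it is used).
\<close>

lift_definition L2_truncate :: "real \<Rightarrow> 'a::{complex_hilbert_space, second_countable_topology} L2 \<Rightarrow> 'a L2"
  is "\<lambda>s f x. indicator {0..<s} x *\<^sub>R f x"
  by (auto simp: L2_rel_def intro!: square_integrable_indicator)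

lift_definition L2_step :: "'a::{complex_hilbert_space, second_countable_topology} \<Rightarrow> real \<Rightarrow> 'a L2"
  is "\<lambda>c t x. indicator {0..<t} x *\<^sub>R c"
proof -
  fix c :: 'a and t :: real
  have "integrable lborel (\<lambda>x. indicator {0..<t} x *\<^sub>R ((norm c)\<^sup>2))"
    by (intro integrable_scaleR_left impI integrable_real_indicator emeasure_bounded_finite) auto
  moreover have "indicator {0..} x *\<^sub>R (norm (indicator {0..<t} x *\<^sub>R c))\<^sup>2 = indicator {0..<t} x *\<^sub>R ((norm c)\<^sup>2)"
    for x :: real by (auto simp: indicator_def)
  ultimately have "integrable half_line (\<lambda>x. (norm (indicator {0..<t} x *\<^sub>R c))\<^sup>2)"
    by (subst integrable_restrict_space) auto
  moreover have "(\<lambda>x. indicator {0..<t} x *\<^sub>R c) \<in> borel_measurable half_line"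
    by (intro measurable_restrict_space1) simp
  ultimately show "L2_rel (\<lambda>x. indicator {0..<t} x *\<^sub>R c) (\<lambda>x. indicator {0..<t} x *\<^sub>R c)"
    by (simp add: L2_rel_def square_integrable_def)
qed

lemma square_integrable_shift:
  fixes f :: "real \<Rightarrow> 'a::{real_normed_vector, second_countable_topology}"
  assumes f: "square_integrable half_line f"
  shows "square_integrable half_line (\<lambda>x. if s \<le> x then f (x - s) else 0)"
proof -
  define F where "F x = indicator {0..} x *\<^sub>R f x" for x :: real
  have F [measurable]: "F \<in> borel_measurable borel"
    using f by (simp add: F_def[abs_def] square_integrable_def borel_measurable_restrict_space_iff)
  have "integrable lborel (\<lambda>x. (norm (F x))\<^sup>2)"
  proof -
    have "integrable lborel (\<lambda>x. indicator {0..} x *\<^sub>R (norm (f x))\<^sup>2)"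
      using f by (simp add: square_integrable_def integrable_restrict_space)
    then show ?thesis
      by (rule Bochner_Integration.integrable_cong[THEN iffD1, rotated 2]) (auto simp: F_def indicator_def)
  qed
  then have int: "integrable lborel (\<lambda>x. (norm (F (x - s)))\<^sup>2)"
    using lborel_integrable_real_affine[of "\<lambda>x. (norm (F x))\<^sup>2" 1 "- s"] by simp
  have meas: "(\<lambda>x. if s \<le> x then f (x - s) else 0) \<in> borel_measurable half_line"
  proof (subst measurable_cong)
    show "(if s \<le> x then f (x - s) else 0) = (if s \<le> x then F (x - s) else 0)" for x
      by (simp add: F_def)
    show "(\<lambda>x. if s \<le> x then F (x - s) else 0) \<in> borel_measurable half_line"
      by (intro measurable_restrict_space1) simp
  qed
  have "integrable half_line (\<lambda>x. (norm (F (x - s)))\<^sup>2)"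
    using int integrable_mult_indicator[of "{0..}" lborel "\<lambda>x. (norm (F (x - s)))\<^sup>2"]
    by (simp add: integrable_restrict_space)
  then have "integrable half_line (\<lambda>x. (norm (if s \<le> x then f (x - s) else 0))\<^sup>2)"
  proof (rule Bochner_Integration.integrable_bound)
    show "(\<lambda>x. (norm (if s \<le> x then f (x - s) else 0))\<^sup>2) \<in> borel_measurable half_line"
      using meas by simp
  qed (simp add: F_def)
  with meas show ?thesis by (simp add: square_integrable_def)
qed

lift_definition L2_shift :: "real \<Rightarrow> 'a::{complex_hilbert_space, second_countable_topology} L2 \<Rightarrow> 'a L2"
  is "\<lambda>s f x. if s \<le> x then f (x - s) else 0"
proof -
  fix s and f g :: "real \<Rightarrow> 'a"
  assume rel: "L2_rel f g"
  then have "AE x in lborel. 0 \<le> x \<longrightarrow> f x = g x" by (simp add: L2_rel_def AE_restrict_space_iff)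
  then have "AE x in lborel. 0 \<le> x - s \<longrightarrow> f (x - s) = g (x - s)"
    using AE_distrD[of "(+) (- s)" lborel borel "\<lambda>x. 0 \<le> x \<longrightarrow> f x = g x"]
    unfolding lborel_distr_plus by simp
  then have "AE x in half_line. (if s \<le> x then f (x - s) else 0) = (if s \<le> x then g (x - s) else 0)"
    by (subst AE_restrict_space_iff) (auto elim: eventually_mono)
  then show "L2_rel (\<lambda>x. if s \<le> x then f (x - s) else 0) (\<lambda>x. if s \<le> x then g (x - s) else 0)"
    using rel by (simp add: L2_rel_def square_integrable_shift)
qed

subsection \<open>Symmetric Fock space\<close>

text \<open>
  With $E$ the chosen orthonormal basis of \<open>'h\<close>, the $n$-fold Hilbert space tensor power of \<open>'h\<close> is realised as the
  $\ell^2$-space of the words of length $n$ in $E$, an elementary tensor $h_1 \otimes \dots \otimes h_n$ having the coordinate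
  $\prod_i \langle x_i, h_i\rangle$ at the word $x_1 \dots x_n$. The full Fock space is then the $\ell^2$-space of all words in $E$,
  and its symmetric part consists of the families invariant under permutation of letters.
  All of these are subspaces of \<open>'h list ell2\<close>.
\<close>

lemma sum_prod_list_words:
  fixes w :: "'a \<Rightarrow> real"
  assumes "finite G"
  shows "(\<Sum>xs | set xs \<subseteq> G \<and> length xs = n. \<Prod>x\<leftarrow>xs. w x) = (\<Sum>x\<in>G. w x) ^ n"
proof (induction n)
  case 0
  have "{xs. set xs \<subseteq> G \<and> length xs = 0} = {[]}" by auto
  then show ?case by simp
next
  case (Suc n)
  let ?L = "{xs. set xs \<subseteq> G \<and> length xs = n}"
  have "{xs. set xs \<subseteq> G \<and> length xs = Suc n} = (\<lambda>(x, xs). x # xs) ` (G \<times> ?L)"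
    by (auto simp: length_Suc_conv image_iff)
  then have "(\<Sum>xs | set xs \<subseteq> G \<and> length xs = Suc n. \<Prod>x\<leftarrow>xs. w x) =
      (\<Sum>(x, xs)\<in>G \<times> ?L. w x * (\<Prod>x\<leftarrow>xs. w x))"
    by (simp add: sum.reindex inj_on_def case_prod_beta comp_def)
  also have "\<dots> = (\<Sum>x\<in>G. w x) * (\<Sum>xs\<in>?L. \<Prod>x\<leftarrow>xs. w x)"
    by (simp add: sum.cartesian_product[symmetric] sum_product)
  finally show ?case using Suc.IH by simp
qed

definition tensor_coord :: "'h::complex_hilbert_space \<Rightarrow> 'h list \<Rightarrow> complex" where
  "tensor_coord h xs = (if set xs \<subseteq> onb then \<Prod>x\<leftarrow>xs. cinner x h else 0)"

lemma sum_tensor_coord_le: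
  assumes "finite F" "\<And>xs. xs \<in> F \<Longrightarrow> length xs = n"
  shows "(\<Sum>xs\<in>F. (cmod (tensor_coord h xs))\<^sup>2) \<le> ((norm h)\<^sup>2) ^ n"
proof -
  define G where "G = (\<Union>xs\<in>F. set xs) \<inter> onb"
  have G: "finite G" "G \<subseteq> onb" using assms by (auto simp: G_def)
  have ortho: "orthonormal G"
    using orthonormal_basis_onb orthonormal_subset[OF _ G(2)] by (auto simp: orthonormal_basis_def)
  have fin: "finite {xs. set xs \<subseteq> G \<and> length xs = n}" by (rule finite_lists_length_eq[OF G(1)])
  have cmod_prod: "(cmod (\<Prod>x\<leftarrow>xs. cinner x h))\<^sup>2 = (\<Prod>x\<leftarrow>xs. (cmod (cinner x h))\<^sup>2)" for xs
    by (induction xs) (simp_all add: norm_mult power_mult_distrib)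
  have "(\<Sum>xs\<in>F. (cmod (tensor_coord h xs))\<^sup>2) = (\<Sum>xs\<in>F \<inter> {xs. set xs \<subseteq> onb}. (cmod (tensor_coord h xs))\<^sup>2)"
    by (intro sum.mono_neutral_right assms(1)) (auto simp: tensor_coord_def)
  also have "\<dots> \<le> (\<Sum>xs | set xs \<subseteq> G \<and> length xs = n. (cmod (tensor_coord h xs))\<^sup>2)"
    by (intro sum_mono2 fin) (auto simp: G_def assms(2))
  also have "\<dots> = (\<Sum>xs | set xs \<subseteq> G \<and> length xs = n. \<Prod>x\<leftarrow>xs. (cmod (cinner x h))\<^sup>2)"
    using G(2) by (intro sum.cong refl) (auto simp: tensor_coord_def cmod_prod)
  also have "\<dots> = (\<Sum>x\<in>G. (cmod (cinner x h))\<^sup>2) ^ n"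
    by (rule sum_prod_list_words[OF G(1)])
  also have "\<dots> \<le> ((norm h)\<^sup>2) ^ n"
    by (intro power_mono bessel ortho G sum_nonneg) auto
  finally show ?thesis .
qed

lift_definition tensor_power :: "nat \<Rightarrow> 'h::complex_hilbert_space \<Rightarrow> 'h list ell2"
  is "\<lambda>n h xs. if length xs = n \<and> set xs \<subseteq> onb then \<Prod>x\<leftarrow>xs. cinner x h else 0"
proof -
  fix n and h :: 'h
  let ?f = "\<lambda>xs. if length xs = n \<and> set xs \<subseteq> onb then \<Prod>x\<leftarrow>xs. cinner x h else 0"
  have "(\<Sum>xs\<in>F. (cmod (?f xs))\<^sup>2) \<le> ((norm h)\<^sup>2) ^ n" if "finite F" for F
  proof -
    have "(\<Sum>xs\<in>F. (cmod (?f xs))\<^sup>2) = (\<Sum>xs\<in>F \<inter> {xs. length xs = n}. (cmod (tensor_coord h xs))\<^sup>2)"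
      using that by (intro sum.mono_neutral_cong_right) (auto simp: tensor_coord_def)
    also have "\<dots> \<le> ((norm h)\<^sup>2) ^ n" using that by (intro sum_tensor_coord_le) auto
    finally show ?thesis .
  qed
  then show "(\<lambda>xs. (cmod (?f xs))\<^sup>2) summable_on UNIV"
    by (intro nonneg_bdd_above_summable_on bdd_aboveI2[where M = "((norm h)\<^sup>2) ^ n"]) auto
qed

text \<open>
  The component of \<open>expvec h\<close> on words of length $n$ is $(n!)^{-1/2} h^{\otimes n}$.
\<close>

lift_definition expvec :: "'h::complex_hilbert_space \<Rightarrow> 'h list ell2"
  is "\<lambda>h xs. coord (tensor_power (length xs) h) xs / sqrt (fact (length xs))"
proof -
  fix h :: 'h
  let ?f = "\<lambda>xs. coord (tensor_power (length xs) h) xs / sqrt (fact (length xs))"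
  have "(\<Sum>xs\<in>F. (cmod (?f xs))\<^sup>2) \<le> exp ((norm h)\<^sup>2)" if F: "finite F" for F
  proof -
    define N where "N = length ` F"
    have N: "finite N" using F by (simp add: N_def)
    have "(\<Sum>xs\<in>F. (cmod (?f xs))\<^sup>2) = (\<Sum>n\<in>N. \<Sum>xs | xs \<in> F \<and> length xs = n. (cmod (?f xs))\<^sup>2)"
      unfolding N_def by (rule sum.image_gen[OF F])
    also have "\<dots> \<le> (\<Sum>n\<in>N. ((norm h)\<^sup>2) ^ n /\<^sub>R fact n)"
    proof (rule sum_mono)
      fix n assume "n \<in> N"
      have "(\<Sum>xs | xs \<in> F \<and> length xs = n. (cmod (?f xs))\<^sup>2) =
          (\<Sum>xs | xs \<in> F \<and> length xs = n. (cmod (tensor_coord h xs))\<^sup>2) / fact n"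
        unfolding sum_divide_distrib
        by (intro sum.cong) (auto simp: tensor_power.rep_eq tensor_coord_def norm_divide power_divide)
      also have "\<dots> \<le> ((norm h)\<^sup>2) ^ n / fact n"
        using F by (intro divide_right_mono sum_tensor_coord_le) auto
      finally show "(\<Sum>xs | xs \<in> F \<and> length xs = n. (cmod (?f xs))\<^sup>2) \<le> ((norm h)\<^sup>2) ^ n /\<^sub>R fact n"
        by (simp add: field_simps)
    qed
    also have "\<dots> \<le> exp ((norm h)\<^sup>2)"
      unfolding exp_def by (intro sum_le_suminf N summable_exp_generic) auto
    finally show ?thesis .
  qed
  then show "(\<lambda>xs. (cmod (?f xs))\<^sup>2) summable_on UNIV"
    by (intro nonneg_bdd_above_summable_on bdd_aboveI2[where M = "exp ((norm h)\<^sup>2)"]) auto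
qed

definition sym_fock :: "'h::complex_hilbert_space list ell2 set" where
  "sym_fock = {\<psi>. (\<forall>xs. \<not> set xs \<subseteq> onb \<longrightarrow> coord \<psi> xs = 0) \<and>
                   (\<forall>xs ys. mset xs = mset ys \<longrightarrow> coord \<psi> xs = coord \<psi> ys)}"

text \<open>
  The Hilbert space tensor product of $\ell^2(I)$ and $\ell^2(J)$ is $\ell^2(I \times J)$.
\<close>

lift_definition tensor :: "'i ell2 \<Rightarrow> 'j ell2 \<Rightarrow> ('i \<times> 'j) ell2" (infixr "\<otimes>\<^sub>2" 70)
  is "\<lambda>f g (i, j). f i * g j"
proof -
  fix f :: "'i \<Rightarrow> complex" and g :: "'j \<Rightarrow> complex"
  assume "(\<lambda>i. (cmod (f i))\<^sup>2) summable_on UNIV" "(\<lambda>j. (cmod (g j))\<^sup>2) summable_on UNIV"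
  note fg = this
  have "(\<Sum>(i, j)\<in>F. (cmod (f i * g j))\<^sup>2) \<le> (\<Sum>\<^sub>\<infinity>i. (cmod (f i))\<^sup>2) * (\<Sum>\<^sub>\<infinity>j. (cmod (g j))\<^sup>2)"
    if F: "finite F" for F :: "('i \<times> 'j) set"
  proof -
    have "(\<Sum>(i, j)\<in>F. (cmod (f i * g j))\<^sup>2) \<le> (\<Sum>(i, j)\<in>fst ` F \<times> snd ` F. (cmod (f i * g j))\<^sup>2)"
      using F by (intro sum_mono2 subset_fst_snd) auto
    also have "\<dots> = (\<Sum>i\<in>fst ` F. (cmod (f i))\<^sup>2) * (\<Sum>j\<in>snd ` F. (cmod (g j))\<^sup>2)"
      by (simp add: sum.cartesian_product[symmetric] sum_product norm_mult power_mult_distrib)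
    also have "\<dots> \<le> (\<Sum>\<^sub>\<infinity>i. (cmod (f i))\<^sup>2) * (\<Sum>\<^sub>\<infinity>j. (cmod (g j))\<^sup>2)"
      using F fg by (intro mult_mono finite_sum_le_infsum infsum_nonneg sum_nonneg) auto
    finally show ?thesis .
  qed
  then show "(\<lambda>ij. (cmod (case ij of (i, j) \<Rightarrow> f i * g j))\<^sup>2) summable_on UNIV"
    by (intro nonneg_bdd_above_summable_on
          bdd_aboveI2[where M = "(\<Sum>\<^sub>\<infinity>i. (cmod (f i))\<^sup>2) * (\<Sum>\<^sub>\<infinity>j. (cmod (g j))\<^sup>2)"])
       (auto simp: case_prod_unfold)
qed

definition tensor_space :: "'i ell2 set \<Rightarrow> 'j ell2 set \<Rightarrow> ('i \<times> 'j) ell2 set" where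
  "tensor_space V W = closure (cspan {x \<otimes>\<^sub>2 y | x y. x \<in> V \<and> y \<in> W})"

definition unitary_between :: "'a::complex_hilbert_space set \<Rightarrow> 'b::complex_hilbert_space set \<Rightarrow> ('a \<Rightarrow> 'b) \<Rightarrow> bool" where
  "unitary_between V W U \<longleftrightarrow> U ` V = W \<and>
     (\<forall>x\<in>V. \<forall>y\<in>V. U (x + y) = U x + U y) \<and>
     (\<forall>a. \<forall>x\<in>V. U (a *\<^sub>C x) = a *\<^sub>C U x) \<and>
     (\<forall>x\<in>V. \<forall>y\<in>V. cinner (U x) (U y) = cinner x y)"

text \<open>
  The adjoint of an operator \<open>T\<close> defined on the closed subspace \<open>V\<close>, with values in \<open>V\<close>.
\<close>

definition adjoint_on :: "'a::complex_hilbert_space set \<Rightarrow> ('a \<Rightarrow> 'b::complex_hilbert_space) \<Rightarrow> 'b \<Rightarrow> 'a" where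
  "adjoint_on V T y = (THE x. x \<in> V \<and> (\<forall>v\<in>V. cinner v x = cinner (T v) y))"

subsection \<open>The Fock Arveson system and its roots\<close>

type_synonym 'a fock = "'a L2 list ell2"

definition K_upto :: "real \<Rightarrow> 'k::{complex_hilbert_space, second_countable_topology} L2 set" where
  "K_upto t = {g. essential_support g \<subseteq> {0..t}}"

definition fibre :: "real \<Rightarrow> 'k::{complex_hilbert_space, second_countable_topology} fock set" where
  "fibre t = closure (cspan (expvec ` K_upto t))"

text \<open>
  The structure maps are determined on \<open>fibre (s + t)\<close>; their values elsewhere are never used.
\<close>

definition structure_map :: "real \<Rightarrow> real \<Rightarrow> 'k::{complex_hilbert_space, second_countable_topology} fock \<Rightarrow>
    ('k L2 list \<times> 'k L2 list) ell2" where
  "structure_map s t = (SOME U. unitary_between (fibre (s + t)) (tensor_space (fibre s) (fibre t)) U \<and>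
     (\<forall>h\<in>K_upto (s + t). U (expvec h) = expvec (L2_truncate s h) \<otimes>\<^sub>2 expvec (adjoint_on UNIV (L2_shift s) h)))"

definition fock_mult :: "real \<Rightarrow> real \<Rightarrow> 'k::{complex_hilbert_space, second_countable_topology} fock \<Rightarrow> 'k fock \<Rightarrow> 'k fock" where
  "fock_mult s t x y = adjoint_on (fibre (s + t)) (structure_map s t) (x \<otimes>\<^sub>2 y)"

text \<open>
  A section is indexed by \<open>t > 0\<close>. It is encoded as a function on all of \<open>real\<close> with the value \<open>0\<close> for \<open>t \<le> 0\<close>,
  so that equality and the pointwise operations of sections are those of functions.
\<close>

definition measurable_section :: "(real \<Rightarrow> 'k::{complex_hilbert_space, second_countable_topology} fock) \<Rightarrow> bool" where
  "measurable_section a \<longleftrightarrow> (\<forall>t>0. a t \<in> fibre t) \<and> (\<forall>t\<le>0. a t = 0) \<and>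
     a \<in> restrict_space borel {0<..} \<rightarrow>\<^sub>M restrict_space borel sym_fock"

definition vacuum :: "real \<Rightarrow> 'k::{complex_hilbert_space, second_countable_topology} fock" where
  "vacuum t = (if 0 < t then expvec 0 else 0)"

definition roots :: "(real \<Rightarrow> 'k::{complex_hilbert_space, second_countable_topology} fock) \<Rightarrow> (real \<Rightarrow> 'k fock) set" where
  "roots u = {a. measurable_section a \<and>
     (\<forall>s>0. \<forall>t>0. a (s + t) = fock_mult s t (a s) (u t) + fock_mult s t (u s) (a t)) \<and>
     (\<forall>t>0. cinner (u t) (a t) = 0)}"

definition root_inner :: "(real \<Rightarrow> 'k::{complex_hilbert_space, second_countable_topology} fock) \<Rightarrow> (real \<Rightarrow> 'k fock) \<Rightarrow> complex" where
  "root_inner a b = cinner (a 1) (b 1)"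

definition chi :: "'k::{complex_hilbert_space, second_countable_topology} \<Rightarrow> real \<Rightarrow> 'k fock" where
  "chi c t = (if 0 < t then tensor_power 1 (L2_step c t) else 0)"

end

theory Submission
  imports Defs
begin

text \<open>
  Write $x \cdot y$ for the product in the Fock Arveson system and $\Omega$ for the vacuum unit. For a root $a$ the summands
  $a_s \cdot \Omega_t$ and $\Omega_s \cdot a_t$ of $a_{s+t}$ are orthogonal, so $\|a_t\|^2$ is additive in $t$ and
  $\|a_{t/n}\| = \|a_t\| / \sqrt n$. Pairing with exponential vectors, $\langle\varepsilon(h) - h, a_t\rangle$ splits into
  $n$ terms belonging to the restrictions $h_i$ of $h$ to the intervals of length $t/n$, each bounded by a multiple of
  $\|h_i\|^2 \|a_{t/n}\|$; the sum is $O(n^{-1/2})$, hence zero, and $a_t$ lives in the one-particle space.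
  Let $d$ be such that $\chi^d_1$ is the projection of $a_1$ onto the closed subspace of all $\chi^c_1$, and put $b = a - \chi^d$.
  Then $t \mapsto \langle c_{[0,t[}, b_t\rangle$ is additive, bounded near $0$ and zero at $1$, so it vanishes. Since the
  functions $c_{[0,t[}$ are total in $L^2$, this forces $b = 0$.
\<close>

subsection \<open>Closed subspaces and unitary extensions\<close>

text \<open>The vacuum condition also explains the quadratic bound. Since $a_t$ is orthogonal to the
  vacuum, \<open>expvec h - one_particle h\<close> may be replaced by the second-order remainder of
  the exponential vector, whose norm is O(||h||^2). The squares ||h_i||^2 add up to ||h||^2, so the
  number n of pieces enters the estimate only through the norm of $a_{t/n}$. Boundedness near 0 in
  the last step comes from the same norm identity: the norm of $b_t$ is nondecreasing in t.

  Two choices in the definitions shape the groundwork. The structure map is picked by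
  \<open>SOME\<close>, so nothing can be said about it before such a unitary is shown to exist; it
  is obtained by extending a correspondence between two families with equal Gram matrices to their
  closed spans. And Fock space is given by words over a chosen basis, so the inner product exp <f,
  g> of two exponential vectors has to be recovered from Parseval's identity. After that, vectors of
  a fibre are compared by testing against exponential vectors.\<close>

lemma cinner_minus_left: "cinner (- x :: 'a::complex_inner) y = - cinner x y"
  using cinner_add_left[of x "- x" y] by (simp add: eq_neg_iff_add_eq_0 add.commute)

lemma cinner_diff_left: "cinner (x - y :: 'a::complex_inner) z = cinner x z - cinner y z"
  using cinner_add_left[of x "- y" z] by (simp add: cinner_minus_left)

lemma cinner_scaleR_right: "cinner x (r *\<^sub>R y :: 'a::complex_inner) = of_real r * cinner x y"
  by (simp add: scaleR_scaleC cinner_scaleC_right)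

lemma tendsto_cinner:
  assumes "(f \<longlongrightarrow> l) F" "(g \<longlongrightarrow> m) F"
  shows "((\<lambda>i. cinner (f i) (g i)) \<longlongrightarrow> cinner l (m :: 'a::complex_inner)) F"
  unfolding cinner_eq_Complex
  by (intro tendsto_Complex tendsto_inner assms bounded_linear.tendsto[OF bounded_linear_scaleC])

lemma tendsto_scaleC:
  assumes "(f \<longlongrightarrow> l) F"
  shows "((\<lambda>i. a *\<^sub>C f i) \<longlongrightarrow> a *\<^sub>C (l :: 'a::complex_inner)) F"
  by (rule bounded_linear.tendsto[OF bounded_linear_scaleC assms])

lemma norm_eq_iff_cinner: "norm x = norm y \<longleftrightarrow> cinner x x = cinner (y::'b::complex_inner) y"
  for x :: "'a::complex_inner"
  unfolding cinner_self of_real_eq_iff by (simp add: power2_eq_iff_nonneg)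

section \<open>Closed complex subspaces and total sets\<close>

lemma csubspace_closure:
  assumes "csubspace S"
  shows "csubspace (closure (S :: 'a::complex_inner set))"
proof (rule complex_vector.subspaceI)
  show "0 \<in> closure S"
    using complex_vector.subspace_0[OF assms] closure_subset by auto
next
  fix x y assume "x \<in> closure S" "y \<in> closure S"
  then obtain X Y where "\<And>n. X n \<in> S" "X \<longlonglongrightarrow> x" "\<And>n. Y n \<in> S" "Y \<longlonglongrightarrow> y"
    by (auto simp: closure_sequential)
  then show "x + y \<in> closure S"
    unfolding closure_sequential
    by (intro exI[of _ "\<lambda>n. X n + Y n"]) (auto intro: tendsto_add complex_vector.subspace_add[OF assms])
next
  fix c x assume "x \<in> closure S"
  then obtain X where "\<And>n. X n \<in> S" "X \<longlonglongrightarrow> x" by (auto simp: closure_sequential)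
  then show "c *\<^sub>C x \<in> closure S"
    unfolding closure_sequential
    by (intro exI[of _ "\<lambda>n. c *\<^sub>C X n"]) (auto intro: tendsto_scaleC complex_vector.subspace_scale[OF assms])
qed

lemma csubspace_closure_cspan: "csubspace (closure (cspan (X :: 'a::complex_inner set)))"
  by (intro csubspace_closure complex_vector.subspace_span)

lemma closure_cspan_superset: "X \<subseteq> closure (cspan (X :: 'a::complex_inner set))"
  using complex_vector.span_superset closure_subset by blast

lemma closure_cspan_minimal:
  assumes "X \<subseteq> S" "csubspace S" "closed (S :: 'a::complex_inner set)"
  shows "closure (cspan X) \<subseteq> S"
  by (intro closure_minimal complex_vector.span_minimal assms)

lemma csubspace_diff: "csubspace S \<Longrightarrow> x \<in> S \<Longrightarrow> y \<in> S \<Longrightarrow> x - y \<in> (S :: 'a::complex_inner set)"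
  by (rule complex_vector.subspace_diff)

lemma closed_Collect_eq_sequential:
  fixes a b :: "'a::complex_inner \<Rightarrow> complex"
  assumes "\<And>X l. X \<longlonglongrightarrow> l \<Longrightarrow> (\<lambda>n. a (X n)) \<longlonglongrightarrow> a l"
    and "\<And>X l. X \<longlonglongrightarrow> l \<Longrightarrow> (\<lambda>n. b (X n)) \<longlonglongrightarrow> b l"
  shows "closed {x. a x = b x}"
  unfolding closed_sequential_limits
proof (intro allI impI, elim conjE)
  fix X l assume X: "\<forall>n. X n \<in> {x. a x = b x}" and l: "X \<longlonglongrightarrow> l"
  have "(\<lambda>n. a (X n)) \<longlonglongrightarrow> b l" using X assms(2)[OF l] by simp
  then show "l \<in> {x. a x = b x}" using LIMSEQ_unique[OF assms(1)[OF l]] by simp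
qed

lemma orthogonal_closure_cspan:
  assumes "\<And>x. x \<in> X \<Longrightarrow> cinner x z = 0" "y \<in> closure (cspan X)"
  shows "cinner y (z :: 'a::complex_inner) = 0"
proof -
  have "closure (cspan X) \<subseteq> {y. cinner y z = 0}"
  proof (rule closure_cspan_minimal)
    show "csubspace {y. cinner y z = 0}"
      by (rule complex_vector.subspaceI) (auto simp: cinner_add_left cinner_scaleC_left)
    show "closed {y. cinner y z = 0}"
      by (rule closed_Collect_eq_sequential) (auto intro: tendsto_cinner)
  qed (use assms in auto)
  then show ?thesis using assms by auto
qed

lemma orthogonal_total_eq_0:
  assumes "\<And>x. x \<in> X \<Longrightarrow> cinner x z = 0" "z \<in> closure (cspan X)"
  shows "z = (0 :: 'a::complex_inner)"
  using orthogonal_closure_cspan[OF assms] by (simp add: cinner_self)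

lemma total_eqI:
  assumes "\<And>x. x \<in> X \<Longrightarrow> cinner x y = cinner x z" "y \<in> closure (cspan X)" "z \<in> closure (cspan X)"
  shows "y = (z :: 'a::complex_inner)"
  using orthogonal_total_eq_0[of X "y - z"] assms csubspace_diff[OF csubspace_closure_cspan]
  by (auto simp: cinner_diff_right)

text \<open>A sequence minimising the distance to V is Cauchy by the parallelogram law, and its
  limit is the foot of the perpendicular.\<close>

lemma orthogonal_projection:
  fixes V :: "'a::complex_hilbert_space set"
  assumes V: "csubspace V" and cl: "closed V"
  obtains p where "p \<in> V" "\<And>v. v \<in> V \<Longrightarrow> cinner v (y - p) = 0"
proof -
  define D where "D = infdist y V"
  have ne: "V \<noteq> {}" using complex_vector.subspace_0[OF V] by auto
  have D_le: "D \<le> norm (y - v)" if "v \<in> V" for v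
    using infdist_le[OF that, of y] by (simp add: D_def dist_norm)
  have D0: "0 \<le> D" by (simp add: D_def infdist_nonneg)
  have D_sq: "D\<^sup>2 \<le> (norm (y - v))\<^sup>2" if "v \<in> V" for v
    using D_le[OF that] D0 by (rule power_mono)
  have "\<exists>v\<in>V. (norm (y - v))\<^sup>2 < D\<^sup>2 + inverse (real (Suc n))" for n
  proof -
    have "D < sqrt (D\<^sup>2 + inverse (real (Suc n)))"
      by (rule real_less_rsqrt) simp
    then obtain v where "v \<in> V" "dist y v < sqrt (D\<^sup>2 + inverse (real (Suc n)))"
      unfolding D_def infdist_notempty[OF ne] 
      using cINF_less_iff[OF ne bdd_belowI2[of V 0 "dist y"]] by (auto simp del: of_nat_Suc)
    then have "(norm (y - v))\<^sup>2 < (sqrt (D\<^sup>2 + inverse (real (Suc n))))\<^sup>2"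
      by (intro power_strict_mono) (auto simp: dist_norm)
    then show ?thesis using \<open>v \<in> V\<close> by (auto simp: add_nonneg_nonneg)
  qed
  then obtain v where v: "\<And>n. v n \<in> V" "\<And>n. (norm (y - v n))\<^sup>2 < D\<^sup>2 + inverse (real (Suc n))"
    by metis
  \<comment> \<open>The midpoint of two members of V is again at distance at least D from y, so the
    parallelogram law leaves 2e + 2e with e = 1/(N + 1).\<close>
  have dist_v: "(norm (v m - v n))\<^sup>2 \<le> 4 * inverse (real (Suc N))" if "N \<le> m" "N \<le> n" for m n N
  proof -
    have "(norm (v m - v n))\<^sup>2 = 2 * (norm (y - v m))\<^sup>2 + 2 * (norm (y - v n))\<^sup>2
        - 4 * (norm (y - (1/2) *\<^sub>R (v m + v n)))\<^sup>2"
      by (simp add: power2_norm_eq_inner inner_diff_left inner_diff_right inner_add_left inner_add_right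
          inner_commute algebra_simps)
    moreover have "(1/2) *\<^sub>R (v m + v n) \<in> V"
      unfolding scaleR_scaleC using v V by (intro complex_vector.subspace_scale complex_vector.subspace_add)
    from D_sq[OF this] have "D\<^sup>2 \<le> (norm (y - (1/2) *\<^sub>R (v m + v n)))\<^sup>2" .
    moreover have "inverse (real (Suc k)) \<le> inverse (real (Suc N))" if "N \<le> k" for k
      using that by (simp add: field_simps)
    from this[OF that(1)] this[OF that(2)]
    have "(norm (y - v m))\<^sup>2 < D\<^sup>2 + inverse (real (Suc N))" "(norm (y - v n))\<^sup>2 < D\<^sup>2 + inverse (real (Suc N))"
      using v(2)[of m] v(2)[of n] by linarith+
    ultimately show ?thesis by linarith
  qed
  have "Cauchy v"
  proof (rule metric_CauchyI)
    fix e :: real assume "e > 0"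
    then obtain N where N: "inverse (real (Suc N)) < e\<^sup>2 / 4"
      using reals_Archimedean[of "e\<^sup>2/4"] by auto
    have "dist (v m) (v n) < e" if "N \<le> m" "N \<le> n" for m n
    proof -
      have "(norm (v m - v n))\<^sup>2 < e\<^sup>2" using dist_v[OF that] N by linarith
      then show ?thesis unfolding dist_norm by (rule power2_less_imp_less) (use \<open>e > 0\<close> in simp)
    qed
    then show "\<exists>M. \<forall>m\<ge>M. \<forall>n\<ge>M. dist (v m) (v n) < e" by blast
  qed
  then obtain p where p: "v \<longlonglongrightarrow> p" using Cauchy_convergent convergent_def by blast
  have pV: "p \<in> V" using cl p v(1) by (auto simp: closed_sequential_limits)
  have norm_p: "(norm (y - p))\<^sup>2 \<le> D\<^sup>2"
  proof (rule LIMSEQ_le)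
    show "(\<lambda>n. (norm (y - v n))\<^sup>2) \<longlonglongrightarrow> (norm (y - p))\<^sup>2"
      by (intro tendsto_intros p)
    show "(\<lambda>n. D\<^sup>2 + inverse (real (Suc n))) \<longlonglongrightarrow> D\<^sup>2"
      using LIMSEQ_inverse_real_of_nat_add[of "D\<^sup>2"] by simp
  qed (use v(2) less_imp_le in blast)
  have "cinner w (y - p) = 0" if w: "w \<in> V" for w
  proof (cases "w = 0")
    case False
    \<comment> \<open>\<open>c *\<^sub>C w\<close> is the component of y - p along w; removing it
      would shorten y - p unless it is zero.\<close>
    define c where "c = cinner w (y - p) / of_real ((norm w)\<^sup>2)"
    have nz: "complex_of_real ((norm w)\<^sup>2) \<noteq> 0" using False by simp
    have "p + c *\<^sub>C w \<in> V"
      using pV w V by (intro complex_vector.subspace_scale complex_vector.subspace_add)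
    from D_sq[OF this] norm_p have le: "(norm (y - p))\<^sup>2 \<le> (norm (y - p - c *\<^sub>C w))\<^sup>2"
      by (metis diff_diff_eq order_trans)
    have c1: "cinner w (y - p - c *\<^sub>C w) = 0"
      using nz by (simp add: cinner_diff_right cinner_scaleC_right cinner_self c_def del: of_real_power)
    have "inner (c *\<^sub>C w) (y - p - c *\<^sub>C w) = 0"
      by (simp add: inner_eq_Re_cinner cinner_scaleC_left c1)
    then have "(norm (y - p))\<^sup>2 = (norm (y - p - c *\<^sub>C w))\<^sup>2 + (norm (c *\<^sub>C w))\<^sup>2"
      using norm_add_Pythagorean[of "c *\<^sub>C w" "y - p - c *\<^sub>C w"] by (simp add: orthogonal_def add.commute)
    with le have "c *\<^sub>C w = 0" by simp
    then have "c = 0" using False by (metis norm_scaleC mult_eq_0_iff norm_eq_zero)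
    then show ?thesis using nz by (simp add: c_def)
  qed simp
  then show ?thesis using pV that by blast
qed

text \<open>
  The quantifier over all pairs $x', y'$ with the same coefficients makes the induction over the span go through.
\<close>

lemma unitary_between_extension_aux:
  fixes e :: "'i \<Rightarrow> 'a::complex_hilbert_space" and f :: "'i \<Rightarrow> 'b::complex_hilbert_space"
  assumes gram: "\<And>i j. i \<in> I \<Longrightarrow> j \<in> I \<Longrightarrow> cinner (f i) (f j) = cinner (e i) (e j)"
    and x: "x \<in> closure (cspan (e ` I))"
  shows "\<exists>y\<in>closure (cspan (f ` I)). \<forall>x' y'. (\<forall>i\<in>I. cinner (f i) y' = cinner (e i) x')
           \<longrightarrow> cinner y y' = cinner x x'"
proof -
  define Q where "Q x y \<longleftrightarrow> (\<forall>x' y'. (\<forall>i\<in>I. cinner (f i) y' = cinner (e i) x')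
           \<longrightarrow> cinner y y' = cinner x x')" for x y
  have Q0: "\<exists>y\<in>cspan (f ` I). Q x y" if "x \<in> cspan (e ` I)" for x
    using that
  proof (induction rule: complex_vector.span_induct_alt)
    case base
    show ?case by (rule bexI[of _ 0]) (auto simp: Q_def complex_vector.span_zero)
  next
    case (step c u v)
    then obtain i w where i: "i \<in> I" "u = e i" and w: "w \<in> cspan (f ` I)" "Q v w" by auto
    then have "c *\<^sub>C f i + w \<in> cspan (f ` I)"
      by (intro complex_vector.span_add[OF complex_vector.span_scale[OF complex_vector.span_base]]) auto
    with i w show ?case
      by (intro bexI[of _ "c *\<^sub>C f i + w"]) (auto simp: Q_def cinner_add_left cinner_scaleC_left)
  qed
  \<comment> \<open>The pairs (e i, f i) are admissible tests by \<open>gram\<close>, so a pair in Q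
    is itself an admissible test. Hence Q preserves inner products and carries Cauchy sequences
    over.\<close>
  have Q_refl: "cinner y y' = cinner x x'" if "Q x y" "Q x' y'" for x y x' y'
  proof -
    have "cinner (f i) y' = cinner (e i) x'" if i: "i \<in> I" for i
    proof -
      have "cinner y' (f i) = cinner x' (e i)"
        using \<open>Q x' y'\<close> gram i by (auto simp: Q_def)
      then show ?thesis by (metis cinner_commute)
    qed
    then show ?thesis using \<open>Q x y\<close> by (auto simp: Q_def)
  qed
  obtain X where X: "\<And>n. X n \<in> cspan (e ` I)" "X \<longlonglongrightarrow> x"
    using x by (auto simp: closure_sequential)
  obtain Y where Y: "\<And>n. Y n \<in> cspan (f ` I)" "\<And>n. Q (X n) (Y n)"
    using Q0[OF X(1)] by metis
  have "norm (Y m - Y n) = norm (X m - X n)" for m n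
    unfolding norm_eq_iff_cinner using Q_refl[OF Y(2) Y(2)] by (simp add: cinner_diff_left cinner_diff_right)
  then have "Cauchy Y"
    using LIMSEQ_imp_Cauchy[OF X(2)] by (simp add: Cauchy_def dist_norm)
  then obtain y where y: "Y \<longlonglongrightarrow> y" using Cauchy_convergent convergent_def by blast
  have "Q x y"
    unfolding Q_def
  proof (intro allI impI)
    fix x' y' assume *: "\<forall>i\<in>I. cinner (f i) y' = cinner (e i) x'"
    have "(\<lambda>n. cinner (Y n) y') \<longlonglongrightarrow> cinner y y'" "(\<lambda>n. cinner (X n) x') \<longlonglongrightarrow> cinner x x'"
      by (intro tendsto_cinner y X tendsto_const)+
    moreover have "cinner (Y n) y' = cinner (X n) x'" for n using Y(2)[of n] * by (auto simp: Q_def)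
    ultimately show "cinner y y' = cinner x x'" using LIMSEQ_unique by auto
  qed
  moreover have "y \<in> closure (cspan (f ` I))" using Y(1) y by (auto simp: closure_sequential)
  ultimately show ?thesis by (auto simp: Q_def)
qed

text \<open>A vector of the target space is determined by its inner products with the f i, so U x is
  the solution y of the linear system \<open>R x y\<close>. Linearity of U comes from that of R,
  surjectivity from the auxiliary lemma with e and f exchanged.\<close>

lemma unitary_between_extension:
  fixes e :: "'i \<Rightarrow> 'a::complex_hilbert_space" and f :: "'i \<Rightarrow> 'b::complex_hilbert_space"
  assumes gram: "\<And>i j. i \<in> I \<Longrightarrow> j \<in> I \<Longrightarrow> cinner (f i) (f j) = cinner (e i) (e j)"
  shows "\<exists>U. unitary_between (closure (cspan (e ` I))) (closure (cspan (f ` I))) U \<and> (\<forall>i\<in>I. U (e i) = f i)"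
proof -
  let ?V = "closure (cspan (e ` I))" and ?W = "closure (cspan (f ` I))"
  define R where "R x y \<longleftrightarrow> (\<forall>i\<in>I. cinner (f i) y = cinner (e i) x)" for x y
  have ex: "\<exists>y\<in>?W. \<forall>x' y'. R x' y' \<longrightarrow> cinner y y' = cinner x x'" if "x \<in> ?V" for x
    using unitary_between_extension_aux[OF gram that] by (auto simp: R_def)
  have ex': "\<exists>x\<in>?V. \<forall>x' y'. R x' y' \<longrightarrow> cinner x x' = cinner y y'" if "y \<in> ?W" for y
    
  proof -
    have "\<exists>x\<in>?V. \<forall>y' x'. (\<forall>i\<in>I. cinner (e i) x' = cinner (f i) y') \<longrightarrow> cinner x x' = cinner y y'"
      by (rule unitary_between_extension_aux[of I e f]) (use gram that in auto)
    then show ?thesis unfolding R_def by metis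
  qed
  from ex obtain U where U: "\<And>x. x \<in> ?V \<Longrightarrow> U x \<in> ?W"
    "\<And>x x' y'. x \<in> ?V \<Longrightarrow> R x' y' \<Longrightarrow> cinner (U x) y' = cinner x x'" by metis
  have Re: "R (e i) (f i)" if "i \<in> I" for i using gram that by (auto simp: R_def)
  have RU: "R x (U x)" if "x \<in> ?V" for x
    unfolding R_def
  proof
    fix i assume "i \<in> I"
    then have "cinner (U x) (f i) = cinner x (e i)" using U(2)[OF that Re] by simp
    then show "cinner (f i) (U x) = cinner (e i) x" by (metis cinner_commute)
  qed
  have U_eqI: "U x = y" if "x \<in> ?V" "y \<in> ?W" "R x y" for x y
    using RU[OF that(1)] that U(1) by (intro total_eqI[of "f ` I"]) (auto simp: R_def)
  note sub = csubspace_closure_cspan[of "e ` I"] csubspace_closure_cspan[of "f ` I"]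
  have "U ` ?V = ?W"
  proof (intro equalityI subsetI)
    fix y assume y: "y \<in> ?W"
    then obtain x where x: "x \<in> ?V" "\<And>x' y'. R x' y' \<Longrightarrow> cinner x x' = cinner y y'" using ex' by metis
    have "R x y"
      unfolding R_def using x(2)[OF Re] by (metis cinner_commute)
    then show "y \<in> U ` ?V" using U_eqI x(1) y by blast
  qed (use U in auto)
  moreover have "U (x + y) = U x + U y" if "x \<in> ?V" "y \<in> ?V" for x y
    using that RU[OF that(1)] RU[OF that(2)] U(1)
    by (intro U_eqI complex_vector.subspace_add[OF sub(1)] complex_vector.subspace_add[OF sub(2)])
       (auto simp: R_def cinner_add_right)
  moreover have "U (a *\<^sub>C x) = a *\<^sub>C U x" if "x \<in> ?V" for a x
    using that RU[OF that(1)] U(1)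
    by (intro U_eqI complex_vector.subspace_scale[OF sub(1)] complex_vector.subspace_scale[OF sub(2)])
       (auto simp: R_def cinner_scaleC_right)
  moreover have "cinner (U x) (U y) = cinner x y" if "x \<in> ?V" "y \<in> ?V" for x y
    using U(2)[OF that(1) RU[OF that(2)]] .
  moreover have "U (e i) = f i" if "i \<in> I" for i
    using that Re closure_cspan_superset[of "e ` I"] closure_cspan_superset[of "f ` I"] by (intro U_eqI) auto
  ultimately show ?thesis
    unfolding unitary_between_def by blast
qed

subsection \<open>Truncation and shift of square-integrable functions\<close>

lemma L2_cases:
  obtains f where "g = abs_L2 f" "L2_rel f f" "square_integrable half_line f"
  using L2_rel_rep[of g] abs_rep_L2[of g] that[of "rep_L2 g"] by (auto simp: L2_rel_def)

lemma L2_relI: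
  assumes "square_integrable half_line f" "square_integrable half_line g" "\<And>x. 0 \<le> x \<Longrightarrow> f x = g x"
  shows "L2_rel f g"
  using assms by (auto simp: L2_rel_def space_restrict_space intro!: AE_I2)

lemma L2_rel_refl_iff: "L2_rel f f \<longleftrightarrow> square_integrable half_line f"
  by (simp add: L2_rel_def)

lemma square_integrable_step:
  "square_integrable half_line (\<lambda>x. indicator {0..<t} x *\<^sub>R (c :: 'a::{complex_hilbert_space, second_countable_topology}))"
  using L2_step.rsp by (auto simp: rel_fun_def L2_rel_def)

lemma square_integrable_unshift:
  fixes f :: "real \<Rightarrow> 'a::{real_normed_vector, second_countable_topology}"
  assumes f: "square_integrable half_line f" and s: "0 \<le> s"
  shows "square_integrable half_line (\<lambda>x. f (x + s))"
proof -
  \<comment> \<open>Extension by zero to the whole line, where Lebesgue measure is translation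
    invariant.\<close>
  define F where "F x = indicator {0..} x *\<^sub>R f x" for x :: real
  have F [measurable]: "F \<in> borel_measurable borel"
    using f by (simp add: F_def[abs_def] square_integrable_def borel_measurable_restrict_space_iff)
  have "integrable lborel (\<lambda>x. indicator {0..} x *\<^sub>R (norm (f x))\<^sup>2)"
    using f by (simp add: square_integrable_def integrable_restrict_space)
  then have "integrable lborel (\<lambda>x. (norm (F x))\<^sup>2)"
    by (rule Bochner_Integration.integrable_cong[THEN iffD1, rotated 2]) (auto simp: F_def indicator_def)
  then have "integrable lborel (\<lambda>x. (norm (F (s + x)))\<^sup>2)"
    using lborel_integrable_real_affine[of "\<lambda>x. (norm (F x))\<^sup>2" 1 s] by simp
  then have "integrable half_line (\<lambda>x. (norm (F (s + x)))\<^sup>2)"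
    using integrable_mult_indicator[of "{0..}" lborel "\<lambda>x. (norm (F (s + x)))\<^sup>2"]
    by (simp add: integrable_restrict_space)
  moreover have "(\<lambda>x. F (s + x)) \<in> borel_measurable half_line"
    by (intro measurable_restrict_space1) simp
  ultimately have "square_integrable half_line (\<lambda>x. F (s + x))"
    by (simp add: square_integrable_def)
  moreover have F_eq: "F (s + x) = f (x + s)" if "x \<in> space half_line" for x
    using that s by (simp add: F_def space_restrict_space add.commute)
  ultimately show ?thesis
    unfolding square_integrable_def
    using measurable_cong[of half_line "\<lambda>x. F (s + x)" "\<lambda>x. f (x + s)" borel]
      Bochner_Integration.integrable_cong[of half_line half_line "\<lambda>x. (norm (F (s + x)))\<^sup>2" "\<lambda>x. (norm (f (x + s)))\<^sup>2"]
    by simp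
qed

text \<open>This will be the adjoint of \<open>L2_shift s\<close>. For s < 0 the formula would read
  f at negative arguments, where its class over \<open>half_line\<close> does not determine it;
  hence the default 0.\<close>

lift_definition L2_unshift :: "real \<Rightarrow> 'a::{complex_hilbert_space, second_countable_topology} L2 \<Rightarrow> 'a L2"
  is "\<lambda>s f x. if 0 \<le> s then f (x + s) else 0"
proof -
  fix s and f g :: "real \<Rightarrow> 'a"
  assume rel: "L2_rel f g"
  then have "AE x in lborel. 0 \<le> x \<longrightarrow> f x = g x" by (simp add: L2_rel_def AE_restrict_space_iff)
  then have "AE x in lborel. 0 \<le> x + s \<longrightarrow> f (x + s) = g (x + s)"
    using AE_distrD[of "(+) s" lborel borel "\<lambda>x. 0 \<le> x \<longrightarrow> f x = g x"]
    unfolding lborel_distr_plus by (simp add: add.commute)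
  then have "AE x in half_line. (if 0 \<le> s then f (x + s) else 0) = (if 0 \<le> s then g (x + s) else 0)"
    by (subst AE_restrict_space_iff) (auto elim: eventually_mono)
  then show "L2_rel (\<lambda>x. if 0 \<le> s then f (x + s) else 0) (\<lambda>x. if 0 \<le> s then g (x + s) else 0)"
    using rel square_integrable_unshift[of f s] square_integrable_unshift[of g s]
    by (cases "0 \<le> s") (auto simp: L2_rel_def square_integrable_zero)
qed

text \<open>
  The operations on representatives are named so that the closure rules for square integrability are first-order
  rewrite rules; stated for the bare $\lambda$-terms they would require higher-order unification.
\<close>

definition fun_truncate :: "real \<Rightarrow> (real \<Rightarrow> 'a::real_vector) \<Rightarrow> real \<Rightarrow> 'a" where
  "fun_truncate s f x = indicator {0..<s} x *\<^sub>R f x"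

definition fun_shift :: "real \<Rightarrow> (real \<Rightarrow> 'a::zero) \<Rightarrow> real \<Rightarrow> 'a" where
  "fun_shift s f x = (if s \<le> x then f (x - s) else 0)"

definition fun_unshift :: "real \<Rightarrow> (real \<Rightarrow> 'a::zero) \<Rightarrow> real \<Rightarrow> 'a" where
  "fun_unshift s f x = (if 0 \<le> s then f (x + s) else 0)"

definition fun_step :: "'a::real_vector \<Rightarrow> real \<Rightarrow> real \<Rightarrow> 'a" where
  "fun_step c t x = indicator {0..<t} x *\<^sub>R c"

lemmas fun_defs = fun_truncate_def fun_shift_def fun_unshift_def fun_step_def

lemma square_integrable_fun_truncate:
  fixes f :: "real \<Rightarrow> 'a::{real_normed_vector, second_countable_topology}"
  shows "square_integrable half_line f \<Longrightarrow> square_integrable half_line (fun_truncate s f)"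
  unfolding fun_truncate_def[abs_def] by (rule square_integrable_indicator) auto

lemma square_integrable_fun_shift:
  fixes f :: "real \<Rightarrow> 'a::{real_normed_vector, second_countable_topology}"
  shows "square_integrable half_line f \<Longrightarrow> square_integrable half_line (fun_shift s f)"
  unfolding fun_shift_def[abs_def] by (rule square_integrable_shift)

lemma square_integrable_fun_unshift:
  fixes f :: "real \<Rightarrow> 'a::{real_normed_vector, second_countable_topology}"
  shows "square_integrable half_line f \<Longrightarrow> square_integrable half_line (fun_unshift s f)"
  unfolding fun_unshift_def[abs_def]
  using square_integrable_unshift[of f s] by (cases "0 \<le> s") (auto simp: square_integrable_zero)

lemma square_integrable_fun_step:
  "square_integrable half_line (fun_step (c :: 'a::{complex_hilbert_space, second_countable_topology}) s)"
  unfolding fun_step_def[abs_def] by (rule square_integrable_step)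

lemmas sq_int = square_integrable_zero square_integrable_add square_integrable_scaleC
  square_integrable_fun_truncate square_integrable_fun_shift square_integrable_fun_unshift square_integrable_fun_step

lemma L2_ops_abs:
  assumes "square_integrable half_line f"
  shows "L2_truncate s (abs_L2 f) = abs_L2 (fun_truncate s f)"
    "L2_shift s (abs_L2 f) = abs_L2 (fun_shift s f)"
    "L2_unshift s (abs_L2 f) = abs_L2 (fun_unshift s f)"
    "a *\<^sub>C abs_L2 f = abs_L2 (\<lambda>x. a *\<^sub>C f x)"
    "square_integrable half_line g \<Longrightarrow> abs_L2 f + abs_L2 g = abs_L2 (\<lambda>x. f x + g x)"
  using assms
  by (simp_all add: L2_truncate.abs_eq L2_shift.abs_eq L2_unshift.abs_eq scaleC_L2.abs_eq plus_L2.abs_eq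
      L2_rel_refl_iff fun_defs[abs_def])

lemma L2_step_abs: "L2_step c s = abs_L2 (fun_step c s)"
  by (simp add: L2_step.abs_eq fun_step_def[abs_def])

lemma abs_L2_eqI:
  assumes "square_integrable half_line f" "square_integrable half_line g" "\<And>x. 0 \<le> x \<Longrightarrow> f x = g x"
  shows "abs_L2 f = abs_L2 g"
  by (rule Quotient3_rel_abs[OF Quotient3_L2], rule L2_relI) (use assms in auto)

lemmas L2_abs = L2_ops_abs L2_step_abs zero_L2_def

section \<open>Algebra of truncations, shifts and steps\<close>

lemma L2_truncate_add: "L2_truncate s (f + g) = L2_truncate s f + L2_truncate s g"
  by (cases f rule: L2_cases, cases g rule: L2_cases, simp add: L2_abs sq_int, rule abs_L2_eqI, simp add: sq_int, simp add: sq_int)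
    (auto simp: fun_defs indicator_def scaleR_scaleC scaleC_scaleC scaleC_add_right mult.commute)

lemma L2_truncate_scaleC: "L2_truncate s (a *\<^sub>C f) = a *\<^sub>C L2_truncate s f"
  by (cases f rule: L2_cases, simp add: L2_abs sq_int, rule abs_L2_eqI, simp add: sq_int, simp add: sq_int)
    (auto simp: fun_defs indicator_def scaleR_scaleC scaleC_scaleC scaleC_add_right mult.commute)

lemma L2_truncate_zero [simp]: "L2_truncate s 0 = 0"
  by (simp add: L2_abs sq_int, rule abs_L2_eqI, simp add: sq_int, simp add: sq_int)
    (auto simp: fun_defs indicator_def scaleR_scaleC scaleC_scaleC scaleC_add_right mult.commute)

lemma L2_truncate_truncate: "L2_truncate s (L2_truncate t f) = L2_truncate (min s t) f"
  by (cases f rule: L2_cases, simp add: L2_abs sq_int, rule abs_L2_eqI, simp add: sq_int, simp add: sq_int)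
    (auto simp: fun_defs indicator_def scaleR_scaleC scaleC_scaleC scaleC_add_right mult.commute)

lemma L2_unshift_add: "L2_unshift s (f + g) = L2_unshift s f + L2_unshift s g"
  by (cases f rule: L2_cases, cases g rule: L2_cases, simp add: L2_abs sq_int, rule abs_L2_eqI, simp add: sq_int, simp add: sq_int)
    (auto simp: fun_defs indicator_def scaleR_scaleC scaleC_scaleC scaleC_add_right mult.commute)

lemma L2_unshift_scaleC: "L2_unshift s (a *\<^sub>C f) = a *\<^sub>C L2_unshift s f"
  by (cases f rule: L2_cases, simp add: L2_abs sq_int, rule abs_L2_eqI, simp add: sq_int, simp add: sq_int)
    (auto simp: fun_defs indicator_def scaleR_scaleC scaleC_scaleC scaleC_add_right mult.commute)

lemma L2_unshift_shift: "0 \<le> s \<Longrightarrow> L2_unshift s (L2_shift s f) = f"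
  by (cases f rule: L2_cases, simp add: L2_abs sq_int, rule abs_L2_eqI, simp add: sq_int, simp add: sq_int)
    (auto simp: fun_defs indicator_def scaleR_scaleC scaleC_scaleC scaleC_add_right mult.commute)

lemma L2_truncate_shift: "L2_truncate s (L2_shift s f) = 0"
  by (cases f rule: L2_cases, simp add: L2_abs sq_int, rule abs_L2_eqI, simp add: sq_int, simp add: sq_int)
    (auto simp: fun_defs indicator_def scaleR_scaleC scaleC_scaleC scaleC_add_right mult.commute)

lemma L2_shift_unshift: "0 \<le> s \<Longrightarrow> L2_truncate s f + L2_shift s (L2_unshift s f) = f"
  by (cases f rule: L2_cases, simp add: L2_abs sq_int, rule abs_L2_eqI, simp add: sq_int, simp add: sq_int)
    (auto simp: fun_defs indicator_def scaleR_scaleC scaleC_scaleC scaleC_add_right mult.commute)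

lemma L2_unshift_truncate: "0 \<le> s \<Longrightarrow> L2_unshift s (L2_truncate (s + t) f) = L2_truncate t (L2_unshift s f)"
  by (cases f rule: L2_cases, simp add: L2_abs sq_int, rule abs_L2_eqI, simp add: sq_int, simp add: sq_int)
    (auto simp: fun_defs indicator_def scaleR_scaleC scaleC_scaleC scaleC_add_right mult.commute)

lemma L2_unshift_truncate_self: "0 \<le> s \<Longrightarrow> L2_unshift s (L2_truncate s f) = 0"
  by (cases f rule: L2_cases, simp add: L2_abs sq_int, rule abs_L2_eqI, simp add: sq_int, simp add: sq_int)
    (auto simp: fun_defs indicator_def scaleR_scaleC scaleC_scaleC scaleC_add_right mult.commute)

lemma L2_truncate_add_shift: "0 \<le> s \<Longrightarrow> 0 \<le> t \<Longrightarrow> L2_truncate (s + t) (L2_shift s f) = L2_shift s (L2_truncate t f)"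
  by (cases f rule: L2_cases, simp add: L2_abs sq_int, rule abs_L2_eqI, simp add: sq_int, simp add: sq_int)
    (auto simp: fun_defs indicator_def scaleR_scaleC scaleC_scaleC scaleC_add_right mult.commute)

lemma L2_truncate_step: "L2_truncate s (L2_step c t) = L2_step c (min s t)"
  by (simp add: L2_abs sq_int, rule abs_L2_eqI, simp add: sq_int, simp add: sq_int)
    (auto simp: fun_defs indicator_def scaleR_scaleC scaleC_scaleC scaleC_add_right mult.commute)

lemma L2_unshift_step: "0 \<le> s \<Longrightarrow> L2_unshift s (L2_step c (s + t)) = L2_step c t"
  by (simp add: L2_abs sq_int, rule abs_L2_eqI, simp add: sq_int, simp add: sq_int)
    (auto simp: fun_defs indicator_def scaleR_scaleC scaleC_scaleC scaleC_add_right mult.commute)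

lemma L2_step_add_time: "0 \<le> s \<Longrightarrow> 0 \<le> t \<Longrightarrow> L2_step c (s + t) = L2_step c s + L2_shift s (L2_step c t)"
  by (simp add: L2_abs sq_int, rule abs_L2_eqI, simp add: sq_int, simp add: sq_int)
    (auto simp: fun_defs indicator_def scaleR_scaleC scaleC_scaleC scaleC_add_right mult.commute)

lemma L2_step_add: "L2_step (c + d) t = L2_step c t + L2_step d t"
  by (simp add: L2_abs sq_int, rule abs_L2_eqI, simp add: sq_int, simp add: sq_int)
    (auto simp: fun_defs indicator_def scaleR_scaleC scaleC_scaleC scaleC_add_right mult.commute)

lemma L2_step_scaleC: "L2_step (z *\<^sub>C c) t = z *\<^sub>C L2_step c t"
  by (simp add: L2_abs sq_int, rule abs_L2_eqI, simp add: sq_int, simp add: sq_int)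
    (auto simp: fun_defs indicator_def scaleR_scaleC scaleC_scaleC scaleC_add_right mult.commute)

section \<open>Inner products of truncated, shifted and step functions\<close>

lemma cinner_L2_truncate: "cinner (L2_truncate s f) g = cinner (L2_truncate s f) (L2_truncate s g)"
  by transfer (auto simp: indicator_def intro!: Bochner_Integration.integral_cong)

lemma cinner_L2_truncate_right: "cinner f (L2_truncate s g) = cinner (L2_truncate s f) (L2_truncate s g)"
  by transfer (auto simp: indicator_def intro!: Bochner_Integration.integral_cong)

lemma cinner_L2_step_left:
  "cinner (L2_step c s) (abs_L2 f) = (\<integral>x. indicator {0..<s} x *\<^sub>R cinner c (f x) \<partial>half_line)"
  if "L2_rel f f"
  using that
  by (subst L2_step.abs_eq, subst cinner_L2.abs_eq, simp add: L2_rel_refl_iff square_integrable_step, assumption)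
    (auto simp: indicator_def intro!: Bochner_Integration.integral_cong)

lemma cinner_L2_step:
  assumes "0 \<le> t"
  shows "cinner (L2_step c t) (L2_step d t) = of_real t * cinner c d"
proof -
  have "cinner (L2_step c t) (L2_step d t) = (\<integral>x. indicator {0..<t} x *\<^sub>R cinner c d \<partial>half_line)"
    by transfer (auto simp: indicator_def intro!: Bochner_Integration.integral_cong)
  also have "\<dots> = (\<integral>x. indicator {0..<t} x *\<^sub>R cinner c d \<partial>lborel)"
    by (subst integral_restrict_space) (auto simp: indicator_def intro!: Bochner_Integration.integral_cong)
  also have "\<dots> = of_real t * cinner c d"
    using assms by (simp add: scaleR_conv_of_real)
  finally show ?thesis .
qed

lemma cinner_L2_shift_left:
  assumes "0 \<le> s"
  shows "cinner (L2_shift s f) g = cinner f (L2_unshift s g)"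
  using assms
proof transfer
  fix s :: real and f g :: "real \<Rightarrow> 'a"
  assume s: "0 \<le> s"
  have "(\<integral>x. cinner (if s \<le> x then f (x - s) else 0) (g x) \<partial>half_line)
      = (\<integral>x. indicator {0..} x *\<^sub>R cinner (if s \<le> x then f (x - s) else 0) (g x) \<partial>lborel)"
    by (subst integral_restrict_space) auto
  also have "\<dots> = (\<integral>x. indicator {0..} (s + x) *\<^sub>R cinner (if s \<le> s + x then f (s + x - s) else 0) (g (s + x)) \<partial>lborel)"
    using lborel_integral_real_affine[of 1 "\<lambda>x. indicator {0..} x *\<^sub>R cinner (if s \<le> x then f (x - s) else 0) (g x)" s]
    by (simp only: mult_1 abs_one scaleR_one)
  also have "\<dots> = (\<integral>x. indicator {0..} x *\<^sub>R cinner (f x) (if 0 \<le> s then g (x + s) else 0) \<partial>lborel)"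
    using s by (intro Bochner_Integration.integral_cong) (auto simp: indicator_def add.commute)
  also have "\<dots> = (\<integral>x. cinner (f x) (if 0 \<le> s then g (x + s) else 0) \<partial>half_line)"
    by (subst integral_restrict_space) auto
  finally show "(\<integral>x. cinner (if s \<le> x then f (x - s) else 0) (g x) \<partial>half_line)
      = (\<integral>x. cinner (f x) (if 0 \<le> s then g (x + s) else 0) \<partial>half_line)" .
qed

lemma adjoint_on_L2_shift:
  assumes "0 \<le> s"
  shows "adjoint_on UNIV (L2_shift s) h = L2_unshift s h"
  unfolding adjoint_on_def
proof (rule the_equality)
  fix x assume x: "x \<in> UNIV \<and> (\<forall>v\<in>UNIV. cinner v x = cinner (L2_shift s v) h)"
  then have "cinner (x - L2_unshift s h) (x - L2_unshift s h) = 0"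
    by (simp add: cinner_L2_shift_left[OF assms] cinner_diff_right[of _ x])
  then show "x = L2_unshift s h" by (simp add: cinner_self)
qed (simp add: cinner_L2_shift_left[OF assms])

text \<open>Exponentiating this sum gives the product formula that makes the structure map isometric
  on exponential vectors.\<close>

lemma cinner_L2_split:
  assumes "0 \<le> s"
  shows "cinner f g = cinner (L2_truncate s f) (L2_truncate s g) + cinner (L2_unshift s f) (L2_unshift s g)"
proof -
  have "cinner f g = cinner (L2_truncate s f + L2_shift s (L2_unshift s f)) g"
    using L2_shift_unshift[OF assms, of f] by simp
  then show ?thesis
    by (simp add: cinner_add_left cinner_L2_shift_left[OF assms] cinner_L2_truncate[of s f g])
qed

lemma norm_L2_split:
  assumes "0 \<le> s"
  shows "(norm f)\<^sup>2 = (norm (L2_truncate s f))\<^sup>2 + (norm (L2_unshift s f))\<^sup>2"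
  using cinner_L2_split[OF assms, of f f] unfolding cinner_self of_real_add[symmetric] of_real_eq_iff .

text \<open>Replaces the topological support by an equation that can be used for rewriting. The
  closed interval and the half-open one of \<open>L2_truncate\<close> differ by the null set
  {t}.\<close>

lemma essential_support_subset_iff:
  "essential_support g \<subseteq> {0..t} \<longleftrightarrow> L2_truncate t g = g"
proof transfer
  fix g :: "real \<Rightarrow> 'a" and t
  assume "L2_rel g g"
  then have sq: "square_integrable half_line g" by (simp add: L2_rel_def)
  let ?N = "\<lambda>x e. AE y in half_line. dist y x < e \<longrightarrow> g y = 0"
  have "L2_rel (\<lambda>x. indicator {0..<t} x *\<^sub>R g x) g \<longleftrightarrow> (AE x in half_line. t \<le> x \<longrightarrow> g x = 0)"
    unfolding L2_rel_def using sq square_integrable_indicator[OF sq, of "{0..<t}"]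
    by (subst AE_cong[of half_line _ "\<lambda>x. t \<le> x \<longrightarrow> g x = 0"]) (auto simp: space_restrict_space indicator_def)
  also have "\<dots> \<longleftrightarrow> {x. 0 \<le> x \<and> (\<forall>e>0. \<not> ?N x e)} \<subseteq> {0..t}"
  proof
    assume ae: "AE x in half_line. t \<le> x \<longrightarrow> g x = 0"
    have "?N x (x - t)" if "t < x" for x
      using ae by eventually_elim (auto simp: dist_real_def)
    then show "{x. 0 \<le> x \<and> (\<forall>e>0. \<not> ?N x e)} \<subseteq> {0..t}"
      by (force simp: not_le[symmetric])
  next
    assume sub: "{x. 0 \<le> x \<and> (\<forall>e>0. \<not> ?N x e)} \<subseteq> {0..t}"
    \<comment> \<open>The null neighbourhoods of the points off the support form an uncountable
      family. Each such point also lies in a rational interval on which g vanishes almost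
      everywhere, and there are only countably many of these.\<close>
    define P where "P = {(q, r). q \<in> \<rat> \<and> r \<in> \<rat> \<and> (AE y in half_line. q < y \<and> y < r \<longrightarrow> g y = 0)}"
    have "countable P"
      by (rule countable_subset[of _ "\<rat> \<times> \<rat>"]) (auto simp: P_def countable_rat)
    then have "AE y in half_line. \<forall>p\<in>P. fst p < y \<and> y < snd p \<longrightarrow> g y = 0"
      by (subst AE_ball_countable) (auto simp: P_def)
    moreover have "AE y in half_line. y \<noteq> t"
      using AE_lborel_singleton[of t] by (auto simp: AE_restrict_space_iff elim: eventually_mono)
    moreover have "AE y in half_line. 0 \<le> y" by (intro AE_I2) (simp add: space_restrict_space)
    ultimately show "AE x in half_line. t \<le> x \<longrightarrow> g x = 0"
    proof eventually_elim
      case (elim x)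
      show ?case
      proof
        assume "t \<le> x"
        then have "x \<notin> {0..t}" using elim by auto
        then obtain e where e: "e > 0" "?N x e" using sub elim by blast
        obtain q where q: "q \<in> \<rat>" "x - e < q" "q < x" using Rats_dense_in_real[of "x - e" x] e(1) by auto
        obtain r where r: "r \<in> \<rat>" "x < r" "r < x + e" using Rats_dense_in_real[of x "x + e"] e(1) by auto
        have "AE y in half_line. q < y \<and> y < r \<longrightarrow> g y = 0"
          using e(2) by eventually_elim (use q r in \<open>auto simp: dist_real_def\<close>)
        then have "(q, r) \<in> P" using q r by (simp add: P_def)
        then show "g x = 0" using elim q r by force
      qed
    qed
  qed
  finally show "({x. 0 \<le> x \<and> (\<forall>e>0. \<not> ?N x e)} \<subseteq> {0..t}) \<longleftrightarrow> L2_rel (\<lambda>x. indicator {0..<t} x *\<^sub>R g x) g"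
    by simp
qed

lemma K_upto_iff: "g \<in> K_upto t \<longleftrightarrow> L2_truncate t g = g"
  by (simp add: K_upto_def essential_support_subset_iff)

lemma L2_truncate_in_K_upto: "L2_truncate t g \<in> K_upto t"
  by (simp add: K_upto_iff L2_truncate_truncate)

lemma zero_in_K_upto: "0 \<in> K_upto t"
  by (simp add: K_upto_iff)

lemma scaleC_in_K_upto: "g \<in> K_upto t \<Longrightarrow> a *\<^sub>C g \<in> K_upto t"
  by (simp add: K_upto_iff L2_truncate_scaleC)

lemma K_upto_mono: "s \<le> t \<Longrightarrow> K_upto s \<subseteq> K_upto t"
  by (force simp: K_upto_def)

lemma L2_step_in_K_upto: "s \<le> t \<Longrightarrow> L2_step c s \<in> K_upto t"
  by (simp add: K_upto_iff L2_truncate_step min_absorb2)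

lemma L2_unshift_in_K_upto: "0 \<le> s \<Longrightarrow> h \<in> K_upto (s + t) \<Longrightarrow> L2_unshift s h \<in> K_upto t"
  unfolding K_upto_iff by (metis L2_unshift_truncate)

lemma shift_in_K_upto: "0 \<le> s \<Longrightarrow> 0 \<le> t \<Longrightarrow> g \<in> K_upto t \<Longrightarrow> L2_shift s g \<in> K_upto (s + t)"
  unfolding K_upto_iff by (simp add: L2_truncate_add_shift)

text \<open>Any two functions can be concatenated, so the images of exponential vectors under the
  structure map are all tensors of exponential vectors and thus total in the tensor space.\<close>

lemma L2_truncate_unshift_surj:
  assumes "0 \<le> s" "0 \<le> t" "f \<in> K_upto s" "g \<in> K_upto t"
  obtains h where "h \<in> K_upto (s + t)" "L2_truncate s h = f" "L2_unshift s h = g"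
proof
  have f: "L2_truncate s f = f" using assms by (simp add: K_upto_iff)
  have "f \<in> K_upto (s + t)" using assms K_upto_mono[of s "s + t"] by auto
  with shift_in_K_upto[OF assms(1,2,4)] show "f + L2_shift s g \<in> K_upto (s + t)"
    by (simp add: K_upto_iff L2_truncate_add)
  show "L2_truncate s (f + L2_shift s g) = f"
    by (simp add: L2_truncate_add L2_truncate_shift f)
  have "L2_unshift s f = 0" using L2_unshift_truncate_self[OF assms(1), of f] f by simp
  then show "L2_unshift s (f + L2_shift s g) = g"
    by (simp add: L2_unshift_add L2_unshift_shift assms)
qed

section \<open>Totality of the step functions\<close>

lemma bounded_linear_cinner_right: "bounded_linear (cinner (x :: 'a::complex_inner))"
  by (rule bounded_linear_intro[of _ "norm x"])
    (simp_all add: cinner_add_right cinner_scaleR_right scaleR_conv_of_real cmod_cinner_le mult.commute[of _ "norm x"])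

text \<open>The half lines are stable under intersection and generate the Borel sets. The sets over
  which F integrates to 0 are closed under complements, by \<open>total\<close>, and under disjoint
  countable unions.\<close>

lemma AE_zero_if_integral_lessThan_zero:
  fixes F :: "real \<Rightarrow> 'a::{banach, second_countable_topology}"
  assumes F: "integrable lborel F"
    and zero: "\<And>s. (\<integral>x. indicator {..<s} x *\<^sub>R F x \<partial>lborel) = 0"
    and total: "(\<integral>x. F x \<partial>lborel) = 0"
  shows "AE x in lborel. F x = 0"
proof (rule sigma_finite_measure.density_zero[OF lborel.sigma_finite_measure_axioms F])
  have sets_eq: "sets (lborel :: real measure) = sigma_sets UNIV (range lessThan)"
    by (subst sets_lborel, subst borel_eq_lessThan) (simp add: eucl_lessThan)
  fix A :: "real set" assume "A \<in> sets lborel"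
  then have A: "A \<in> sigma_sets UNIV (range lessThan)" by (simp only: sets_eq)
  have in_borel: "B \<in> sets lborel" if "B \<in> sigma_sets UNIV (range lessThan)" for B :: "real set"
    using that by (simp only: sets_eq)
  show "set_lebesgue_integral lborel A F = 0"
  proof (rule sigma_sets_induct_disjoint[OF _ _ A])
    have "{..<a} \<inter> {..<b} = {..<min a b}" for a b :: real by auto
    then show "Int_stable (range lessThan :: real set set)"
      by (auto simp: Int_stable_def)
  next
    fix B assume B: "B \<in> sigma_sets UNIV (range lessThan)" "set_lebesgue_integral lborel B F = 0"
    have int: "integrable lborel (\<lambda>x. indicator B x *\<^sub>R F x)"
      using in_borel[OF B(1)] F by (intro integrable_mult_indicator)
    have "set_lebesgue_integral lborel (UNIV - B) F = (\<integral>x. F x - indicator B x *\<^sub>R F x \<partial>lborel)"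
      unfolding set_lebesgue_integral_def
      by (intro Bochner_Integration.integral_cong) (auto simp: indicator_def)
    then show "set_lebesgue_integral lborel (UNIV - B) F = 0"
      using B(2) int F total by (simp add: set_lebesgue_integral_def)
  next
    fix B :: "nat \<Rightarrow> real set"
    assume B: "disjoint_family B" "range B \<subseteq> sigma_sets UNIV (range lessThan)"
      "\<And>i. set_lebesgue_integral lborel (B i) F = 0"
    have B_borel: "B i \<in> sets lborel" for i using B(2) in_borel by blast
    have "set_integrable lborel (\<Union>i. B i) F"
      unfolding set_integrable_def using B_borel F by (intro integrable_mult_indicator) auto
    then have "set_lebesgue_integral lborel (\<Union>i. B i) F = (\<Sum>i. set_lebesgue_integral lborel (B i) F)"
      using B(1) B_borel
      by (intro lebesgue_integral_countable_add) (auto simp: disjoint_family_on_def)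
    then show "set_lebesgue_integral lborel (\<Union>i. B i) F = 0" using B(3) by simp
  qed (auto simp: set_lebesgue_integral_def zero)
qed

text \<open>A vector orthogonal to all steps has vanishing indefinite integral, hence vanishes
  almost everywhere; the projection theorem turns this into density.\<close>

lemma L2_steps_total:
  "closure (cspan {L2_step c s | c s. 0 < s}) = (UNIV :: 'a::{complex_hilbert_space, second_countable_topology} L2 set)"
proof -
  let ?V = "closure (cspan {L2_step c s | (c :: 'a) s. 0 < s})"
  have zero: "r = 0" if orth: "\<And>c s. 0 < s \<Longrightarrow> cinner (L2_step c s) r = 0" for r :: "'a L2"
  proof -
    obtain f where f: "r = abs_L2 f" "L2_rel f f" "square_integrable half_line f" by (rule L2_cases)
    \<comment> \<open>A square-integrable function on the half line need not be integrable; on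
      {0..<n} it is, by a \<le> 1 + a^2.\<close>
    have "AE x in lborel. indicator {0..<real n} x *\<^sub>R f x = 0" for n
    proof (rule AE_zero_if_integral_lessThan_zero)
      have meas: "(\<lambda>x. indicator {0..} x *\<^sub>R f x) \<in> borel_measurable borel"
        using f(3) by (simp add: square_integrable_def borel_measurable_restrict_space_iff)
      have "(\<lambda>x. indicator {0..<real n} x *\<^sub>R (indicator {0..} x *\<^sub>R f x)) \<in> borel_measurable lborel"
        by (rule borel_measurable_scaleR) (use meas in \<open>simp_all del: borel_measurable_scaleR\<close>)
      then have meas': "(\<lambda>x. indicator {0..<real n} x *\<^sub>R f x) \<in> borel_measurable lborel"
        by (rule measurable_cong[THEN iffD1, rotated]) (auto simp: indicator_def)
      show int: "integrable lborel (\<lambda>x. indicator {0..<real n} x *\<^sub>R f x)"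
      proof (rule Bochner_Integration.integrable_bound)
        show "integrable lborel (\<lambda>x. indicator {0..<real n} x + indicator {0..} x *\<^sub>R (norm (f x))\<^sup>2)"
          using f(3) by (intro Bochner_Integration.integrable_add integrable_real_indicator emeasure_bounded_finite)
            (auto simp: square_integrable_def integrable_restrict_space)
        have "a \<le> 1 + a\<^sup>2" for a :: real
          using sum_squares_bound[of a 1] zero_le_power2[of a] unfolding power_one by linarith
        then show "AE x in lborel. norm (indicator {0..<real n} x *\<^sub>R f x)
            \<le> norm (indicator {0..<real n} x + indicator {0..} x *\<^sub>R (norm (f x))\<^sup>2)"
          by (intro AE_I2) (auto simp: indicator_def)
      qed (rule meas')
      have step_int: "(\<integral>x. indicator {0..<s} x *\<^sub>R f x \<partial>lborel) = 0" if "0 < s" "s \<le> real n" for s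
      proof -
        have eq: "indicator {0..<s} x *\<^sub>R f x = indicator {..<s} x *\<^sub>R (indicator {0..<real n} x *\<^sub>R f x)" for x
          using that by (auto simp: indicator_def)
        have ints: "integrable lborel (\<lambda>x. indicator {0..<s} x *\<^sub>R f x)"
          unfolding eq by (intro integrable_mult_indicator int) simp
        \<comment> \<open>The value of the step is chosen to be the vector-valued integral itself,
          so that orthogonality reads <v, v> = 0.\<close>
        define v where "v = (\<integral>x. indicator {0..<s} x *\<^sub>R f x \<partial>lborel)"
        have "cinner v v = (\<integral>x. cinner v (indicator {0..<s} x *\<^sub>R f x) \<partial>lborel)"
          unfolding v_def by (rule integral_bounded_linear[OF bounded_linear_cinner_right ints, symmetric])
        also have "\<dots> = (\<integral>x. indicator {0..<s} x *\<^sub>R cinner v (f x) \<partial>half_line)"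
          by (subst integral_restrict_space) (auto simp: indicator_def intro!: Bochner_Integration.integral_cong)
        also have "\<dots> = cinner (L2_step v s) r"
          unfolding f(1) by (rule cinner_L2_step_left[OF f(2), symmetric])
        also have "\<dots> = 0" by (rule orth) fact
        finally show ?thesis by (simp add: cinner_self v_def)
      qed
      have zero_n: "(\<integral>x. indicator {0..<real n} x *\<^sub>R f x \<partial>lborel) = 0"
        using step_int[of "real n"] by (cases "n = 0") auto
      then show "(\<integral>x. indicator {0..<real n} x *\<^sub>R f x \<partial>lborel) = 0" .
      fix s
      have "(\<integral>x. indicator {..<s} x *\<^sub>R (indicator {0..<real n} x *\<^sub>R f x) \<partial>lborel)
          = (\<integral>x. indicator {0..<min s n} x *\<^sub>R f x \<partial>lborel)"
        by (intro Bochner_Integration.integral_cong) (auto simp: indicator_def)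
      then show "(\<integral>x. indicator {..<s} x *\<^sub>R (indicator {0..<real n} x *\<^sub>R f x) \<partial>lborel) = 0"
        using step_int[of "min s n"] by (cases "0 < min s n") auto
    qed
    then have "AE x in lborel. \<forall>n. indicator {0..<real n} x *\<^sub>R f x = 0"
      unfolding AE_all_countable by blast
    then have "AE x in lborel. x \<in> {0..} \<longrightarrow> f x = 0"
    proof eventually_elim
      case (elim x)
      obtain n where n: "x < real n" using reals_Archimedean2 by blast
      have "indicator {0..<real n} x *\<^sub>R f x = 0" using elim by blast
      then show ?case using n by auto
    qed
    then have "AE x in half_line. f x = 0" by (simp add: AE_restrict_space_iff)
    then have "L2_rel f (\<lambda>_. 0)" using f by (simp add: L2_rel_def square_integrable_zero)
    then show "r = 0" unfolding f(1) zero_L2_def using Quotient3_rel[OF Quotient3_L2] f(2)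
      by (metis (mono_tags, lifting) L2_rel_refl_iff square_integrable_zero)
  qed
  have "y \<in> ?V" for y :: "'a L2"
  proof -
    obtain p where p: "p \<in> ?V" "\<And>v. v \<in> ?V \<Longrightarrow> cinner v (y - p) = 0"
      using orthogonal_projection[OF csubspace_closure_cspan closed_closure, of "{L2_step c s | (c :: 'a) s. 0 < s}" y] by blast
    have "y - p = 0"
      using closure_cspan_superset[of "{L2_step c s | (c :: 'a) s. 0 < s}"]
      by (intro zero p(2)) auto
    then show ?thesis using p(1) by simp
  qed
  then show ?thesis by auto
qed

subsection \<open>Exponential and one-particle vectors\<close>

lemma orthonormal_Int_onb: "orthonormal (F \<inter> onb)"
  using orthonormal_basis_onb unfolding orthonormal_basis_def by (blast intro: orthonormal_subset)

lift_definition onb_coords :: "'h::complex_hilbert_space \<Rightarrow> 'h ell2"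
  is "\<lambda>h x. if x \<in> onb then cinner x h else 0"
proof -
  fix h :: 'h
  have "(\<Sum>x\<in>F. (cmod (if x \<in> onb then cinner x h else 0))\<^sup>2) \<le> (norm h)\<^sup>2" if "finite F" for F
  proof -
    have "orthonormal (F \<inter> onb)" by (rule orthonormal_Int_onb)
    then have "(\<Sum>x\<in>F \<inter> onb. (cmod (cinner x h))\<^sup>2) \<le> (norm h)\<^sup>2"
      using that by (intro bessel) auto
    also have "(\<Sum>x\<in>F \<inter> onb. (cmod (cinner x h))\<^sup>2) = (\<Sum>x\<in>F. (cmod (if x \<in> onb then cinner x h else 0))\<^sup>2)"
      using that by (intro sum.mono_neutral_cong_left) auto
    finally show ?thesis .
  qed
  then show "(\<lambda>x. (cmod (if x \<in> onb then cinner x h else 0))\<^sup>2) summable_on UNIV"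
    by (intro nonneg_bdd_above_summable_on bdd_aboveI2[where M = "(norm h)\<^sup>2"]) auto
qed

lemma onb_coords_linear:
  "onb_coords (f + g) = onb_coords f + onb_coords g"
  "onb_coords (a *\<^sub>C f) = a *\<^sub>C onb_coords f"
  by (transfer, auto simp: cinner_add_right cinner_scaleC_right)+

lemma norm_onb_coords_le: "norm (onb_coords h) \<le> norm h"
proof (rule power2_le_imp_le)
  have "(\<Sum>x\<in>F. (cmod (coord (onb_coords h) x))\<^sup>2) \<le> (norm h)\<^sup>2" if "finite F" for F
    using that bessel[OF orthonormal_Int_onb, of F h]
    by (subst sum.mono_neutral_cong_right[where S = "F \<inter> onb" and h = "\<lambda>x. (cmod (cinner x h))\<^sup>2"])
      (auto simp: onb_coords.rep_eq)
  then show "(norm (onb_coords h))\<^sup>2 \<le> (norm h)\<^sup>2"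
    unfolding norm_ell2_sq using coord[of "onb_coords h"] by (intro infsum_le_finite_sums) auto
qed simp

lemma bounded_linear_onb_coords: "bounded_linear onb_coords"
  by (rule bounded_linear_intro[of _ 1])
    (simp_all add: onb_coords_linear scaleR_scaleC norm_onb_coords_le)

lemma cinner_ell2_delta:
  assumes "\<And>y. coord \<phi> y = (if y = x then 1 else 0)"
  shows "cinner \<phi> \<psi> = coord \<psi> x"
proof -
  have "(\<Sum>\<^sub>\<infinity>y. cnj (coord \<phi> y) * coord \<psi> y) = (\<Sum>\<^sub>\<infinity>y\<in>{x}. cnj (coord \<phi> y) * coord \<psi> y)"
    by (rule infsum_cong_neutral) (auto simp: assms)
  then show ?thesis by (simp add: cinner_ell2.rep_eq assms)
qed

text \<open>True for f in the basis, where \<open>onb_coords f\<close> is a delta family. Both sides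
  are conjugate linear and continuous in f, so the identity extends to the closed span.\<close>

lemma parseval: "cinner (onb_coords f) (onb_coords g) = cinner f g"
proof -
  have ortho: "cinner x y = (if x = y then 1 else 0)" if "x \<in> onb" "y \<in> onb" for x y :: 'a
    using orthonormal_basis_onb that by (auto simp: orthonormal_basis_def orthonormal_def)
  have "closure (cspan onb) \<subseteq> {f. cinner (onb_coords f) (onb_coords g) = cinner f g}"
  proof (rule closure_cspan_minimal)
    show "onb \<subseteq> {f. cinner (onb_coords f) (onb_coords g) = cinner f g}"
    proof clarify
      fix x :: 'a assume x: "x \<in> onb"
      have "cinner (onb_coords x) (onb_coords g) = coord (onb_coords g) x"
        by (rule cinner_ell2_delta) (use x in \<open>auto simp: onb_coords.rep_eq ortho\<close>)
      then show "cinner (onb_coords x) (onb_coords g) = cinner x g"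
        using x by (simp add: onb_coords.rep_eq)
    qed
    show "csubspace {f. cinner (onb_coords f) (onb_coords g) = cinner f g}"
      using onb_coords_linear(2)[of 0 "0 :: 'a"]
      by (intro complex_vector.subspaceI) (auto simp: onb_coords_linear cinner_add_left cinner_scaleC_left)
    show "closed {f. cinner (onb_coords f) (onb_coords g) = cinner f g}"
      by (intro closed_Collect_eq_sequential tendsto_cinner tendsto_const
          bounded_linear.tendsto[OF bounded_linear_onb_coords])
  qed
  then show ?thesis using orthonormal_basis_onb by (auto simp: orthonormal_basis_def)
qed

text \<open>The summand of Parseval's series. Being 0 off the basis, it makes its product over a
  word the summand for tensor powers without a side condition on the letters.\<close>

definition letter_weight :: "'h::complex_hilbert_space \<Rightarrow> 'h \<Rightarrow> 'h \<Rightarrow> complex" where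
  "letter_weight f g x = (if x \<in> onb then cnj (cinner x f) * cinner x g else 0)"

lemma infsum_letter_weight: "(\<Sum>\<^sub>\<infinity>x. letter_weight f g x) = cinner f g"
  unfolding parseval[of f g, symmetric] cinner_ell2.rep_eq onb_coords.rep_eq letter_weight_def
  by (intro infsum_cong) auto

lemma coord_tensor_power_mult:
  "cnj (coord (tensor_power n f) xs) * coord (tensor_power n g) xs =
     (if length xs = n then \<Prod>x\<leftarrow>xs. letter_weight f g x else 0)"
proof -
  have "(\<Prod>x\<leftarrow>xs. letter_weight f g x) =
      (if set xs \<subseteq> onb then cnj (\<Prod>x\<leftarrow>xs. cinner x f) * (\<Prod>x\<leftarrow>xs. cinner x g) else 0)"
    by (induction xs) (simp_all add: letter_weight_def)
  then show ?thesis by (auto simp: tensor_power.rep_eq)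
qed

text \<open>Splitting off the first letter turns words of length n + 1 into pairs, and Fubini
  factorises the sum. The premise is what Fubini needs; it will come from square summability of
  tensor powers.\<close>

lemma infsum_words:
  fixes w :: "'a \<Rightarrow> complex"
  assumes "\<And>n. (\<lambda>xs. \<Prod>x\<leftarrow>xs. w x) summable_on {xs. length xs = n}"
  shows "(\<Sum>\<^sub>\<infinity>xs\<in>{xs. length xs = n}. \<Prod>x\<leftarrow>xs. w x) = (\<Sum>\<^sub>\<infinity>x. w x) ^ n"
proof (induction n)
  case 0
  have "{xs :: 'a list. length xs = 0} = {[]}" by auto
  then show ?case by simp
next
  case (Suc n)
  let ?L = "{xs :: 'a list. length xs = n}"
  have eq: "{xs :: 'a list. length xs = Suc n} = (\<lambda>(x, xs). x # xs) ` (UNIV \<times> ?L)"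
    by (auto simp: length_Suc_conv image_iff)
  have inj: "inj_on (\<lambda>(x, xs). x # xs) (UNIV \<times> ?L)" by (auto simp: inj_on_def)
  have summable: "(\<lambda>(x, xs). w x * (\<Prod>x\<leftarrow>xs. w x)) summable_on UNIV \<times> ?L"
    using assms[of "Suc n"] unfolding eq summable_on_reindex[OF inj] by (simp add: o_def case_prod_unfold)
  have "(\<Sum>\<^sub>\<infinity>xs\<in>{xs. length xs = Suc n}. \<Prod>x\<leftarrow>xs. w x) = (\<Sum>\<^sub>\<infinity>(x, xs)\<in>UNIV \<times> ?L. w x * (\<Prod>x\<leftarrow>xs. w x))"
    unfolding eq infsum_reindex[OF inj] by (simp add: o_def case_prod_unfold)
  also have "\<dots> = (\<Sum>\<^sub>\<infinity>x. \<Sum>\<^sub>\<infinity>xs\<in>?L. w x * (\<Prod>x\<leftarrow>xs. w x))"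
    by (rule infsum_Sigma'_banach[symmetric]) (use summable in simp)
  also have "\<dots> = (\<Sum>\<^sub>\<infinity>x. w x) ^ Suc n"
    by (simp add: infsum_cmult_right' infsum_cmult_left' Suc.IH)
  finally show ?case .
qed

lemma summable_words: "(\<lambda>xs. \<Prod>x\<leftarrow>xs. letter_weight f g x) summable_on {xs. length xs = n}"
proof -
  have "(\<lambda>xs. cnj (coord (tensor_power n f) xs) * coord (tensor_power n g) xs) summable_on UNIV"
    using coord[of "tensor_power n f"] coord[of "tensor_power n g"] by (intro square_summable_cinner) auto
  then show ?thesis
    unfolding coord_tensor_power_mult
    by (rule summable_on_cong_neutral[THEN iffD1, rotated -1]) auto
qed

lemma infsum_words_letter_weight:
  "(\<Sum>\<^sub>\<infinity>xs\<in>{xs. length xs = n}. \<Prod>x\<leftarrow>xs. letter_weight f g x) = cinner f g ^ n"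
  unfolding infsum_letter_weight[symmetric] by (rule infsum_words[OF summable_words])

lemma cinner_tensor_power: "cinner (tensor_power n f) (tensor_power n g) = cinner f g ^ n"
  unfolding cinner_ell2.rep_eq coord_tensor_power_mult infsum_words_letter_weight[symmetric]
  by (rule infsum_cong_neutral) auto

text \<open>Grouped by length, the words of length n contribute <f, g>^n / n!, the two
  normalisations 1/sqrt(n!) combining. The set \<open>?S\<close> is the disjoint union over the
  lengths.\<close>

lemma cinner_expvec: "cinner (expvec f) (expvec g) = exp (cinner f g)"
proof -
  let ?W = "\<lambda>xs. \<Prod>x\<leftarrow>xs. letter_weight f g x"
  let ?S = "SIGMA n:UNIV. {xs :: 'a list. length xs = n}"
  have inj: "inj_on snd ?S" and img: "snd ` ?S = UNIV" by (auto simp: inj_on_def image_iff)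
  have summand: "cnj (coord (expvec f) xs) * coord (expvec g) xs = ?W xs / fact (length xs)" for xs
  proof -
    have "cnj (coord (expvec f) xs) * coord (expvec g) xs =
        cnj (coord (tensor_power (length xs) f) xs) * coord (tensor_power (length xs) g) xs
          / (complex_of_real (sqrt (fact (length xs)) * sqrt (fact (length xs))))"
      by (simp add: expvec.rep_eq del: real_sqrt_mult_self)
    then show ?thesis by (simp add: coord_tensor_power_mult)
  qed
  have "(\<lambda>xs. ?W xs / fact (length xs)) summable_on snd ` ?S"
    unfolding img summand[symmetric]
    using coord[of "expvec f"] coord[of "expvec g"] by (intro square_summable_cinner) auto
  then have summable: "(\<lambda>(n, xs). ?W xs / fact (length xs)) summable_on ?S"
    unfolding summable_on_reindex[OF inj] by (simp add: o_def case_prod_unfold)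
  have "cinner (expvec f) (expvec g) = (\<Sum>\<^sub>\<infinity>xs\<in>snd ` ?S. ?W xs / fact (length xs))"
    unfolding img by (simp add: cinner_ell2.rep_eq summand)
  also have "\<dots> = (\<Sum>\<^sub>\<infinity>(n, xs)\<in>?S. ?W xs / fact (length xs))"
    unfolding infsum_reindex[OF inj] by (simp add: o_def case_prod_unfold)
  also have "\<dots> = (\<Sum>\<^sub>\<infinity>n. \<Sum>\<^sub>\<infinity>xs\<in>{xs. length xs = n}. ?W xs / fact (length xs))"
    by (rule infsum_Sigma'_banach[symmetric]) (use summable in simp)
  also have "\<dots> = (\<Sum>\<^sub>\<infinity>n. \<Sum>\<^sub>\<infinity>xs\<in>{xs. length xs = n}. ?W xs * (1 / fact n))"
    by (intro infsum_cong) auto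
  also have "\<dots> = (\<Sum>\<^sub>\<infinity>n. cinner f g ^ n * (1 / fact n))"
    by (simp add: infsum_cmult_left' infsum_words_letter_weight del: times_divide_eq_right)
  also have "\<dots> = exp (cinner f g)"
  proof (intro infsumI norm_summable_imp_has_sum)
    show "summable (\<lambda>n. norm (cinner f g ^ n * (1 / fact n)))"
      using summable_norm_exp[of "cinner f g"] by (simp add: scaleR_conv_of_real divide_inverse mult.commute)
    show "(\<lambda>n. cinner f g ^ n * (1 / fact n)) sums exp (cinner f g)"
      using exp_converges[of "cinner f g"] by (simp add: scaleR_conv_of_real divide_inverse mult.commute)
  qed
  finally show ?thesis .
qed

section \<open>One-particle vectors as derivatives of exponential vectors\<close>

definition one_particle :: "'h::complex_hilbert_space \<Rightarrow> 'h list ell2" where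
  "one_particle h = tensor_power 1 h"

lemma coord_one_particle:
  "coord (one_particle h) xs = (case xs of [x] \<Rightarrow> if x \<in> onb then cinner x h else 0 | _ \<Rightarrow> 0)"
  by (auto simp: one_particle_def tensor_power.rep_eq split: list.split)

lemma coord_eqI: "(\<And>i. coord x i = coord y i) \<Longrightarrow> x = y"
  by (simp add: coord_inject[symmetric] fun_eq_iff)

lemma one_particle_add: "one_particle (f + g) = one_particle f + one_particle g"
  by (rule coord_eqI) (auto simp: coord_one_particle plus_ell2.rep_eq cinner_add_right split: list.split)

lemma one_particle_scaleC: "one_particle (a *\<^sub>C f) = a *\<^sub>C one_particle f"
  by (rule coord_eqI) (auto simp: coord_one_particle scaleC_ell2.rep_eq cinner_scaleC_right split: list.split)

lemma one_particle_zero [simp]: "one_particle 0 = 0"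
  using one_particle_scaleC[of 0 0] by simp

lemma one_particle_in_sym_fock: "one_particle h \<in> sym_fock"
  unfolding sym_fock_def
proof (intro CollectI conjI allI impI)
  fix xs :: "'a list" assume "\<not> set xs \<subseteq> onb"
  then show "coord (one_particle h) xs = 0"
    by (simp add: one_particle_def tensor_power.rep_eq)
next
  fix xs ys :: "'a list" assume eq: "mset xs = mset ys"
  show "coord (one_particle h) xs = coord (one_particle h) ys"
  proof (cases "length xs = 1")
    case True
    then obtain x where x: "xs = [x]" by (auto simp: length_Suc_conv)
    then have "ys = [x]" using eq by simp
    with x show ?thesis by simp
  next
    case False
    then show ?thesis
      using mset_eq_length[OF eq] by (simp add: one_particle_def tensor_power.rep_eq)
  qed
qed

lemma cinner_one_particle: "cinner (one_particle f) (one_particle g) = cinner f g"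
  by (simp add: one_particle_def cinner_tensor_power del: One_nat_def)

text \<open>Only words of one letter contribute, and there the normalisation 1/sqrt(1!) is
  1.\<close>

lemma cinner_expvec_one_particle: "cinner (expvec f) (one_particle g) = cinner f g"
proof -
  have "cinner (expvec f) (one_particle g) = cinner (one_particle f) (one_particle g)"
    unfolding cinner_ell2.rep_eq
    by (intro infsum_cong) (auto simp: coord_one_particle expvec.rep_eq tensor_power.rep_eq split: list.split)
  then show ?thesis by (simp add: cinner_one_particle)
qed

lemma cinner_one_particle_expvec: "cinner (one_particle f) (expvec g) = cinner f g"
  by (metis cinner_commute cinner_expvec_one_particle)

lemma norm_one_particle: "norm (one_particle f) = norm f"
  unfolding norm_eq_iff_cinner by (rule cinner_one_particle)

text \<open>With x = ||g||^2 the left side equals exp x - 1 - x. What matters is that the bound is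
  of second order in x; the factor exp x is crude but stays bounded on bounded sets.\<close>

lemma norm_expvec_remainder_le:
  "(norm (expvec g - expvec 0 - one_particle g))\<^sup>2 \<le> ((norm g)\<^sup>2)\<^sup>2 * exp ((norm g)\<^sup>2)"
proof -
  let ?v = "expvec g - expvec 0 - one_particle g" and ?x = "(norm g)\<^sup>2"
  have "cinner ?v ?v = exp (cinner g g) - 1 - cinner g g"
    by (simp add: cinner_diff_left cinner_diff_right cinner_expvec cinner_expvec_one_particle
        cinner_one_particle_expvec cinner_one_particle)
  then have "complex_of_real ((norm ?v)\<^sup>2) = complex_of_real (exp ?x - 1 - ?x)"
    by (simp only: cinner_self exp_of_real of_real_diff of_real_1)
  then have "(norm ?v)\<^sup>2 = exp ?x - 1 - ?x" by (simp only: of_real_eq_iff)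
  also have "\<dots> \<le> ?x\<^sup>2 * exp ?x"
  proof -
    have x: "0 \<le> ?x" by simp
    \<comment> \<open>From 1 - x \<le> exp(-x) follows exp x - 1 \<le> x exp x. Used twice, this
      gives exp x - 1 - x \<le> x (exp x - 1) \<le> x^2 exp x.\<close>
    have "(1 - ?x) * exp ?x \<le> exp (- ?x) * exp ?x"
      using exp_ge_add_one_self[of "- ?x"] by (intro mult_right_mono) auto
    also have "\<dots> = 1" by (simp add: exp_minus)
    finally have le: "exp ?x - 1 \<le> ?x * exp ?x" by (simp add: algebra_simps)
    have "?x * (exp ?x - 1) \<le> ?x * (?x * exp ?x)" using le x by (rule mult_left_mono)
    with le show ?thesis by (simp add: algebra_simps power2_eq_square)
  qed
  finally show ?thesis .
qed

text \<open>The derivative of \<open>expvec\<close> at 0 in direction h. It carries closed linear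
  conditions from exponential vectors over to one-particle vectors.\<close>

lemma tendsto_one_particle:
  "(\<lambda>n. of_nat (Suc n) *\<^sub>C (expvec (inverse (of_nat (Suc n)) *\<^sub>C h) - expvec 0)) \<longlonglongrightarrow> one_particle h"
proof -
  define u where "u n = (of_nat (Suc n) :: complex)" for n
  have u: "u n \<noteq> 0" "cmod (u n) = real (Suc n)" for n
    unfolding u_def norm_of_nat by (simp_all del: of_nat_Suc)
  \<comment> \<open>The remainder at h/(n + 1) is of order 1/(n + 1)^2, one order better than the
    factor n + 1 in front of it.\<close>
  have bound: "norm (u n *\<^sub>C (expvec (inverse (u n) *\<^sub>C h) - expvec 0) - one_particle h)
      \<le> inverse (real (Suc n)) * ((norm h)\<^sup>2 * sqrt (exp ((norm h)\<^sup>2)))" for n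
  proof -
    let ?g = "inverse (u n) *\<^sub>C h"
    have ng: "(norm ?g)\<^sup>2 = (inverse (real (Suc n)))\<^sup>2 * (norm h)\<^sup>2"
      using u by (simp add: norm_scaleC norm_inverse power_mult_distrib)
    have "one_particle h = u n *\<^sub>C one_particle ?g"
      using u by (simp add: one_particle_scaleC scaleC_scaleC)
    then have eq: "u n *\<^sub>C (expvec ?g - expvec 0) - one_particle h = u n *\<^sub>C (expvec ?g - expvec 0 - one_particle ?g)"
      by (simp only: complex_vector.scale_right_diff_distrib)
    have "norm (expvec ?g - expvec 0 - one_particle ?g) \<le> sqrt (((norm ?g)\<^sup>2)\<^sup>2 * exp ((norm ?g)\<^sup>2))"
      using norm_expvec_remainder_le[of ?g] by (rule real_le_rsqrt)
    also have "\<dots> = (norm ?g)\<^sup>2 * sqrt (exp ((norm ?g)\<^sup>2))"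
      by (simp only: real_sqrt_mult real_sqrt_abs abs_power2)
    also have "\<dots> \<le> (norm ?g)\<^sup>2 * sqrt (exp ((norm h)\<^sup>2))"
    proof -
      have "(inverse (real (Suc n)))\<^sup>2 \<le> 1" by (simp add: field_simps)
      then have "(norm ?g)\<^sup>2 \<le> (norm h)\<^sup>2" unfolding ng by (simp add: mult_left_le_one_le)
      then show ?thesis by (intro mult_left_mono) auto
    qed
    finally have le: "norm (expvec ?g - expvec 0 - one_particle ?g) \<le> (norm ?g)\<^sup>2 * sqrt (exp ((norm h)\<^sup>2))" .
    have "norm (u n *\<^sub>C (expvec ?g - expvec 0) - one_particle h)
        \<le> real (Suc n) * ((norm ?g)\<^sup>2 * sqrt (exp ((norm h)\<^sup>2)))"
      unfolding eq norm_scaleC[of "u n"] u(2) using le by (intro mult_left_mono) auto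
    also have "\<dots> = inverse (real (Suc n)) * ((norm h)\<^sup>2 * sqrt (exp ((norm h)\<^sup>2)))"
      unfolding ng by (simp add: power2_eq_square del: of_nat_Suc)
    finally show ?thesis .
  qed
  have lim: "(\<lambda>n. inverse (real (Suc n)) * ((norm h)\<^sup>2 * sqrt (exp ((norm h)\<^sup>2)))) \<longlonglongrightarrow> 0"
    by (intro tendsto_mult_left_zero LIMSEQ_inverse_real_of_nat)
  have "(\<lambda>n. u n *\<^sub>C (expvec (inverse (u n) *\<^sub>C h) - expvec 0) - one_particle h) \<longlonglongrightarrow> 0"
    by (rule Lim_null_comparison[OF always_eventually[OF allI, OF bound] lim])
  then show ?thesis unfolding u_def by (rule LIM_zero_cancel)
qed

section \<open>Tensor products of square-summable families and of closed spans\<close>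

lemma tensor_add_left: "(x + y) \<otimes>\<^sub>2 z = x \<otimes>\<^sub>2 z + y \<otimes>\<^sub>2 z"
  by (rule coord_eqI) (auto simp: tensor.rep_eq plus_ell2.rep_eq algebra_simps)

lemma tensor_add_right: "z \<otimes>\<^sub>2 (x + y) = z \<otimes>\<^sub>2 x + z \<otimes>\<^sub>2 y"
  by (rule coord_eqI) (auto simp: tensor.rep_eq plus_ell2.rep_eq algebra_simps)

lemma tensor_scaleC_left: "(a *\<^sub>C x) \<otimes>\<^sub>2 z = a *\<^sub>C (x \<otimes>\<^sub>2 z)"
  by (rule coord_eqI) (auto simp: tensor.rep_eq scaleC_ell2.rep_eq algebra_simps)

lemma tensor_scaleC_right: "z \<otimes>\<^sub>2 (a *\<^sub>C x) = a *\<^sub>C (z \<otimes>\<^sub>2 x)"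
  by (rule coord_eqI) (auto simp: tensor.rep_eq scaleC_ell2.rep_eq algebra_simps)

lemma cinner_tensor: "cinner (x \<otimes>\<^sub>2 y) (x' \<otimes>\<^sub>2 y') = cinner x x' * cinner y y'"
proof -
  have "(\<lambda>p. cnj (coord (x \<otimes>\<^sub>2 y) p) * coord (x' \<otimes>\<^sub>2 y') p) summable_on UNIV"
    using coord[of "x \<otimes>\<^sub>2 y"] coord[of "x' \<otimes>\<^sub>2 y'"] by (intro square_summable_cinner) auto
  then have summable: "(\<lambda>(i, j). (cnj (coord x i) * coord x' i) * (cnj (coord y j) * coord y' j)) summable_on UNIV \<times> UNIV"
    by (simp add: tensor.rep_eq case_prod_unfold ac_simps)
  have "cinner (x \<otimes>\<^sub>2 y) (x' \<otimes>\<^sub>2 y')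
      = (\<Sum>\<^sub>\<infinity>(i, j)\<in>UNIV \<times> UNIV. (cnj (coord x i) * coord x' i) * (cnj (coord y j) * coord y' j))"
    by (simp add: cinner_ell2.rep_eq tensor.rep_eq case_prod_unfold ac_simps)
  also have "\<dots> = (\<Sum>\<^sub>\<infinity>i. \<Sum>\<^sub>\<infinity>j. (cnj (coord x i) * coord x' i) * (cnj (coord y j) * coord y' j))"
    by (rule infsum_Sigma'_banach[symmetric]) (use summable in simp)
  also have "\<dots> = cinner x x' * cinner y y'"
    by (simp only: infsum_cmult_right' infsum_cmult_left' cinner_ell2.rep_eq)
  finally show ?thesis .
qed

lemma norm_tensor: "norm (x \<otimes>\<^sub>2 y) = norm x * norm y"
proof -
  have "complex_of_real ((norm (x \<otimes>\<^sub>2 y))\<^sup>2) = complex_of_real ((norm x * norm y)\<^sup>2)"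
    by (simp only: cinner_self[symmetric] cinner_tensor power_mult_distrib of_real_mult)
  then show ?thesis by (simp only: of_real_eq_iff) (simp add: power2_eq_iff_nonneg)
qed

lemma tensor_zero [simp]: "0 \<otimes>\<^sub>2 y = 0" "x \<otimes>\<^sub>2 0 = 0"
  using norm_tensor[of 0 y] norm_tensor[of x 0] by simp_all

lemma bounded_linear_tensor_left: "bounded_linear (\<lambda>x. x \<otimes>\<^sub>2 z)"
  by (rule bounded_linear_intro[of _ "norm z"])
    (simp_all add: tensor_add_left scaleR_scaleC tensor_scaleC_left norm_tensor)

lemma bounded_linear_tensor_right: "bounded_linear (\<lambda>x. z \<otimes>\<^sub>2 x)"
  by (rule bounded_linear_intro[of _ "norm z"])
    (simp_all add: tensor_add_right scaleR_scaleC tensor_scaleC_right norm_tensor mult.commute)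

lemma closed_vimage_bounded_linear:
  assumes "bounded_linear f" "closed W"
  shows "closed {x. f x \<in> W}"
  using continuous_closed_vimage[OF assms(2), of f] linear_continuous_at[OF assms(1)] by (simp add: vimage_def)

text \<open>The inclusion from left to right is reached one factor at a time: for fixed y in Y the
  admissible x form a closed subspace, and then for fixed x the admissible y do.\<close>

lemma tensor_space_closure_cspan:
  "tensor_space (closure (cspan X)) (closure (cspan Y)) = closure (cspan {x \<otimes>\<^sub>2 y | x y. x \<in> X \<and> y \<in> Y})"
proof
  let ?W = "closure (cspan {x \<otimes>\<^sub>2 y | x y. x \<in> X \<and> y \<in> Y})"
  have "csubspace ?W" by (rule csubspace_closure_cspan)
  note sub = complex_vector.subspace_0[OF this] complex_vector.subspace_add[OF this]
    complex_vector.subspace_scale[OF this]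
  have left: "x \<otimes>\<^sub>2 y \<in> ?W" if x: "x \<in> closure (cspan X)" and y: "y \<in> Y" for x y
  proof -
    have "closure (cspan X) \<subseteq> {x. x \<otimes>\<^sub>2 y \<in> ?W}"
    proof (rule closure_cspan_minimal)
      show "X \<subseteq> {x. x \<otimes>\<^sub>2 y \<in> ?W}" using y closure_cspan_superset[of "{x \<otimes>\<^sub>2 y | x y. x \<in> X \<and> y \<in> Y}"] by blast
      show "csubspace {x. x \<otimes>\<^sub>2 y \<in> ?W}"
        using sub
        by (intro complex_vector.subspaceI)
          (auto simp: tensor_add_left tensor_scaleC_left)
      show "closed {x. x \<otimes>\<^sub>2 y \<in> ?W}"
        by (rule closed_vimage_bounded_linear[OF bounded_linear_tensor_left closed_closure])
    qed
    then show ?thesis using x by blast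
  qed
  have both: "x \<otimes>\<^sub>2 y \<in> ?W" if x: "x \<in> closure (cspan X)" and y: "y \<in> closure (cspan Y)" for x y
  proof -
    have "closure (cspan Y) \<subseteq> {y. x \<otimes>\<^sub>2 y \<in> ?W}"
    proof (rule closure_cspan_minimal)
      show "Y \<subseteq> {y. x \<otimes>\<^sub>2 y \<in> ?W}" using left x by blast
      show "csubspace {y. x \<otimes>\<^sub>2 y \<in> ?W}"
        using sub
        by (intro complex_vector.subspaceI)
          (auto simp: tensor_add_right tensor_scaleC_right)
      show "closed {y. x \<otimes>\<^sub>2 y \<in> ?W}"
        by (rule closed_vimage_bounded_linear[OF bounded_linear_tensor_right closed_closure])
    qed
    then show ?thesis using y by blast
  qed
  show "tensor_space (closure (cspan X)) (closure (cspan Y)) \<subseteq> ?W"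
    unfolding tensor_space_def
  proof (rule closure_cspan_minimal)
    show "{x \<otimes>\<^sub>2 y |x y. x \<in> closure (cspan X) \<and> y \<in> closure (cspan Y)} \<subseteq> ?W"
      by (clarify, rule both)
  qed (rule csubspace_closure_cspan closed_closure)+
  have "{x \<otimes>\<^sub>2 y | x y. x \<in> X \<and> y \<in> Y}
      \<subseteq> {x \<otimes>\<^sub>2 y |x y. x \<in> closure (cspan X) \<and> y \<in> closure (cspan Y)}"
    by (clarify, intro exI conjI, rule refl) (auto intro: subsetD[OF closure_cspan_superset])
  then show "?W \<subseteq> tensor_space (closure (cspan X)) (closure (cspan Y))"
    unfolding tensor_space_def by (rule closure_mono[OF complex_vector.span_mono])
qed

subsection \<open>The product of the Fock Arveson system\<close>

lemma csubspace_fibre: "csubspace (fibre t)"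
  unfolding fibre_def by (rule csubspace_closure_cspan)

lemma expvec_in_fibre: "f \<in> K_upto t \<Longrightarrow> expvec f \<in> fibre t"
  unfolding fibre_def using closure_cspan_superset[of "expvec ` K_upto t"] by blast

lemma vacuum_in_fibre: "expvec 0 \<in> fibre t"
  by (intro expvec_in_fibre zero_in_K_upto)

lemma fibre_mono: "s \<le> t \<Longrightarrow> fibre s \<subseteq> fibre t"
  unfolding fibre_def by (intro closure_mono complex_vector.span_mono image_mono K_upto_mono)

lemma fibre_eqI:
  assumes "x \<in> fibre t" "y \<in> fibre t" "\<And>h. h \<in> K_upto t \<Longrightarrow> cinner (expvec h) x = cinner (expvec h) y"
  shows "x = y"
  using assms unfolding fibre_def by (intro total_eqI[of "expvec ` K_upto t"]) auto

lemma one_particle_in_fibre: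
  assumes "g \<in> K_upto t"
  shows "one_particle g \<in> fibre t"
proof (rule closed_sequentially)
  show "closed (fibre t)" by (simp add: fibre_def)
  show "of_nat (Suc n) *\<^sub>C (expvec (inverse (of_nat (Suc n)) *\<^sub>C g) - expvec 0) \<in> fibre t" for n
    using csubspace_fibre[of t] assms
    by (intro complex_vector.subspace_scale csubspace_diff expvec_in_fibre vacuum_in_fibre scaleC_in_K_upto)
qed (rule tendsto_one_particle)

text \<open>Vectors of \<open>fibre s\<close> see h only before time s. Exponential vectors suffice
  for the proof, both sides being linear and continuous in x.\<close>

lemma cinner_expvec_truncate:
  fixes h :: "'k::{complex_hilbert_space, second_countable_topology} L2"
  assumes "x \<in> fibre s"
  shows "cinner (expvec h) x = cinner (expvec (L2_truncate s h)) x"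
proof -
  have "fibre s \<subseteq> {x. cinner (expvec h) x = cinner (expvec (L2_truncate s h)) x}"
    unfolding fibre_def
  proof (rule closure_cspan_minimal)
    show "expvec ` K_upto s \<subseteq> {x. cinner (expvec h) x = cinner (expvec (L2_truncate s h)) x}"
    proof clarify
      fix f :: "'k L2" assume "f \<in> K_upto s"
      then have "cinner h f = cinner (L2_truncate s h) f"
        using cinner_L2_truncate_right[of h s f] by (simp add: K_upto_iff)
      then show "cinner (expvec h) (expvec f) = cinner (expvec (L2_truncate s h)) (expvec f)"
        by (simp add: cinner_expvec)
    qed
    show "csubspace {x. cinner (expvec h) x = cinner (expvec (L2_truncate s h)) x}"
      by (rule complex_vector.subspaceI) (auto simp: cinner_add_right cinner_scaleC_right)
    show "closed {x. cinner (expvec h) x = cinner (expvec (L2_truncate s h)) x}"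
      by (intro closed_Collect_eq_sequential tendsto_cinner tendsto_const)
  qed
  then show ?thesis using assms by blast
qed

text \<open>Differentiates an identity between exponential vectors at $0$.\<close>

lemma cinner_one_particle_eqI:
  assumes "\<And>z. cinner (expvec (z *\<^sub>C h)) x = cinner (expvec (z *\<^sub>C f)) y + cinner (expvec (z *\<^sub>C g)) w"
  shows "cinner (one_particle h) x = cinner (one_particle f) y + cinner (one_particle g) w"
proof -
  let ?d = "\<lambda>n h. of_nat (Suc n) *\<^sub>C (expvec (inverse (of_nat (Suc n)) *\<^sub>C h) - expvec 0)"
  have lim: "(\<lambda>n. cinner (?d n h) x) \<longlonglongrightarrow> cinner (one_particle h) x" for h x
    by (intro tendsto_cinner tendsto_one_particle tendsto_const)
  have "cinner (?d n h) x = cinner (?d n f) y + cinner (?d n g) w" for n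
    using assms[of "inverse (of_nat (Suc n))"] assms[of 0]
    by (simp add: cinner_scaleC_left cinner_diff_left algebra_simps del: of_nat_Suc)
  then have "(\<lambda>n. cinner (?d n h) x) \<longlonglongrightarrow> cinner (one_particle f) y + cinner (one_particle g) w"
    using tendsto_add[OF lim lim] by simp
  then show ?thesis using LIMSEQ_unique[OF lim] by blast
qed

lemma cinner_one_particle_truncate:
  assumes "x \<in> fibre s"
  shows "cinner (one_particle h) x = cinner (one_particle (L2_truncate s h)) x"
proof -
  have "cinner (expvec (z *\<^sub>C h)) x = cinner (expvec (z *\<^sub>C L2_truncate s h)) x" for z
    using cinner_expvec_truncate[OF assms, of "z *\<^sub>C h"] by (simp add: L2_truncate_scaleC)
  then show ?thesis using cinner_one_particle_eqI[of h x "L2_truncate s h" x 0 0] by simp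
qed

text \<open>The property under \<open>SOME\<close> is satisfiable: the prescribed images of
  exponential vectors have the right Gram matrix by \<open>exp_add\<close>, and they are total in
  the tensor space.\<close>

lemma structure_map_unitary:
  fixes s t :: real
  assumes "0 \<le> s" "0 \<le> t"
  defines "U \<equiv> structure_map s t :: 'k::{complex_hilbert_space, second_countable_topology} fock \<Rightarrow> _"
  shows "unitary_between (fibre (s + t)) (tensor_space (fibre s) (fibre t)) U"
    and "\<And>h. h \<in> K_upto (s + t) \<Longrightarrow> U (expvec h) = expvec (L2_truncate s h) \<otimes>\<^sub>2 expvec (L2_unshift s h)"
proof -
  let ?f = "\<lambda>h :: 'k L2. expvec (L2_truncate s h) \<otimes>\<^sub>2 expvec (L2_unshift s h)"
  have gram: "cinner (?f h) (?f h') = cinner (expvec h) (expvec h')" for h h'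
    by (simp add: cinner_tensor cinner_expvec cinner_L2_split[OF assms(1), of h h'] exp_add)
  have "?f ` K_upto (s + t) = {x \<otimes>\<^sub>2 y | x y. x \<in> expvec ` K_upto s \<and> y \<in> expvec ` K_upto t}"
  proof (intro equalityI subsetI)
    fix z assume "z \<in> ?f ` K_upto (s + t)"
    then show "z \<in> {x \<otimes>\<^sub>2 y | x y. x \<in> expvec ` K_upto s \<and> y \<in> expvec ` K_upto t}"
      using L2_truncate_in_K_upto L2_unshift_in_K_upto[OF assms(1)] by blast
  next
    fix z :: "('k L2 list \<times> 'k L2 list) ell2"
    assume "z \<in> {x \<otimes>\<^sub>2 y | x y. x \<in> expvec ` K_upto s \<and> y \<in> expvec ` K_upto t}"
    then obtain f g :: "'k L2" where z: "z = expvec f \<otimes>\<^sub>2 expvec g" "f \<in> K_upto s" "g \<in> K_upto t" by blast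
    then obtain h where "h \<in> K_upto (s + t)" "L2_truncate s h = f" "L2_unshift s h = g"
      using L2_truncate_unshift_surj[OF assms(1,2)] by metis
    then show "z \<in> ?f ` K_upto (s + t)" using z(1) by auto
  qed
  then have space: "tensor_space (fibre s) (fibre t) = closure (cspan (?f ` K_upto (s + t)))"
    unfolding fibre_def by (simp add: tensor_space_closure_cspan)
  have "\<exists>U. unitary_between (fibre (s + t)) (tensor_space (fibre s) (fibre t)) U \<and>
      (\<forall>h\<in>K_upto (s + t). U (expvec h) = ?f h)"
    unfolding space unfolding fibre_def by (rule unitary_between_extension) (rule gram)
  from someI_ex[OF this]
  show "unitary_between (fibre (s + t)) (tensor_space (fibre s) (fibre t)) U"
    and "\<And>h. h \<in> K_upto (s + t) \<Longrightarrow> U (expvec h) = ?f h"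
    unfolding U_def structure_map_def adjoint_on_L2_shift[OF assms(1)] by auto
qed

text \<open>The adjoint of a unitary is its inverse, so the product is the preimage p of the
  elementary tensor. The uniqueness demanded by \<open>THE\<close> holds because exponential vectors
  separate the points of the fibre.\<close>

lemma
  assumes st: "0 \<le> s" "0 \<le> t" and x: "x \<in> fibre s" and y: "y \<in> fibre t"
  shows fock_mult_in_fibre: "fock_mult s t x y \<in> fibre (s + t)"
    and structure_map_fock_mult: "structure_map s t (fock_mult s t x y) = x \<otimes>\<^sub>2 y"
proof -
  note U = structure_map_unitary(1)[OF st, unfolded unitary_between_def]
  have "x \<otimes>\<^sub>2 y \<in> tensor_space (fibre s) (fibre t)"
    unfolding tensor_space_def using x y
    by (intro subsetD[OF closure_cspan_superset]) blast
  then obtain p where p: "p \<in> fibre (s + t)" "structure_map s t p = x \<otimes>\<^sub>2 y"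
    using U by (metis imageE)
  have "fock_mult s t x y = p"
    unfolding fock_mult_def adjoint_on_def
  proof (rule the_equality)
    show "p \<in> fibre (s + t) \<and> (\<forall>v\<in>fibre (s + t). cinner v p = cinner (structure_map s t v) (x \<otimes>\<^sub>2 y))"
      using U p by metis
  next
    fix q assume q: "q \<in> fibre (s + t) \<and> (\<forall>v\<in>fibre (s + t). cinner v q = cinner (structure_map s t v) (x \<otimes>\<^sub>2 y))"
    show "q = p"
    proof (rule fibre_eqI)
      fix h :: "'a L2" assume "h \<in> K_upto (s + t)"
      then have "expvec h \<in> fibre (s + t)" by (rule expvec_in_fibre)
      then show "cinner (expvec h) q = cinner (expvec h) p" using q U p by metis
    qed (use q p in auto)
  qed
  with p show "fock_mult s t x y \<in> fibre (s + t)" "structure_map s t (fock_mult s t x y) = x \<otimes>\<^sub>2 y"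
    by simp_all
qed

lemma cinner_fock_mult:
  assumes "0 \<le> s" "0 \<le> t" "x \<in> fibre s" "y \<in> fibre t" "x' \<in> fibre s" "y' \<in> fibre t"
  shows "cinner (fock_mult s t x y) (fock_mult s t x' y') = cinner x x' * cinner y y'"
  using structure_map_unitary(1)[OF assms(1,2)] fock_mult_in_fibre[OF assms(1,2)] assms
  unfolding unitary_between_def by (metis cinner_tensor structure_map_fock_mult)

lemma cinner_expvec_fock_mult:
  assumes "0 \<le> s" "0 \<le> t" "x \<in> fibre s" "y \<in> fibre t" "h \<in> K_upto (s + t)"
  shows "cinner (expvec h) (fock_mult s t x y) =
    cinner (expvec (L2_truncate s h)) x * cinner (expvec (L2_unshift s h)) y"
  using structure_map_unitary[OF assms(1,2)] fock_mult_in_fibre[OF assms(1-4)] expvec_in_fibre[OF assms(5)] assms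
  unfolding unitary_between_def by (metis cinner_tensor structure_map_fock_mult)

text \<open>Right multiplication by the vacuum is the inclusion of nested fibres, because its factor
  \<open>cinner (expvec (L2_unshift s h)) (expvec 0)\<close> is exp 0 = 1.\<close>

lemma fock_mult_vacuum_right:
  assumes "0 \<le> s" "0 \<le> t" "x \<in> fibre s"
  shows "fock_mult s t x (expvec 0) = x"
proof (rule fibre_eqI)
  show "x \<in> fibre (s + t)" using assms fibre_mono[of s "s + t"] by auto
  show "cinner (expvec h) (fock_mult s t x (expvec 0)) = cinner (expvec h) x" if "h \<in> K_upto (s + t)" for h
    using that assms cinner_expvec_truncate[OF assms(3), of h]
    by (simp add: cinner_expvec_fock_mult vacuum_in_fibre cinner_expvec)
qed (intro fock_mult_in_fibre assms vacuum_in_fibre)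

text \<open>Left multiplication by the vacuum is translation by s: the adjoint relation moves the
  backward shift of h to a forward shift of g.\<close>

lemma fock_mult_vacuum_one_particle:
  assumes "0 \<le> s" "0 \<le> t" "g \<in> K_upto t"
  shows "fock_mult s t (expvec 0) (one_particle g) = one_particle (L2_shift s g)"
proof (rule fibre_eqI)
  show "cinner (expvec h) (fock_mult s t (expvec 0) (one_particle g)) = cinner (expvec h) (one_particle (L2_shift s g))"
    if "h \<in> K_upto (s + t)" for h
  proof -
    have "cinner h (L2_shift s g) = cinner (L2_unshift s h) g"
      by (metis assms(1) cinner_L2_shift_left cinner_commute)
    then show ?thesis
      using that assms
      by (simp add: cinner_expvec_fock_mult vacuum_in_fibre one_particle_in_fibre cinner_expvec cinner_expvec_one_particle)
  qed
qed (auto intro!: fock_mult_in_fibre one_particle_in_fibre vacuum_in_fibre shift_in_K_upto assms)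

subsection \<open>Determination of the roots\<close>

text \<open>
  The root equation tested against exponential vectors. In this form it is visibly stable under differences,
  which measurability into a possibly non-separable space is not.
\<close>

definition additive_section :: "(real \<Rightarrow> 'k::{complex_hilbert_space, second_countable_topology} fock) \<Rightarrow> bool" where
  "additive_section a \<longleftrightarrow> (\<forall>t>0. a t \<in> fibre t \<and> cinner (expvec 0) (a t) = 0) \<and>
     (\<forall>s>0. \<forall>t>0. \<forall>h\<in>K_upto (s + t).
        cinner (expvec h) (a (s + t)) = cinner (expvec (L2_truncate s h)) (a s) + cinner (expvec (L2_unshift s h)) (a t))"

text \<open>Both sides of the root equation lie in \<open>fibre (s + t)\<close>, where exponential
  vectors separate points; each vacuum factor contributes exp 0 = 1.\<close>

lemma additive_section_iff:
  "additive_section a \<longleftrightarrow> (\<forall>t>0. a t \<in> fibre t \<and> cinner (expvec 0) (a t) = 0) \<and>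
     (\<forall>s>0. \<forall>t>0. a (s + t) = fock_mult s t (a s) (expvec 0) + fock_mult s t (expvec 0) (a t))"
proof -
  have "(\<forall>h\<in>K_upto (s + t). cinner (expvec h) (a (s + t)) =
        cinner (expvec (L2_truncate s h)) (a s) + cinner (expvec (L2_unshift s h)) (a t)) \<longleftrightarrow>
      a (s + t) = fock_mult s t (a s) (expvec 0) + fock_mult s t (expvec 0) (a t)" (is "?L = ?R")
    if fib: "\<forall>t>0. a t \<in> fibre t" and st: "0 < s" "0 < t" for s t
  proof -
    have mem: "a s \<in> fibre s" "a t \<in> fibre t" "a (s + t) \<in> fibre (s + t)" using fib st by auto
    let ?p = "fock_mult s t (a s) (expvec 0) + fock_mult s t (expvec 0) (a t)"
    have p: "?p \<in> fibre (s + t)"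
      using st mem by (intro complex_vector.subspace_add[OF csubspace_fibre] fock_mult_in_fibre vacuum_in_fibre) auto
    have val: "cinner (expvec h) ?p = cinner (expvec (L2_truncate s h)) (a s) + cinner (expvec (L2_unshift s h)) (a t)"
      if "h \<in> K_upto (s + t)" for h
      using that st mem by (simp add: cinner_add_right cinner_expvec_fock_mult vacuum_in_fibre cinner_expvec)
    show ?thesis
    proof
      assume ?L
      then show ?R by (intro fibre_eqI[OF mem(3) p]) (simp add: val)
    next
      assume ?R
      then show ?L using val by simp
    qed
  qed
  note split_iff = this
  show ?thesis
  proof
    assume a: "additive_section a"
    then have "\<forall>t>0. a t \<in> fibre t" by (simp add: additive_section_def)
    from split_iff[OF this] a
    show "(\<forall>t>0. a t \<in> fibre t \<and> cinner (expvec 0) (a t) = 0) \<and>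
     (\<forall>s>0. \<forall>t>0. a (s + t) = fock_mult s t (a s) (expvec 0) + fock_mult s t (expvec 0) (a t))"
      unfolding additive_section_def by metis
  next
    assume a: "(\<forall>t>0. a t \<in> fibre t \<and> cinner (expvec 0) (a t) = 0) \<and>
     (\<forall>s>0. \<forall>t>0. a (s + t) = fock_mult s t (a s) (expvec 0) + fock_mult s t (expvec 0) (a t))"
    then have "\<forall>t>0. a t \<in> fibre t" by simp
    from split_iff[OF this] a show "additive_section a"
      unfolding additive_section_def by metis
  qed
qed

lemma roots_vacuum_iff: "a \<in> roots vacuum \<longleftrightarrow> measurable_section a \<and> additive_section a"
proof -
  have vac: "vacuum t = expvec 0" if "0 < t" for t :: real
    using that by (simp add: vacuum_def)
  show ?thesis
  proof
    assume a: "a \<in> roots vacuum"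
    then have "a t \<in> fibre t" "cinner (vacuum t) (a t) = 0" if "0 < t" for t
      using that by (simp_all add: roots_def measurable_section_def)
    then have "a t \<in> fibre t" "cinner (expvec 0) (a t) = 0" if "0 < t" for t
      using that by (simp_all flip: vac)
    moreover have "a (s + t) = fock_mult s t (a s) (expvec 0) + fock_mult s t (expvec 0) (a t)"
      if st: "0 < s" "0 < t" for s t
    proof -
      have "a (s + t) = fock_mult s t (a s) (vacuum t) + fock_mult s t (vacuum s) (a t)"
        using a st unfolding roots_def by simp
      then show ?thesis by (simp only: vac[OF st(1)] vac[OF st(2)])
    qed
    ultimately show "measurable_section a \<and> additive_section a"
      using a by (simp add: additive_section_iff roots_def)
  next
    assume a: "measurable_section a \<and> additive_section a"
    then have "cinner (vacuum t) (a t) = 0" if "0 < t" for t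
      using that by (simp add: additive_section_def vac)
    moreover have "a (s + t) = fock_mult s t (a s) (vacuum t) + fock_mult s t (vacuum s) (a t)"
      if st: "0 < s" "0 < t" for s t
    proof -
      have "a (s + t) = fock_mult s t (a s) (expvec 0) + fock_mult s t (expvec 0) (a t)"
        using a st unfolding additive_section_iff by simp
      then show ?thesis by (simp only: vac[OF st(1)] vac[OF st(2)])
    qed
    ultimately show "a \<in> roots vacuum"
      using a unfolding roots_def by simp
  qed
qed

section \<open>Sections satisfying the root equation are one-particle\<close>

lemma additive_section_diff:
  assumes "additive_section a" "additive_section b"
  shows "additive_section (\<lambda>t. a t - b t)"
  using assms unfolding additive_section_def
  by (simp add: csubspace_diff[OF csubspace_fibre] cinner_diff_right)

text \<open>The equation holds for all multiples of h, so it may be differentiated at the multiple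
  0.\<close>

lemma additive_section_one_particle:
  assumes a: "additive_section a" and st: "0 < s" "0 < t" and h: "h \<in> K_upto (s + t)"
  shows "cinner (one_particle h) (a (s + t)) =
    cinner (one_particle (L2_truncate s h)) (a s) + cinner (one_particle (L2_unshift s h)) (a t)"
proof (rule cinner_one_particle_eqI)
  fix z
  have "z *\<^sub>C h \<in> K_upto (s + t)" using h by (rule scaleC_in_K_upto)
  then show "cinner (expvec (z *\<^sub>C h)) (a (s + t)) =
      cinner (expvec (z *\<^sub>C L2_truncate s h)) (a s) + cinner (expvec (z *\<^sub>C L2_unshift s h)) (a t)"
    using a st by (simp add: additive_section_def flip: L2_truncate_scaleC L2_unshift_scaleC)
qed

text \<open>The cross terms are products of pairings of \<open>a s\<close> and \<open>a t\<close>
  with the vacuum, which vanish.\<close>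

lemma additive_section_norm_add:
  assumes a: "additive_section a" and st: "0 < s" "0 < t"
  shows "(norm (a (s + t)))\<^sup>2 = (norm (a s))\<^sup>2 + (norm (a t))\<^sup>2"
proof -
  have mem: "a s \<in> fibre s" "a t \<in> fibre t" and orth: "cinner (expvec 0) (a s) = 0" "cinner (expvec 0) (a t) = 0"
    and eq: "a (s + t) = fock_mult s t (a s) (expvec 0) + fock_mult s t (expvec 0) (a t)"
    using a st unfolding additive_section_iff by auto
  have "cinner (a s) (expvec 0) = 0" using orth(1) by (metis cinner_commute complex_cnj_zero)
  then have "cinner (a (s + t)) (a (s + t)) = cinner (a s) (a s) + cinner (a t) (a t)"
    unfolding eq using st mem orth
    by (simp add: cinner_add_left cinner_add_right cinner_fock_mult vacuum_in_fibre cinner_expvec)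
  then show ?thesis unfolding cinner_self of_real_add[symmetric] of_real_eq_iff .
qed

text \<open>The multiple \<open>Suc n\<close> keeps all times positive, as additivity
  requires.\<close>

lemma additive_section_norm_mult:
  assumes a: "additive_section a" and t: "0 < t"
  shows "(norm (a (real (Suc n) * t)))\<^sup>2 = real (Suc n) * (norm (a t))\<^sup>2"
proof (induction n)
  case (Suc n)
  have "real (Suc (Suc n)) * t = t + real (Suc n) * t" by (simp add: algebra_simps)
  moreover have "0 < real (Suc n) * t" using t by simp
  ultimately have "(norm (a (real (Suc (Suc n)) * t)))\<^sup>2 = (norm (a t))\<^sup>2 + (norm (a (real (Suc n) * t)))\<^sup>2"
    using additive_section_norm_add[OF a t] by metis
  then show ?case unfolding Suc.IH by (simp add: algebra_simps)
qed simp

text \<open>Subtracting \<open>expvec 0\<close> costs nothing, since \<open>a d\<close> is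
  orthogonal to it. The separate bound M gives all pieces of a function the same exponential
  factor.\<close>

lemma additive_section_remainder_le_step:
  assumes a: "additive_section a" and d: "0 < d" and M: "(norm h)\<^sup>2 \<le> M"
  shows "cmod (cinner (expvec h - one_particle h) (a d)) \<le> (norm h)\<^sup>2 * (sqrt (exp M) * norm (a d))"
proof -
  let ?v = "expvec h - expvec 0 - one_particle h"
  have "cinner (expvec h - one_particle h) (a d) = cinner ?v (a d)"
    using a d by (simp add: additive_section_def cinner_diff_left)
  moreover have "cmod (cinner ?v (a d)) \<le> norm ?v * norm (a d)" by (rule cmod_cinner_le)
  moreover have "norm ?v \<le> (norm h)\<^sup>2 * sqrt (exp M)"
  proof -
    have "norm ?v \<le> sqrt (((norm h)\<^sup>2)\<^sup>2 * exp ((norm h)\<^sup>2))"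
      using norm_expvec_remainder_le[of h] by (rule real_le_rsqrt)
    also have "\<dots> \<le> sqrt (((norm h)\<^sup>2)\<^sup>2 * exp M)"
      using M by (intro real_sqrt_le_mono mult_left_mono) auto
    also have "\<dots> = (norm h)\<^sup>2 * sqrt (exp M)" by (simp only: real_sqrt_mult real_sqrt_abs abs_power2)
    finally show ?thesis .
  qed
  then have "norm ?v * norm (a d) \<le> (norm h)\<^sup>2 * sqrt (exp M) * norm (a d)"
    by (rule mult_right_mono) simp
  ultimately show ?thesis by (simp add: mult.assoc)
qed

text \<open>Each induction step cuts off a first piece of length d. Squared norms of the pieces add
  up, so the constant does not grow with n.\<close>

lemma additive_section_remainder_le:
  assumes a: "additive_section a" and d: "0 < d"
  shows "h \<in> K_upto (real (Suc n) * d) \<Longrightarrow> (norm h)\<^sup>2 \<le> M \<Longrightarrow>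
    cmod (cinner (expvec h - one_particle h) (a (real (Suc n) * d))) \<le> (norm h)\<^sup>2 * (sqrt (exp M) * norm (a d))"
proof (induction n arbitrary: h)
  case (0 h)
  then show ?case using additive_section_remainder_le_step[OF a d] by simp
next
  case (Suc n h)
  let ?t = "real (Suc n) * d"
  let ?R = "\<lambda>h t. cinner (expvec h - one_particle h) (a t)"
  let ?C = "sqrt (exp M) * norm (a d)"
  have t: "0 < ?t" using d by simp
  have sum: "real (Suc (Suc n)) * d = d + ?t" by (simp add: algebra_simps)
  have h: "h \<in> K_upto (d + ?t)" using Suc.prems(1) unfolding sum .
  have split: "(norm h)\<^sup>2 = (norm (L2_truncate d h))\<^sup>2 + (norm (L2_unshift d h))\<^sup>2"
    using d by (intro norm_L2_split) simp
  have "?R h (d + ?t) = ?R (L2_truncate d h) d + ?R (L2_unshift d h) ?t"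
    using a d t h additive_section_one_particle[OF a d t h]
    by (simp add: additive_section_def cinner_diff_left del: of_nat_Suc)
  then have "cmod (?R h (d + ?t)) \<le> cmod (?R (L2_truncate d h) d) + cmod (?R (L2_unshift d h) ?t)"
    using norm_triangle_ineq by metis
  also have "\<dots> \<le> (norm (L2_truncate d h))\<^sup>2 * ?C + (norm (L2_unshift d h))\<^sup>2 * ?C"
  proof (rule add_mono)
    show "cmod (?R (L2_unshift d h) ?t) \<le> (norm (L2_unshift d h))\<^sup>2 * ?C"
    proof (rule Suc.IH)
      show "L2_unshift d h \<in> K_upto ?t" using d h by (intro L2_unshift_in_K_upto) auto
      show "(norm (L2_unshift d h))\<^sup>2 \<le> M"
        using split Suc.prems(2) zero_le_power2[of "norm (L2_truncate d h)"] by linarith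
    qed
    have "(norm (L2_truncate d h))\<^sup>2 \<le> M"
      using split Suc.prems(2) zero_le_power2[of "norm (L2_unshift d h)"] by linarith
    then show "cmod (?R (L2_truncate d h) d) \<le> (norm (L2_truncate d h))\<^sup>2 * ?C"
      by (rule additive_section_remainder_le_step[OF a d])
  qed
  also have "\<dots> = (norm h)\<^sup>2 * ?C" unfolding split by (simp add: algebra_simps)
  finally have "cmod (?R h (d + ?t)) \<le> (norm h)\<^sup>2 * ?C" .
  then show ?case by (simp only: sum)
qed

lemma cinner_expvec_additive_section:
  assumes a: "additive_section a" and t: "0 < t" and h: "h \<in> K_upto t"
  shows "cinner (expvec h) (a t) = cinner (one_particle h) (a t)"
proof -
  let ?R = "cmod (cinner (expvec h - one_particle h) (a t))"
  let ?C = "(norm h)\<^sup>2 * (sqrt (exp ((norm h)\<^sup>2)) * norm (a t))"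
  have "?R \<le> ?C * inverse (sqrt (real (Suc n)))" for n
  proof -
    \<comment> \<open>n + 1 equal pieces fill the interval exactly, and the norm at time
      \<open>?d\<close> is the norm at t divided by sqrt(n + 1).\<close>
    let ?d = "t / real (Suc n)"
    have d: "0 < ?d" using t by simp
    have nd: "real (Suc n) * ?d = t" by (simp del: of_nat_Suc)
    have "(norm (a ?d))\<^sup>2 = (norm (a t) * inverse (sqrt (real (Suc n))))\<^sup>2"
      using additive_section_norm_mult[OF a d, of n, unfolded nd]
      by (simp add: power_mult_distrib field_simps del: of_nat_Suc)
    then have norm_d: "norm (a ?d) = norm (a t) * inverse (sqrt (real (Suc n)))"
      by (simp add: power2_eq_iff_nonneg del: of_nat_Suc)
    show ?thesis
      using additive_section_remainder_le[OF a d, of h n "(norm h)\<^sup>2", unfolded nd] h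
      unfolding norm_d by (simp add: mult.assoc del: of_nat_Suc)
  qed
  moreover have "(\<lambda>n. ?C * inverse (sqrt (real (Suc n)))) \<longlonglongrightarrow> ?C * 0"
    by (intro tendsto_mult_left tendsto_inverse_0_at_top filterlim_compose[OF sqrt_at_top]
        filterlim_compose[OF filterlim_real_sequentially filterlim_Suc])
  ultimately have "?R \<le> ?C * 0" by (intro LIMSEQ_le_const) auto
  then show ?thesis by (simp add: cinner_diff_left)
qed

text \<open>Cauchy's functional equation: f 1 = 0 makes f periodic, so the bound on the unit
  interval holds everywhere, and f t = f (n t) / n tends to 0.\<close>

lemma additive_bounded_zero:
  fixes f :: "real \<Rightarrow> 'a::real_normed_vector"
  assumes add: "\<And>s t. 0 < s \<Longrightarrow> 0 < t \<Longrightarrow> f (s + t) = f s + f t"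
    and bound: "\<And>t. 0 < t \<Longrightarrow> t \<le> 1 \<Longrightarrow> norm (f t) \<le> C"
    and one: "f 1 = 0" and t: "0 < t"
  shows "f t = 0"
proof -
  have mult: "f (real (Suc n) * u) = real (Suc n) *\<^sub>R f u" if "0 < u" for n u
  proof (induction n)
    case (Suc n)
    have "real (Suc (Suc n)) * u = u + real (Suc n) * u" by (simp add: algebra_simps)
    then have "f (real (Suc (Suc n)) * u) = f u + f (real (Suc n) * u)"
      using add[OF that, of "real (Suc n) * u"] that by (simp del: of_nat_Suc)
    then show ?case unfolding Suc.IH by (simp add: algebra_simps scaleR_2)
  qed simp
  have bound': "norm (f u) \<le> C" if "0 < u" for u
  proof -
    \<comment> \<open>The largest integer strictly below u: the rest u - n lies in ]0, 1] and is
      positive, as additivity requires.\<close>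
    define n where "n = nat (\<lceil>u\<rceil> - 1)"
    have n: "real n < u" "u \<le> real n + 1"
      using that unfolding n_def by linarith+
    show ?thesis
    proof (cases n)
      case 0
      then show ?thesis using that n by (intro bound) auto
    next
      case (Suc m)
      have "f u = f ((u - real n) + real (Suc m) * 1)" using Suc by simp
      also have "\<dots> = f (u - real n) + f (real (Suc m) * 1)"
        by (rule add) (use n in auto)
      also have "\<dots> = f (u - real n)" using mult[of 1 m] one by simp
      finally show ?thesis using bound[of "u - real n"] n by simp
    qed
  qed
  have "norm (f t) \<le> C * inverse (real (Suc n))" for n
    using bound'[of "real (Suc n) * t"] t mult[OF t, of n] by (simp add: field_simps del: of_nat_Suc)
  moreover have "(\<lambda>n. C * inverse (real (Suc n))) \<longlonglongrightarrow> C * 0"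
    by (intro tendsto_mult_left LIMSEQ_inverse_real_of_nat)
  ultimately have "norm (f t) \<le> C * 0" by (intro LIMSEQ_le_const) auto
  then show ?thesis by simp
qed

section \<open>Uniqueness from the step coefficients at time 1\<close>

lemma L2_step_self_in_K_upto: "L2_step c t \<in> K_upto t"
  by (rule L2_step_in_K_upto) simp

lemma norm_L2_step: "0 \<le> t \<Longrightarrow> norm (L2_step c t) = sqrt t * norm c"
proof -
  assume t: "0 \<le> t"
  have "complex_of_real ((norm (L2_step c t))\<^sup>2) = complex_of_real ((sqrt t * norm c)\<^sup>2)"
    using t by (simp only: cinner_self[symmetric] cinner_L2_step[OF t] power_mult_distrib of_real_mult
        real_sqrt_pow2)
  then show ?thesis using t by (simp only: of_real_eq_iff) (simp add: power2_eq_iff_nonneg)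
qed

text \<open>Supplies the bound on the unit interval for the functional equation.\<close>

lemma additive_section_norm_le:
  assumes a: "additive_section a" and t: "0 < t" "t \<le> 1"
  shows "norm (a t) \<le> norm (a 1)"
proof (cases "t = 1")
  case False
  then have "(norm (a 1))\<^sup>2 = (norm (a t))\<^sup>2 + (norm (a (1 - t)))\<^sup>2"
    using additive_section_norm_add[OF a t(1), of "1 - t"] t by simp
  then have "(norm (a t))\<^sup>2 \<le> (norm (a 1))\<^sup>2" by simp
  then show ?thesis by (rule power2_le_imp_le) simp
qed simp

lemma additive_section_eq_0:
  fixes b :: "real \<Rightarrow> 'k::{complex_hilbert_space, second_countable_topology} fock"
  assumes b: "additive_section b" and orth: "\<And>c. cinner (one_particle (L2_step c 1)) (b 1) = 0" and t: "0 < t"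
  shows "b t = 0"
proof -
  \<comment> \<open>When interval and time agree, cutting both at s produces objects of the same
    kind, so the pairing is additive in u.\<close>
  have diag: "cinner (one_particle (L2_step c u)) (b u) = 0" if "0 < u" for c u
  proof (rule additive_bounded_zero[where f = "\<lambda>u. cinner (one_particle (L2_step c u)) (b u)"])
    show "cinner (one_particle (L2_step c (s + t))) (b (s + t))
        = cinner (one_particle (L2_step c s)) (b s) + cinner (one_particle (L2_step c t)) (b t)"
      if "0 < s" "0 < t" for s t
      using additive_section_one_particle[OF b that L2_step_self_in_K_upto[of c]] that
      by (simp add: L2_truncate_step L2_unshift_step)
    show "norm (cinner (one_particle (L2_step c u)) (b u)) \<le> norm c * norm (b 1)" if "0 < u" "u \<le> 1" for u
    proof -
      have "norm (cinner (one_particle (L2_step c u)) (b u)) \<le> norm (one_particle (L2_step c u)) * norm (b u)"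
        by (rule cmod_cinner_le)
      also have "\<dots> = sqrt u * norm c * norm (b u)"
        using that by (simp add: norm_one_particle norm_L2_step)
      also have "\<dots> \<le> 1 * norm c * norm (b 1)"
        using that additive_section_norm_le[OF b that] by (intro mult_mono) auto
      finally show ?thesis by simp
    qed
  qed (use orth that in auto)
  \<comment> \<open>A shorter step vanishes after s, so the root equation replaces t by s; a longer
    one is seen by \<open>b t\<close> only up to t. Both cases reduce to
    \<open>diag\<close>.\<close>
  have steps: "cinner (one_particle (L2_step c s)) (b t) = 0" if s: "0 < s" for c s
  proof (cases "s < t")
    case True
    have eq: "s + (t - s) = t" by simp
    have "L2_step c s \<in> K_upto (s + (t - s))" using True by (intro L2_step_in_K_upto) simp
    moreover have "L2_unshift s (L2_step c s) = 0"
      using L2_unshift_truncate_self[of s "L2_step c s"] s by (simp add: L2_truncate_step)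
    ultimately have "cinner (one_particle (L2_step c s)) (b t) = cinner (one_particle (L2_step c s)) (b s)"
      using additive_section_one_particle[OF b s, of "t - s" "L2_step c s"] True
      by (simp add: L2_truncate_step)
    then show ?thesis using diag[OF s] by simp
  next
    case False
    have "cinner (one_particle (L2_step c s)) (b t) = cinner (one_particle (L2_step c t)) (b t)"
      using b t False cinner_one_particle_truncate[of "b t" t "L2_step c s"]
      by (simp add: additive_section_def L2_truncate_step min_absorb1)
    then show ?thesis using diag[OF t] by simp
  qed
  \<comment> \<open>The admissible g form a closed subspace containing the steps, hence are all of
    L2. As \<open>expvec h\<close> acts on \<open>b t\<close> like \<open>one_particle h\<close>,
    every test against the fibre then gives 0.\<close>
  have "closure (cspan {L2_step c s | c s. 0 < s}) \<subseteq> {g. cinner (one_particle g) (b t) = 0}"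
  proof (rule closure_cspan_minimal)
    show "{L2_step c s | c s. 0 < s} \<subseteq> {g. cinner (one_particle g) (b t) = 0}"
      using steps by blast
    show "csubspace {g. cinner (one_particle g) (b t) = 0}"
      by (rule complex_vector.subspaceI)
        (auto simp: one_particle_add one_particle_scaleC cinner_add_left cinner_scaleC_left)
    have "bounded_linear one_particle"
      by (rule bounded_linear_intro[of _ 1])
        (simp_all add: one_particle_add one_particle_scaleC scaleR_scaleC norm_one_particle)
    then show "closed {g. cinner (one_particle g) (b t) = 0}"
      by (intro closed_Collect_eq_sequential tendsto_cinner tendsto_const) (rule bounded_linear.tendsto)
  qed
  then have one: "cinner (one_particle g) (b t) = 0" for g
    unfolding L2_steps_total by auto
  have bt: "b t \<in> fibre t" using b t by (simp add: additive_section_def)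
  show ?thesis
  proof (rule fibre_eqI[OF bt complex_vector.subspace_0[OF csubspace_fibre]])
    fix h :: "'k L2" assume "h \<in> K_upto t"
    then show "cinner (expvec h) (b t) = cinner (expvec h) 0"
      using cinner_expvec_additive_section[OF b t] one by simp
  qed
qed

section \<open>The sections \<open>chi\<close> and their exhaustion of the roots\<close>

lemma chi_eq: "0 < t \<Longrightarrow> chi c t = one_particle (L2_step c t)"
  by (simp add: chi_def one_particle_def)

lemma chi_nonpos: "t \<le> 0 \<Longrightarrow> chi c t = 0"
  by (simp add: chi_def)

lemma chi_add: "chi (c + d) = (\<lambda>t. chi c t + chi d t)"
proof
  show "chi (c + d) t = chi c t + chi d t" for t
    by (cases "0 < t") (simp_all add: chi_eq chi_nonpos L2_step_add one_particle_add)
qed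

lemma chi_scaleC: "chi (z *\<^sub>C c) = (\<lambda>t. z *\<^sub>C chi c t)"
proof
  show "chi (z *\<^sub>C c) t = z *\<^sub>C chi c t" for t
    by (cases "0 < t") (simp_all add: chi_eq chi_nonpos L2_step_scaleC one_particle_scaleC)
qed

lemma root_inner_chi: "root_inner (chi c) (chi d) = cinner c d"
  by (simp add: root_inner_def chi_eq cinner_one_particle cinner_L2_step)

text \<open>The source of measurability: the difference of two steps with value c is c on an
  interval of length |t - s|, so \<open>chi c\<close> is Hoelder continuous of order 1/2.\<close>

lemma continuous_on_chi: "continuous_on {0<..} (chi c)"
proof -
  have le: "(norm (chi c t - chi c s))\<^sup>2 = \<bar>t - s\<bar> * (norm c)\<^sup>2" if "0 < s" "s \<le> t" for s t
  proof -
    have st: "cinner (L2_step c s) (L2_step c t) = of_real s * cinner c c"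
      using cinner_L2_truncate[of s "L2_step c s" "L2_step c t"] that
      by (simp add: L2_truncate_step cinner_L2_step)
    then have ts: "cinner (L2_step c t) (L2_step c s) = of_real s * cinner c c"
      by (metis cinner_commute complex_cnj_complex_of_real complex_cnj_mult)
    have "cinner (chi c t - chi c s) (chi c t - chi c s) = of_real (t - s) * cinner c c"
      using that by (simp add: chi_eq cinner_diff_left cinner_diff_right cinner_one_particle cinner_L2_step st ts
          algebra_simps)
    then have "complex_of_real ((norm (chi c t - chi c s))\<^sup>2) = complex_of_real (\<bar>t - s\<bar> * (norm c)\<^sup>2)"
      using that by (simp add: cinner_self)
    then show ?thesis by (simp only: of_real_eq_iff)
  qed
  have dist: "norm (chi c t - chi c s) = sqrt (\<bar>t - s\<bar> * (norm c)\<^sup>2)" if "0 < s" "0 < t" for s t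
  proof (rule real_sqrt_unique[symmetric])
    show "(norm (chi c t - chi c s))\<^sup>2 = \<bar>t - s\<bar> * (norm c)\<^sup>2"
      using le[of s t] le[of t s] that by (cases "s \<le> t") (auto simp: norm_minus_commute abs_minus_commute)
  qed simp
  show ?thesis
    unfolding continuous_on_def
  proof
    fix s :: real assume s: "s \<in> {0<..}"
    have lim: "((\<lambda>t. sqrt (\<bar>t - s\<bar> * (norm c)\<^sup>2)) \<longlongrightarrow> sqrt (\<bar>s - s\<bar> * (norm c)\<^sup>2)) (at s within {0<..})"
      by (intro tendsto_intros)
    have "((\<lambda>t. chi c t - chi c s) \<longlongrightarrow> 0) (at s within {0<..})"
    proof (rule Lim_null_comparison)
      show "\<forall>\<^sub>F t in at s within {0<..}. norm (chi c t - chi c s) \<le> sqrt (\<bar>t - s\<bar> * (norm c)\<^sup>2)"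
        using dist s by (auto simp: eventually_at_filter)
    qed (use lim in simp)
    then show "(chi c \<longlongrightarrow> chi c s) (at s within {0<..})" by (rule LIM_zero_cancel)
  qed
qed

text \<open>The root equation is the decomposition of a step on [0, s + t[ into a step on [0, s[ and
  a shifted step on [s, s + t[.\<close>

lemma chi_in_roots: "chi c \<in> roots vacuum"
  unfolding roots_vacuum_iff
proof
  have "chi c \<in> borel_measurable (restrict_space borel {0<..})"
    by (rule borel_measurable_continuous_on_restrict[OF continuous_on_chi])
  then show "measurable_section (chi c)"
    by (auto simp: measurable_section_def chi_eq chi_nonpos measurable_restrict_space2_iff space_restrict_space
        one_particle_in_sym_fock intro!: one_particle_in_fibre L2_step_self_in_K_upto)
  show "additive_section (chi c)"
    unfolding additive_section_iff
  proof (intro conjI allI impI)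
    fix s t :: real assume st: "0 < s" "0 < t"
    have "fock_mult s t (chi c s) (expvec 0) = one_particle (L2_step c s)"
      using st by (simp add: chi_eq fock_mult_vacuum_right one_particle_in_fibre L2_step_self_in_K_upto)
    moreover have "fock_mult s t (expvec 0) (chi c t) = one_particle (L2_shift s (L2_step c t))"
      using st by (simp add: chi_eq fock_mult_vacuum_one_particle L2_step_self_in_K_upto)
    ultimately show "chi c (s + t) = fock_mult s t (chi c s) (expvec 0) + fock_mult s t (expvec 0) (chi c t)"
      using st by (simp add: chi_eq L2_step_add_time one_particle_add)
  qed (auto simp: chi_eq cinner_expvec_one_particle intro!: one_particle_in_fibre L2_step_self_in_K_upto)
qed

lemma roots_subset_range_chi:
  fixes a :: "real \<Rightarrow> 'k::{complex_hilbert_space, second_countable_topology} fock"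
  assumes "a \<in> roots vacuum"
  shows "a \<in> range chi"
proof -
  have a: "measurable_section a" "additive_section a" using assms by (auto simp: roots_vacuum_iff)
  have chi: "additive_section (chi d)" for d :: 'k using chi_in_roots by (auto simp: roots_vacuum_iff)
  let ?V = "range (\<lambda>c :: 'k. chi c 1)"
  have norm: "norm (chi c 1) = norm c" for c :: 'k
    unfolding norm_eq_iff_cinner using root_inner_chi[of c c] by (simp add: root_inner_def)
  have "bounded_linear (\<lambda>c :: 'k. chi c 1)"
    by (rule bounded_linear_intro[of _ 1]) (simp_all add: chi_add chi_scaleC scaleR_scaleC norm)
  \<comment> \<open>An isometric image of a Hilbert space is complete, hence closed, so the
    projection onto it exists.\<close>
  then have "complete ?V"
    by (intro complete_isometric_image[of 1] complete_UNIV) (auto simp: norm)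
  then have closed: "closed ?V" by (simp add: complete_eq_closed)
  have sub: "csubspace ?V"
  proof (rule complex_vector.subspaceI)
    show "0 \<in> ?V" using norm[of 0] by (intro range_eqI[of _ _ 0]) simp
  qed (auto simp flip: fun_cong[OF chi_add] fun_cong[OF chi_scaleC])
  obtain d where d: "\<And>v. v \<in> ?V \<Longrightarrow> cinner v (a 1 - chi d 1) = 0"
    using orthogonal_projection[OF sub closed, of "a 1"] by (metis rangeE)
  have "a t = chi d t" for t
  proof (cases "0 < t")
    case True
    have "a t - chi d t = 0"
    proof (rule additive_section_eq_0[OF additive_section_diff[OF a(2) chi] _ True])
      show "cinner (one_particle (L2_step c 1)) (a 1 - chi d 1) = 0" for c
        using d[of "chi c 1"] by (simp add: chi_eq)
    qed
    then show ?thesis by simp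
  next
    case False
    \<comment> \<open>At t \<le> 0 both sections are 0 by the encoding of sections.\<close>
    then show ?thesis using a(1) by (simp add: measurable_section_def chi_nonpos)
  qed
  then show ?thesis by (intro range_eqI[of _ _ d]) auto
qed

theorem proposition3p3:
  shows "bij_betw (chi :: 'k::{complex_hilbert_space, second_countable_topology} \<Rightarrow> real \<Rightarrow> 'k fock)
           UNIV (roots vacuum) \<and>
         (\<forall>c d :: 'k. chi (c + d) = (\<lambda>t. chi c t + chi d t)) \<and>
         (\<forall>(z :: complex) (c :: 'k). chi (z *\<^sub>C c) = (\<lambda>t. z *\<^sub>C chi c t)) \<and>
         (\<forall>c d :: 'k. root_inner (chi c) (chi d) = cinner c d)"
proof (intro conjI allI)
  have "inj (chi :: 'k \<Rightarrow> real \<Rightarrow> 'k fock)"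
  proof (rule injI)
    fix c d :: 'k assume eq: "chi c = chi d"
    \<comment> \<open><c - d, c> and <c - d, d> are both \<open>root_inner\<close> of
      \<open>chi (c - d)\<close> with the common section, hence equal.\<close>
    have "cinner (c - d) (c - d) = 0"
      using root_inner_chi[of "c - d" c] root_inner_chi[of "c - d" d] unfolding eq by (simp add: cinner_diff_right)
    then show "c = d" by (simp add: cinner_self)
  qed
  moreover have "range (chi :: 'k \<Rightarrow> real \<Rightarrow> 'k fock) = roots vacuum"
    using chi_in_roots roots_subset_range_chi by blast
  ultimately show "bij_betw (chi :: 'k \<Rightarrow> real \<Rightarrow> 'k fock) UNIV (roots vacuum)"
    by (simp add: bij_betw_def)
qed (rule chi_add chi_scaleC root_inner_chi)+

end
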